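(* Let $u\in\mathcal{K}_E(H)$ $(\subset \mathcal{K}_E(K))$. (a) If $u$ is positive, then there is a $u$-orthonormal sequence $(\xi_n)_{n\in\mathbb{N}}$ in $K$ such that $$u=\sum_{n\in\mathbb{N}}\theta_n(u)\,\xi_n\langle\,\cdot\,|\,\xi_n\rangle\qquad\text{(in }\mathcal{K}_E(K)).$$ In this case $u\xi_n=\theta_n(u)\xi_n\in H$ for all $n\in\mathbb{N}$. (b) There are $u$-orthonormal sequences $(\xi_n)_{n\in\mathbb{N}}$ and $(\eta_n)_{n\in\mathbb{N}}$ in $K$ such that $$u=\sum_{n\in\mathbb{N}}\theta_n(u)\,\xi_n\langle\,\cdot\,|\,\eta_n\rangle\qquad\text{(in }\mathcal{K}_E(K)).$$
   Context: $\mathbb{K}$ is $\mathbb{R}$ or $\mathbb{C}$; $\mathbb{N}=\{1,2,\dots\}$. $T$ is a compact hyperstonian space and $E:=\mathcal{C}(T)$ is the commutative C*-algebra (in fact W*-algebra) of continuous $\mathbb{K}$-valued functions on $T$. $(p_\iota)_{\iota\in I}$ is a family of projections of $E$. $K$ is the selfdual Hilbert right $E$-module given by the W*-direct sum of the $p_\iota E$: families $\xi=(\xi_\iota)_{\iota\in I}$ with $\xi_\iota\in p_\iota E$ for which the finite partial sums of $\sum_\iota \xi_\iota^*\xi_\iota$ are bounded, with $\langle\xi|\eta\rangle=\sum_{\iota}\eta_\iota^*\xi_\iota$ (weak* sum in $E$). $H\subset K$ is the C*-direct sum of the $p_\iota E$: families for which $\sum_\iota\xi_\iota^*\xi_\iota$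 is norm-summable in $E$. Inner products are $E$-linear in the first variable. $\mathcal{L}_E(\cdot)$ denotes the C*-algebra of adjointable operators, and $\mathcal{K}_E(\cdot)$ its C*-subalgebra of "compact" operators, i.e. the closed linear span of the operators $\xi\langle\cdot|\eta\rangle:\zeta\mapsto\xi\langle\zeta|\eta\rangle$; the inclusion $\mathcal{K}_E(H)\subset\mathcal{K}_E(K)$ is the one letting $\xi\langle\cdot|\eta\rangle$ ($\xi,\eta\in H$) act on $K$. An element of $E$ multiplies operators and module elements in the obvious way ($E$ is commutative). For $t\in T$ let $\psi:l^2(I)\to H$, $\zeta\mapsto(\zeta_\iota p_\iota)_\iota$; $\psi_t:H\to l^2(I)$, $\xi\mapsto(\xi_\iota(t))_\iota$; and $\varphi_t:\mathcal{L}_E(H)\to\mathcal{L}(l^2(I))$, $u\mapsto\psi_t\circ u\circ\psi$. For $u\in\mathcal{K}_E(H)$ the map $t\mapsto\varphi_tu$ is continuous from $T$ into the compact operators $\mathcal{K}(l^2(I))$. For a compact operator $x$ on a Hilbert space, $\theta_n(x)$ is its $n$-th singular value (eigenvalues of $|x|$ in decreasing order with multiplicity, completed by $0$). For $u\in\mathcal{K}_E(H)$, $\theta_n(u)\in E$ is the continuous function $t\mapsto\theta_n(\varphi_tu)$. For $\xi\in K$, $t\in T$ put $\xi(t):=(\xi_\iota(t))_{\iota\in I}\in l^2(I)$. For $u\in\mathcal{K}_E(H)$ put $U_n(u):=\{t\in T: \theta_n(\varphi_tu)\neq0\}$ and let $e_n(u)\in E$ be the indicator function of the clopen set $\overline{U_n(u)}$.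 A sequence $(\xi_n)_{n\in\mathbb{N}}$ in $K$ is $u$-orthonormal if for all $m\le n$ one has $\langle\xi_m|\xi_n\rangle=\delta_{m,n}e_n(u)$ and, for each $n$, the map $U_n(u)\to l^2(I)$, $t\mapsto\xi_n(t)$ is (norm) continuous. *)

theory Defs
  imports "HOL-Analysis.Analysis" "HOL-Library.Function_Algebras"
begin

text \<open>
  The field of scalars is the real or the complex numbers. Up to isomorphism these are the only
  two instances of the class below: by Gelfand-Mazur a real normed field is \<open>\<real>\<close> or \<open>\<complex>\<close>, and the
  last axiom makes \<open>kconj\<close> the usual conjugation.
\<close>

class rclike = real_normed_field + euclidean_space +
  fixes kconj :: "'a \<Rightarrow> 'a"
  assumes kconj_add: "kconj (x + y) = kconj x + kconj y"
    and kconj_mult: "kconj (x * y) = kconj x * kconj y"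
    and kconj_scaleR_1: "kconj (r *\<^sub>R 1) = r *\<^sub>R 1"
    and mult_kconj: "x * kconj x = (norm x)\<^sup>2 *\<^sub>R 1"

instantiation real :: rclike
begin
definition kconj_real :: "real \<Rightarrow> real" where "kconj_real x = x"
instance by standard (auto simp: kconj_real_def power2_eq_square)
end

instantiation complex :: rclike
begin
definition kconj_complex :: "complex \<Rightarrow> complex" where "kconj_complex = cnj"
instance
proof
  fix x y :: complex and r :: real
  show "kconj (x + y) = kconj x + kconj y" "kconj (x * y) = kconj x * kconj y"
    "kconj (r *\<^sub>R 1) = (r *\<^sub>R 1 :: complex)"
    by (simp_all add: kconj_complex_def)
  show "x * kconj x = (norm x)\<^sup>2 *\<^sub>R 1"
    using complex_norm_square[of x] by (simp add: kconj_complex_def scaleR_conv_of_real)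
qed
end

text \<open>
  On a compact space every continuous function is bounded, so the library type \<open>'t \<Rightarrow>\<^sub>C 'k\<close> with
  its supremum norm is \<open>\<C>(T)\<close>; only the multiplication and the involution are missing.
\<close>

instantiation bcontfun :: (topological_space, real_normed_field) "{comm_ring_1, real_normed_algebra_1}"
begin

definition times_bcontfun :: "('a \<Rightarrow>\<^sub>C 'b) \<Rightarrow> ('a \<Rightarrow>\<^sub>C 'b) \<Rightarrow> 'a \<Rightarrow>\<^sub>C 'b"
  where "times_bcontfun f g = Bcontfun (\<lambda>t. f t * g t)"

definition one_bcontfun :: "'a \<Rightarrow>\<^sub>C 'b"
  where "one_bcontfun = const_bcontfun 1"

lemma apply_bcontfun_times [simp]:
  fixes f g :: "'a \<Rightarrow>\<^sub>C 'b"
  shows "apply_bcontfun (f * g) t = f t * g t"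
proof -
  have "norm (f x * g x) \<le> norm f * norm g" for x
    by (simp add: norm_mult mult_mono norm_bounded)
  then have "(\<lambda>t. f t * g t) \<in> bcontfun"
    by (intro bcontfun_normI) (auto intro!: continuous_intros)
  then show ?thesis
    by (simp add: times_bcontfun_def Bcontfun_inverse)
qed

lemma apply_bcontfun_one [simp]: "apply_bcontfun (1 :: 'a \<Rightarrow>\<^sub>C 'b) t = 1"
  by (simp add: one_bcontfun_def)

instance
proof
  fix f g h :: "'a \<Rightarrow>\<^sub>C 'b" and r :: real
  show "f * g * h = f * (g * h)" by (rule bcontfun_eqI) (simp add: mult.assoc)
  show "f * g = g * f" by (rule bcontfun_eqI) (simp add: mult.commute)
  show "1 * f = f" by (rule bcontfun_eqI) simp
  show "(f + g) * h = f * h + g * h" by (rule bcontfun_eqI) (simp add: distrib_right)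
  show "f * (g + h) = f * g + f * h" by (rule bcontfun_eqI) (simp add: distrib_left)
  show "f * 1 = f" by (rule bcontfun_eqI) simp
  show "r *\<^sub>R f * g = r *\<^sub>R (f * g)" by (rule bcontfun_eqI) simp
  show "f * r *\<^sub>R g = r *\<^sub>R (f * g)" by (rule bcontfun_eqI) simp
  have "apply_bcontfun (0 :: 'a \<Rightarrow>\<^sub>C 'b) undefined \<noteq> apply_bcontfun 1 undefined" by simp
  then show "(0 :: 'a \<Rightarrow>\<^sub>C 'b) \<noteq> 1" by metis
  show "norm (f * g) \<le> norm f * norm g"
    by (rule norm_bound) (simp add: norm_mult mult_mono norm_bounded)
  show "norm (1 :: 'a \<Rightarrow>\<^sub>C 'b) = 1"
    using norm_bound[of "1 :: 'a \<Rightarrow>\<^sub>C 'b" 1] norm_bounded[of "1 :: 'a \<Rightarrow>\<^sub>C 'b" undefined]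
    by simp
qed

end

definition bstar :: "('t::topological_space \<Rightarrow>\<^sub>C 'k::rclike) \<Rightarrow> 't \<Rightarrow>\<^sub>C 'k"
  where "bstar f = Bcontfun (\<lambda>t. kconj (f t))"

definition projection :: "('t::topological_space \<Rightarrow>\<^sub>C 'k::rclike) \<Rightarrow> bool"
  where "projection q \<longleftrightarrow> q * q = q \<and> bstar q = q"

definition is_lub_C :: "('t::topological_space \<Rightarrow>\<^sub>C real) set \<Rightarrow> ('t \<Rightarrow>\<^sub>C real) \<Rightarrow> bool"
  where "is_lub_C F f \<longleftrightarrow>
    (\<forall>g\<in>F. \<forall>t. g t \<le> f t) \<and>
    (\<forall>h :: 't \<Rightarrow>\<^sub>C real. (\<forall>g\<in>F. \<forall>t. g t \<le> h t) \<longrightarrow> (\<forall>t. f t \<le> h t))"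

text \<open>
  Positive Radon measures that are order continuous on the real-valued continuous functions.
  The supremum \<open>f\<close> is the one of the ordered space \<open>\<C>(T)\<close>, not the pointwise one.
\<close>

definition normal_measure :: "'t::topological_space measure \<Rightarrow> bool"
  where "normal_measure M \<longleftrightarrow>
    sets M = sets borel \<and> finite_measure M \<and>
    (\<forall>A\<in>sets borel. emeasure M A = (SUP C\<in>{C. compact C \<and> C \<subseteq> A}. emeasure M C)) \<and>
    (\<forall>(F :: ('t \<Rightarrow>\<^sub>C real) set) f.
       F \<noteq> {} \<and>
       (\<forall>g\<in>F. \<forall>h\<in>F. \<exists>k\<in>F. \<forall>t.
         apply_bcontfun g t \<le> apply_bcontfun k t \<and> apply_bcontfun h t \<le> apply_bcontfun k t) \<and>
       is_lub_C F f \<longrightarrow>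
       (\<integral>t. apply_bcontfun f t \<partial>M) = (SUP g\<in>F. (\<integral>t. apply_bcontfun g t \<partial>M)))"

definition measure_support :: "'t::topological_space measure \<Rightarrow> 't set"
  where "measure_support M = {t. \<forall>U. open U \<and> t \<in> U \<longrightarrow> emeasure M U > 0}"

definition hyperstonian :: "'t::t2_space itself \<Rightarrow> bool"
  where "hyperstonian _ \<longleftrightarrow>
    compact (UNIV :: 't set) \<and>
    (\<forall>U :: 't set. open U \<longrightarrow> open (closure U)) \<and>
    closure (\<Union>M\<in>{M :: 't measure. normal_measure M}. measure_support M) = UNIV"

text \<open>
  The predual of \<open>\<C>(T)\<close> for hyperstonian \<open>T\<close> is spanned by the (positive) normal measures, so weak*
  convergence means convergence of the integrals against all of them.
\<close>

definition has_weak_star_sum ::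
    "('i \<Rightarrow> ('t::topological_space \<Rightarrow>\<^sub>C 'k::rclike)) \<Rightarrow> ('t \<Rightarrow>\<^sub>C 'k) \<Rightarrow> 'i set \<Rightarrow> bool"
  where "has_weak_star_sum f g I \<longleftrightarrow>
    (\<forall>M. normal_measure M \<longrightarrow> ((\<lambda>i. \<integral>t. f i t \<partial>M) has_sum (\<integral>t. g t \<partial>M)) I)"

text \<open>
  A family indexed by \<open>I\<close> is represented by a total function that vanishes outside \<open>I\<close>.
\<close>

definition Kmod ::
    "'i set \<Rightarrow> ('i \<Rightarrow> ('t::topological_space \<Rightarrow>\<^sub>C 'k::rclike)) \<Rightarrow> ('i \<Rightarrow> ('t \<Rightarrow>\<^sub>C 'k)) set"
  where "Kmod I p =
    {\<xi>. (\<forall>i\<in>I. \<xi> i \<in> range ((*) (p i))) \<and> (\<forall>i. i \<notin> I \<longrightarrow> \<xi> i = 0) \<and>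
        bounded ((\<lambda>F. \<Sum>i\<in>F. bstar (\<xi> i) * \<xi> i) ` {F. finite F \<and> F \<subseteq> I})}"

definition Hmod ::
    "'i set \<Rightarrow> ('i \<Rightarrow> ('t::topological_space \<Rightarrow>\<^sub>C 'k::rclike)) \<Rightarrow> ('i \<Rightarrow> ('t \<Rightarrow>\<^sub>C 'k)) set"
  where "Hmod I p =
    {\<xi>. (\<forall>i\<in>I. \<xi> i \<in> range ((*) (p i))) \<and> (\<forall>i. i \<notin> I \<longrightarrow> \<xi> i = 0) \<and>
        (\<lambda>i. bstar (\<xi> i) * \<xi> i) summable_on I}"

text \<open>
  The inner product of \<open>K\<close>, used for the submodule \<open>H\<close> as well; on \<open>H\<close> the sum even converges in norm.
\<close>

definition mod_inner ::
    "'i set \<Rightarrow> ('i \<Rightarrow> ('t::topological_space \<Rightarrow>\<^sub>C 'k::rclike)) \<Rightarrow> ('i \<Rightarrow> ('t \<Rightarrow>\<^sub>C 'k)) \<Rightarrow> 't \<Rightarrow>\<^sub>C 'k"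
  where "mod_inner I \<xi> \<eta> = (THE g. has_weak_star_sum (\<lambda>i. bstar (\<eta> i) * \<xi> i) g I)"

definition mod_norm :: "'i set \<Rightarrow> ('i \<Rightarrow> ('t::topological_space \<Rightarrow>\<^sub>C 'k::rclike)) \<Rightarrow> real"
  where "mod_norm I \<xi> = sqrt (norm (mod_inner I \<xi> \<xi>))"

text \<open>
  Below \<open>X\<close> is the carrier \<open>H\<close> or \<open>K\<close>. Operators on \<open>X\<close> are elements of \<open>X \<rightarrow>\<^sub>E X\<close>, so that equality of
  operators is equality of functions.
\<close>

type_synonym ('i, 't, 'k) mod_op = "('i \<Rightarrow> ('t \<Rightarrow>\<^sub>C 'k)) \<Rightarrow> 'i \<Rightarrow> ('t \<Rightarrow>\<^sub>C 'k)"

definition adjointable_ops ::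
    "'i set \<Rightarrow> ('i \<Rightarrow> ('t::topological_space \<Rightarrow>\<^sub>C 'k::rclike)) set \<Rightarrow> ('i, 't, 'k) mod_op set"
  where "adjointable_ops I X =
    {u \<in> X \<rightarrow>\<^sub>E X. \<exists>v \<in> X \<rightarrow>\<^sub>E X. \<forall>\<xi>\<in>X. \<forall>\<eta>\<in>X. mod_inner I (u \<xi>) \<eta> = mod_inner I \<xi> (v \<eta>)}"

definition mod_adjoint ::
    "'i set \<Rightarrow> ('i \<Rightarrow> ('t::topological_space \<Rightarrow>\<^sub>C 'k::rclike)) set \<Rightarrow> ('i, 't, 'k) mod_op
      \<Rightarrow> ('i, 't, 'k) mod_op"
  where "mod_adjoint I X u =
    (THE v. v \<in> X \<rightarrow>\<^sub>E X \<and> (\<forall>\<xi>\<in>X. \<forall>\<eta>\<in>X. mod_inner I (u \<xi>) \<eta> = mod_inner I \<xi> (v \<eta>)))"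

text \<open>Positive elements of the C*-algebra of adjointable operators are those of the form \<open>v* v\<close>.\<close>

definition positive_op ::
    "'i set \<Rightarrow> ('i \<Rightarrow> ('t::topological_space \<Rightarrow>\<^sub>C 'k::rclike)) set \<Rightarrow> ('i, 't, 'k) mod_op \<Rightarrow> bool"
  where "positive_op I X u \<longleftrightarrow> (\<exists>v\<in>adjointable_ops I X. u = compose X (mod_adjoint I X v) v)"

definition rank_one ::
    "'i set \<Rightarrow> ('i \<Rightarrow> ('t::topological_space \<Rightarrow>\<^sub>C 'k::rclike)) set
      \<Rightarrow> ('i \<Rightarrow> ('t \<Rightarrow>\<^sub>C 'k)) \<Rightarrow> ('i \<Rightarrow> ('t \<Rightarrow>\<^sub>C 'k)) \<Rightarrow> ('i, 't, 'k) mod_op"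
  where "rank_one I X \<xi> \<eta> = (\<lambda>\<zeta>\<in>X. \<lambda>i. \<xi> i * mod_inner I \<zeta> \<eta>)"

text \<open>
  Scalar coefficients can be absorbed into the \<open>\<xi> k\<close>, so these are all linear combinations of
  operators of rank one.
\<close>

definition rank_one_sum ::
    "'i set \<Rightarrow> ('i \<Rightarrow> ('t::topological_space \<Rightarrow>\<^sub>C 'k::rclike)) set
      \<Rightarrow> nat \<Rightarrow> (nat \<Rightarrow> 'i \<Rightarrow> ('t \<Rightarrow>\<^sub>C 'k)) \<Rightarrow> (nat \<Rightarrow> 'i \<Rightarrow> ('t \<Rightarrow>\<^sub>C 'k)) \<Rightarrow> ('i, 't, 'k) mod_op"
  where "rank_one_sum I X N \<xi> \<eta> = (\<lambda>\<zeta>\<in>X. \<Sum>k<N. rank_one I X (\<xi> k) (\<eta> k) \<zeta>)"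

text \<open>\<open>op_near I X e u v\<close> says that the operator norm of \<open>u - v\<close> on \<open>X\<close> is at most \<open>e\<close>.\<close>

definition op_near ::
    "'i set \<Rightarrow> ('i \<Rightarrow> ('t::topological_space \<Rightarrow>\<^sub>C 'k::rclike)) set \<Rightarrow> real
      \<Rightarrow> ('i, 't, 'k) mod_op \<Rightarrow> ('i, 't, 'k) mod_op \<Rightarrow> bool"
  where "op_near I X e u v \<longleftrightarrow> (\<forall>\<zeta>\<in>X. mod_norm I (u \<zeta> - v \<zeta>) \<le> e * mod_norm I \<zeta>)"

definition compact_ops ::
    "'i set \<Rightarrow> ('i \<Rightarrow> ('t::topological_space \<Rightarrow>\<^sub>C 'k::rclike)) set \<Rightarrow> ('i, 't, 'k) mod_op set"
  where "compact_ops I X =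
    {u \<in> adjointable_ops I X. \<forall>e>0. \<exists>N \<xi> \<eta>.
       (\<forall>k<N. \<xi> k \<in> X \<and> \<eta> k \<in> X) \<and> op_near I X e u (rank_one_sum I X N \<xi> \<eta>)}"

text \<open>
  The inclusion of the compact operators on \<open>H\<close> into those on \<open>K\<close>: the continuous map sending each
  finite sum of operators of rank one with vectors in \<open>H\<close>, regarded on \<open>H\<close>, to the same sum
  regarded on \<open>K\<close>.
\<close>

definition compact_incl ::
    "'i set \<Rightarrow> ('i \<Rightarrow> ('t::topological_space \<Rightarrow>\<^sub>C 'k::rclike)) \<Rightarrow> ('i, 't, 'k) mod_op
      \<Rightarrow> ('i, 't, 'k) mod_op"
  where "compact_incl I p u = (THE v. v \<in> compact_ops I (Kmod I p) \<and>
    (\<forall>e>0. \<exists>N \<xi> \<eta>. (\<forall>k<N. \<xi> k \<in> Hmod I p \<and> \<eta> k \<in> Hmod I p) \<and>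
       op_near I (Hmod I p) e u (rank_one_sum I (Hmod I p) N \<xi> \<eta>) \<and>
       op_near I (Kmod I p) e v (rank_one_sum I (Kmod I p) N \<xi> \<eta>)))"

definition scale_op ::
    "('i \<Rightarrow> ('t::topological_space \<Rightarrow>\<^sub>C 'k::rclike)) set \<Rightarrow> ('t \<Rightarrow>\<^sub>C 'k)
      \<Rightarrow> ('i, 't, 'k) mod_op \<Rightarrow> ('i, 't, 'k) mod_op"
  where "scale_op X a u = (\<lambda>\<zeta>\<in>X. \<lambda>i. a * u \<zeta> i)"

text \<open>
  Summability over the net of finite subsets of the index set, in the norm of the C*-algebra of
  compact operators on \<open>X\<close>. (The library relation \<open>has_sum\<close> would use the product topology here.)
\<close>

definition compact_has_sum ::
    "'i set \<Rightarrow> ('i \<Rightarrow> ('t::topological_space \<Rightarrow>\<^sub>C 'k::rclike)) set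
      \<Rightarrow> ('n \<Rightarrow> ('i, 't, 'k) mod_op) \<Rightarrow> ('i, 't, 'k) mod_op \<Rightarrow> 'n set \<Rightarrow> bool"
  where "compact_has_sum I X f u A \<longleftrightarrow>
    u \<in> compact_ops I X \<and> (\<forall>n\<in>A. f n \<in> compact_ops I X) \<and>
    (\<forall>e>0. \<exists>F0. finite F0 \<and> F0 \<subseteq> A \<and>
       (\<forall>F. finite F \<and> F0 \<subseteq> F \<and> F \<subseteq> A \<longrightarrow> op_near I X e u (\<lambda>\<zeta>. \<Sum>n\<in>F. f n \<zeta>)))"

definition l2 :: "'i set \<Rightarrow> ('i \<Rightarrow> 'k::rclike) set"
  where "l2 I = {x. (\<forall>i. i \<notin> I \<longrightarrow> x i = 0) \<and> (\<lambda>i. (norm (x i))\<^sup>2) summable_on I}"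

definition l2_inner :: "'i set \<Rightarrow> ('i \<Rightarrow> 'k::rclike) \<Rightarrow> ('i \<Rightarrow> 'k) \<Rightarrow> 'k"
  where "l2_inner I x y = (\<Sum>\<^sub>\<infinity>i\<in>I. x i * kconj (y i))"

definition l2_norm :: "'i set \<Rightarrow> ('i \<Rightarrow> 'k::rclike) \<Rightarrow> real"
  where "l2_norm I x = sqrt (\<Sum>\<^sub>\<infinity>i\<in>I. (norm (x i))\<^sup>2)"

definition l2_ops :: "'i set \<Rightarrow> (('i \<Rightarrow> 'k::rclike) \<Rightarrow> 'i \<Rightarrow> 'k) set"
  where "l2_ops I = {x \<in> l2 I \<rightarrow>\<^sub>E l2 I.
    (\<forall>\<zeta>\<in>l2 I. \<forall>\<omega>\<in>l2 I. x (\<zeta> + \<omega>) = x \<zeta> + x \<omega>) \<and>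
    (\<forall>c. \<forall>\<zeta>\<in>l2 I. x (\<lambda>i. c * \<zeta> i) = (\<lambda>i. c * x \<zeta> i)) \<and>
    (\<exists>B. \<forall>\<zeta>\<in>l2 I. l2_norm I (x \<zeta>) \<le> B * l2_norm I \<zeta>)}"

definition l2_adjoint ::
    "'i set \<Rightarrow> (('i \<Rightarrow> 'k::rclike) \<Rightarrow> 'i \<Rightarrow> 'k) \<Rightarrow> ('i \<Rightarrow> 'k) \<Rightarrow> 'i \<Rightarrow> 'k"
  where "l2_adjoint I x = (THE y. y \<in> l2_ops I \<and>
    (\<forall>\<zeta>\<in>l2 I. \<forall>\<omega>\<in>l2 I. l2_inner I (x \<zeta>) \<omega> = l2_inner I \<zeta> (y \<omega>)))"

definition l2_positive :: "'i set \<Rightarrow> (('i \<Rightarrow> 'k::rclike) \<Rightarrow> 'i \<Rightarrow> 'k) \<Rightarrow> bool"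
  where "l2_positive I y \<longleftrightarrow>
    y \<in> l2_ops I \<and> l2_adjoint I y = y \<and> (\<forall>\<zeta>\<in>l2 I. l2_inner I (y \<zeta>) \<zeta> \<in> \<real>\<^sub>\<ge>\<^sub>0)"

definition l2_abs ::
    "'i set \<Rightarrow> (('i \<Rightarrow> 'k::rclike) \<Rightarrow> 'i \<Rightarrow> 'k) \<Rightarrow> ('i \<Rightarrow> 'k) \<Rightarrow> 'i \<Rightarrow> 'k"
  where "l2_abs I x = (THE y. l2_positive I y \<and>
    compose (l2 I) y y = compose (l2 I) (l2_adjoint I x) x)"

definition eigen_mult :: "'i set \<Rightarrow> (('i \<Rightarrow> 'k::rclike) \<Rightarrow> 'i \<Rightarrow> 'k) \<Rightarrow> real \<Rightarrow> nat"
  where "eigen_mult I y r =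
    vector_space.dim (\<lambda>(c::'k) \<zeta> i. c * \<zeta> i) {\<zeta> \<in> l2 I. y \<zeta> = (\<lambda>i. of_real r * \<zeta> i)}"

text \<open>
  The decreasing enumeration of the strictly positive eigenvalues of the absolute value, each
  repeated according to its multiplicity and the whole completed by zeros. The description
  determines the sequence if \<open>x\<close> is compact. Singular values are numbered from 1, so that the
  \<open>n\<close>-th one is the entry at \<open>n - 1\<close>.
\<close>

definition singular_values :: "'i set \<Rightarrow> (('i \<Rightarrow> 'k::rclike) \<Rightarrow> 'i \<Rightarrow> 'k) \<Rightarrow> nat \<Rightarrow> real"
  where "singular_values I x = (THE s. decseq s \<and> (\<forall>n. s n \<ge> 0) \<and>
    (\<forall>r>0. finite {n. s n = r} \<and> card {n. s n = r} = eigen_mult I (l2_abs I x) r))"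

definition singular_value :: "'i set \<Rightarrow> nat \<Rightarrow> (('i \<Rightarrow> 'k::rclike) \<Rightarrow> 'i \<Rightarrow> 'k) \<Rightarrow> real"
  where "singular_value I n x = singular_values I x (n - 1)"

definition psi ::
    "('i \<Rightarrow> ('t::topological_space \<Rightarrow>\<^sub>C 'k::rclike)) \<Rightarrow> ('i \<Rightarrow> 'k) \<Rightarrow> 'i \<Rightarrow> ('t \<Rightarrow>\<^sub>C 'k)"
  where "psi p \<zeta> = (\<lambda>i. const_bcontfun (\<zeta> i) * p i)"

definition psi_at ::
    "'t \<Rightarrow> ('i \<Rightarrow> ('t::topological_space \<Rightarrow>\<^sub>C 'k::rclike)) \<Rightarrow> 'i \<Rightarrow> 'k"
  where "psi_at t \<xi> = (\<lambda>i. \<xi> i t)"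

definition phi ::
    "'i set \<Rightarrow> ('i \<Rightarrow> ('t::topological_space \<Rightarrow>\<^sub>C 'k::rclike)) \<Rightarrow> 't \<Rightarrow> ('i, 't, 'k) mod_op
      \<Rightarrow> ('i \<Rightarrow> 'k) \<Rightarrow> 'i \<Rightarrow> 'k"
  where "phi I p t u = (\<lambda>\<zeta>\<in>l2 I. psi_at t (u (psi p \<zeta>)))"

definition theta ::
    "'i set \<Rightarrow> ('i \<Rightarrow> ('t::topological_space \<Rightarrow>\<^sub>C 'k::rclike)) \<Rightarrow> nat \<Rightarrow> ('i, 't, 'k) mod_op
      \<Rightarrow> 't \<Rightarrow>\<^sub>C 'k"
  where "theta I p n u = Bcontfun (\<lambda>t. of_real (singular_value I n (phi I p t u)))"

definition U_set ::
    "'i set \<Rightarrow> ('i \<Rightarrow> ('t::topological_space \<Rightarrow>\<^sub>C 'k::rclike)) \<Rightarrow> nat \<Rightarrow> ('i, 't, 'k) mod_op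
      \<Rightarrow> 't set"
  where "U_set I p n u = {t. singular_value I n (phi I p t u) \<noteq> 0}"

definition e_fun ::
    "'i set \<Rightarrow> ('i \<Rightarrow> ('t::topological_space \<Rightarrow>\<^sub>C 'k::rclike)) \<Rightarrow> nat \<Rightarrow> ('i, 't, 'k) mod_op
      \<Rightarrow> 't \<Rightarrow>\<^sub>C 'k"
  where "e_fun I p n u = Bcontfun (indicator (closure (U_set I p n u)))"

text \<open>Sequences are indexed by \<open>n \<ge> 1\<close>; the value at \<open>0\<close> is irrelevant.\<close>

definition u_orthonormal ::
    "'i set \<Rightarrow> ('i \<Rightarrow> ('t::topological_space \<Rightarrow>\<^sub>C 'k::rclike)) \<Rightarrow> ('i, 't, 'k) mod_op
      \<Rightarrow> (nat \<Rightarrow> 'i \<Rightarrow> ('t \<Rightarrow>\<^sub>C 'k)) \<Rightarrow> bool"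
  where "u_orthonormal I p u \<xi> \<longleftrightarrow>
    (\<forall>n\<ge>1. \<xi> n \<in> Kmod I p) \<and>
    (\<forall>m\<ge>1. \<forall>n\<ge>m. mod_inner I (\<xi> m) (\<xi> n) = (if m = n then e_fun I p n u else 0)) \<and>
    (\<forall>n\<ge>1. \<forall>s\<in>U_set I p n u.
       ((\<lambda>t. l2_norm I (psi_at t (\<xi> n) - psi_at s (\<xi> n))) \<longlongrightarrow> 0) (at s within U_set I p n u))"

end

theory Submission
  imports Defs
begin

text \<open>
  The fibres \<open>v\<^sub>t = \<phi>\<^sub>t u\<close> form a norm continuous family of compact operators, uniform limits of families of
  fixed finite rank. The top eigenvalue of \<open>v\<^sub>t\<^sup>* v\<^sub>t\<close> depends continuously on \<open>t\<close>, and the pairs of \<open>t\<close> and a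
  top eigenvector with norm equal to that eigenvalue form a compact set projecting onto \<open>T\<close>. Since \<open>T\<close>
  is extremally disconnected, Gleason's theorem yields a continuous choice of eigenvector. Removing the
  corresponding rank one part and repeating produces a singular value decomposition of \<open>v\<^sub>t\<close> with
  singular values continuous on \<open>T\<close> and singular vectors norm continuous where the singular value is
  nonzero; the finite rank approximation makes the singular values decay uniformly in \<open>t\<close>.

  Only the coordinates of the singular vectors extend continuously to the closure of \<open>U\<^sub>n(u)\<close>, so the
  vectors lie in \<open>K\<close>. Their inner products can be computed pointwise on \<open>U\<^sub>n(u)\<close>, because the weak* sum
  agrees with the pointwise one wherever a field is norm continuous, and hence on its closure.
  Multiplication by \<open>\<theta>\<^sub>n(u)\<close> restores norm continuity, which puts \<open>\<theta>\<^sub>n(u) \<xi>\<^sub>n\<close> into \<open>H\<close>.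
\<close>

text \<open>The obstacle is the crossing of eigenvalues: where multiplicities change, eigenvectors
  of a norm continuous family cannot in general be followed continuously. Only the top eigenvector
  of the current remainder is ever selected, and its eigenvalue is an operator norm. Unit
  eigenvectors would lose compactness where that norm vanishes; vectors whose norm is the eigenvalue
  stay in one compact set and shrink to 0 there. Rescaled so that its norm is the square root of the
  eigenvalue, such a vector g gives the rank one part g<.|g> with no division, so the next remainder
  is again continuous on all of T. A second obstacle is that the statement fixes adjoints, absolute
  values, singular values, inner products and the inclusion into the operators on K by definite
  descriptions. Each of them is computed from a candidate and a uniqueness proof; for singular
  values the dimensions of eigenspaces determine the sequence. The analysis takes place in one
  Banach space over the whole index type, so that operators can be treated as elements of a normed
  space.\<close>

section \<open>Scalars\<close>

lemma norm_kconj [simp]: "norm (kconj x) = norm (x::'k::rclike)"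
proof (cases "x = 0")
  case False
  have "norm x * norm (kconj x) = norm ((norm x)\<^sup>2 *\<^sub>R (1::'k))"
    using mult_kconj[of x] by (metis norm_mult)
  with False show ?thesis by (simp add: power2_eq_square)
next
  case True
  have "kconj (0::'k) = 0" using kconj_scaleR_1[of 0] by simp
  with True show ?thesis by simp
qed

lemma kconj_of_real [simp]: "kconj (of_real r) = (of_real r :: 'k::rclike)"
  using kconj_scaleR_1[of r] by (simp add: scaleR_conv_of_real)

lemma kconj_0 [simp]: "kconj 0 = (0::'k::rclike)"
  using kconj_of_real[of 0] by simp

lemma kconj_1 [simp]: "kconj 1 = (1::'k::rclike)"
  using kconj_of_real[of 1] by simp

lemma mult_kconj_of_real: "x * kconj x = of_real ((norm x)\<^sup>2)" for x :: "'k::rclike"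
  using mult_kconj[of x] by (simp add: scaleR_conv_of_real)

lemma kconj_scaleR [simp]: "kconj (r *\<^sub>R x) = r *\<^sub>R kconj x" for x :: "'k::rclike"
  using kconj_mult[of "of_real r" x] by (simp add: scaleR_conv_of_real)

lemma bounded_linear_kconj: "bounded_linear (kconj :: 'k::rclike \<Rightarrow> 'k)"
  by (rule bounded_linear_intro[where K = 1]) (auto simp: kconj_add)

lemmas kconj_sum = linear_sum[OF bounded_linear.linear[OF bounded_linear_kconj]]
lemmas continuous_on_kconj [continuous_intros] =
  bounded_linear.continuous_on[OF bounded_linear_kconj]

lemma kconj_kconj [simp]: "kconj (kconj x) = (x::'k::rclike)"
proof (cases "x = 0")
  case False
  then have "kconj x \<noteq> 0" by (metis norm_eq_zero norm_kconj)
  have "kconj x * kconj (kconj x) = kconj x * x"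
    using mult_kconj[of "kconj x"] mult_kconj[of x] by (simp add: mult.commute)
  with \<open>kconj x \<noteq> 0\<close> show ?thesis by simp
qed simp

text \<open>The class links \<open>inner\<close> and \<open>kconj\<close> only through the norm, so
  polarization of |x + y|^2 is what identifies the Euclidean inner product with the real part of
  \<open>x * kconj y\<close>.\<close>

lemma of_real_inner_rclike:
  "of_real (x \<bullet> y) = (x * kconj y + kconj (x * kconj y)) / (2::'k::rclike)"
proof -
  have "of_real ((norm (x + y))\<^sup>2) = (x + y) * kconj (x + y)"
    by (rule mult_kconj_of_real[symmetric])
  also have "\<dots> = x * kconj x + y * kconj y + (x * kconj y + kconj (x * kconj y))"
    by (simp add: kconj_add kconj_mult algebra_simps)
  also have "\<dots> = of_real ((norm x)\<^sup>2 + (norm y)\<^sup>2) + (x * kconj y + kconj (x * kconj y))"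
    by (simp add: mult_kconj_of_real)
  finally have "of_real ((norm (x + y))\<^sup>2 - (norm x)\<^sup>2 - (norm y)\<^sup>2)
      = x * kconj y + kconj (x * kconj y)"
    by simp
  moreover have "(norm (x + y))\<^sup>2 - (norm x)\<^sup>2 - (norm y)\<^sup>2 = 2 * (x \<bullet> y)"
    by (simp add: dot_norm)
  ultimately show ?thesis by (simp add: mult.commute)
qed

text \<open>Hence \<open>z \<bullet> 1\<close> serves as the real part of z for either field of
  scalars, with no case distinction.\<close>

lemma inner_rclike: "x \<bullet> y = (x * kconj y) \<bullet> (1::'k::rclike)"
proof -
  have "of_real (x \<bullet> y) = (of_real ((x * kconj y) \<bullet> 1) :: 'k)"
    unfolding of_real_inner_rclike by simp
  then show ?thesis by (simp only: of_real_eq_iff)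
qed

lemma inner_one_one [simp]: "(1::'k::rclike) \<bullet> 1 = 1"
  by (simp add: dot_square_norm)

section \<open>The Hilbert space of square summable families\<close>

text \<open>A type rather than the set \<open>l2 I\<close>, so that bounded operators live in the
  \<open>blinfun\<close> type with its norm and limits. The index set I reappears later as a
  condition on supports.\<close>

typedef (overloaded) ('i, 'k::rclike) ell2 = "{x :: 'i \<Rightarrow> 'k. (\<lambda>i. (norm (x i))\<^sup>2) summable_on UNIV}"
  morphisms coords Ell2
  by (rule exI[of _ "\<lambda>_. 0"]) simp

setup_lifting type_definition_ell2

lemma sq_summable_cmult:
  fixes x :: "'i \<Rightarrow> 'k::real_normed_field"
  assumes "(\<lambda>i. (norm (x i))\<^sup>2) summable_on A"
  shows "(\<lambda>i. (norm (c * x i))\<^sup>2) summable_on A"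
  using summable_on_cmult_right[OF assms, of "(norm c)\<^sup>2"]
  by (simp add: norm_mult power_mult_distrib)

lemma sq_summable_add:
  fixes x y :: "'i \<Rightarrow> 'k::real_normed_vector"
  assumes "(\<lambda>i. (norm (x i))\<^sup>2) summable_on A" "(\<lambda>i. (norm (y i))\<^sup>2) summable_on A"
  shows "(\<lambda>i. (norm (x i + y i))\<^sup>2) summable_on A"
proof (rule summable_on_comparison_test)
  show "(\<lambda>i. 2 * (norm (x i))\<^sup>2 + 2 * (norm (y i))\<^sup>2) summable_on A"
    by (intro summable_on_add summable_on_cmult_right assms)
  fix i
  have "(norm (x i + y i))\<^sup>2 \<le> (norm (x i) + norm (y i))\<^sup>2"
    by (simp add: power_mono norm_triangle_ineq)
  also have "\<dots> \<le> 2 * (norm (x i))\<^sup>2 + 2 * (norm (y i))\<^sup>2"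
    using sum_squares_bound[of "norm (x i)" "norm (y i)"] by (simp add: power2_sum)
  finally show "(norm (x i + y i))\<^sup>2 \<le> 2 * (norm (x i))\<^sup>2 + 2 * (norm (y i))\<^sup>2" .
qed auto

lemma sq_summable_mult:
  fixes x y :: "'i \<Rightarrow> 'k::real_normed_vector"
  assumes "(\<lambda>i. (norm (x i))\<^sup>2) summable_on A" "(\<lambda>i. (norm (y i))\<^sup>2) summable_on A"
    and f: "\<And>i. norm (f i :: 'b::banach) \<le> norm (x i) * norm (y i)"
  shows "f summable_on A"
proof (rule abs_summable_summable, rule summable_on_comparison_test)
  show "(\<lambda>i. (norm (x i))\<^sup>2 + (norm (y i))\<^sup>2) summable_on A"
    by (intro summable_on_add assms)
  fix i
  show "norm (f i) \<le> (norm (x i))\<^sup>2 + (norm (y i))\<^sup>2"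
    using f[of i] sum_squares_bound[of "norm (x i)" "norm (y i)"]
      mult_nonneg_nonneg[OF norm_ge_zero[of "x i"] norm_ge_zero[of "y i"]]
    by linarith
qed auto

instantiation ell2 :: (type, rclike) real_vector
begin
lift_definition zero_ell2 :: "('a, 'b) ell2" is "\<lambda>_. 0" by simp
lift_definition plus_ell2 :: "('a, 'b) ell2 \<Rightarrow> ('a, 'b) ell2 \<Rightarrow> ('a, 'b) ell2"
  is "\<lambda>x y i. x i + y i" by (simp add: sq_summable_add)
lift_definition uminus_ell2 :: "('a, 'b) ell2 \<Rightarrow> ('a, 'b) ell2" is "\<lambda>x i. - x i" by simp
lift_definition minus_ell2 :: "('a, 'b) ell2 \<Rightarrow> ('a, 'b) ell2 \<Rightarrow> ('a, 'b) ell2"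
  is "\<lambda>x y i. x i - y i"
  using sq_summable_add[where y = "\<lambda>i. - _ i"] by fastforce
lift_definition scaleR_ell2 :: "real \<Rightarrow> ('a, 'b) ell2 \<Rightarrow> ('a, 'b) ell2"
  is "\<lambda>r x i. r *\<^sub>R x i"
  by (simp add: power_mult_distrib summable_on_cmult_right)
instance
  by standard (transfer; simp add: algebra_simps fun_eq_iff)+
end

lemma coords_sq_summable: "(\<lambda>i. (norm (coords x i))\<^sup>2) summable_on A"
proof -
  have "(\<lambda>i. (norm (coords x i))\<^sup>2) summable_on UNIV" using coords[of x] by simp
  then show ?thesis by (rule summable_on_subset_banach) simp
qed

lemma coords_inner_summable: "(\<lambda>i. coords x i \<bullet> coords y i) summable_on A"
  by (rule sq_summable_mult[OF coords_sq_summable[of x] coords_sq_summable[of y]])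
    (simp add: Cauchy_Schwarz_ineq2)

instantiation ell2 :: (type, rclike) real_inner
begin
definition inner_ell2 :: "('a, 'b) ell2 \<Rightarrow> ('a, 'b) ell2 \<Rightarrow> real"
  where "inner_ell2 x y = (\<Sum>\<^sub>\<infinity>i. coords x i \<bullet> coords y i)"
definition norm_ell2 :: "('a, 'b) ell2 \<Rightarrow> real" where "norm_ell2 x = sqrt (inner x x)"
definition sgn_ell2 :: "('a, 'b) ell2 \<Rightarrow> ('a, 'b) ell2" where "sgn_ell2 x = x /\<^sub>R norm x"
definition dist_ell2 :: "('a, 'b) ell2 \<Rightarrow> ('a, 'b) ell2 \<Rightarrow> real" where "dist_ell2 x y = norm (x - y)"
definition uniformity_ell2 :: "(('a, 'b) ell2 \<times> ('a, 'b) ell2) filter"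
  where "uniformity_ell2 = (INF e\<in>{0<..}. principal {(x, y). dist x y < e})"
definition open_ell2 :: "('a, 'b) ell2 set \<Rightarrow> bool"
  where "open_ell2 U \<longleftrightarrow> (\<forall>x\<in>U. eventually (\<lambda>(x', y). x' = x \<longrightarrow> y \<in> U) uniformity)"
instance
proof
  fix x y z :: "('a, 'b) ell2" and r :: real and U :: "('a, 'b) ell2 set"
  show "inner x y = inner y x" by (simp add: inner_ell2_def inner_commute)
  show "inner (x + y) z = inner x z + inner y z"
    unfolding inner_ell2_def
    by (simp add: plus_ell2.rep_eq inner_add_left infsum_add coords_inner_summable)
  show "inner (r *\<^sub>R x) y = r * inner x y"
    unfolding inner_ell2_def by (simp add: scaleR_ell2.rep_eq infsum_cmult_right')
  show "0 \<le> inner x x" unfolding inner_ell2_def by (rule infsum_nonneg) simp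
  show "(inner x x = 0) = (x = 0)"
  proof
    assume "inner x x = 0"
    then have "((\<lambda>i. coords x i \<bullet> coords x i) has_sum 0) UNIV"
      using has_sum_infsum[OF coords_inner_summable[of x x UNIV]] by (simp add: inner_ell2_def)
    then have "coords x i \<bullet> coords x i = 0" for i
      by (rule nonneg_has_sum_le_0D) auto
    then have "coords x = coords 0" by (simp add: fun_eq_iff zero_ell2.rep_eq)
    then show "x = 0" by (simp add: coords_inject)
  qed (simp add: inner_ell2_def zero_ell2.rep_eq)
  show "norm x = sqrt (inner x x)" by (rule norm_ell2_def)
  show "sgn x = x /\<^sub>R norm x" by (rule sgn_ell2_def)
  show "dist x y = norm (x - y)" by (rule dist_ell2_def)
  show "uniformity = (INF e\<in>{0<..}. principal {(x :: ('a, 'b) ell2, y). dist x y < e})"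
    by (rule uniformity_ell2_def)
  show "open U = (\<forall>x\<in>U. eventually (\<lambda>(x', y). x' = x \<longrightarrow> y \<in> U) uniformity)"
    by (rule open_ell2_def)
qed
end

lemma coords_zero [simp]: "coords 0 i = 0" by (simp add: zero_ell2.rep_eq)
lemma coords_add [simp]: "coords (x + y) i = coords x i + coords y i"
  by (simp add: plus_ell2.rep_eq)
lemma coords_diff [simp]: "coords (x - y) i = coords x i - coords y i"
  by (simp add: minus_ell2.rep_eq)
lemma coords_scaleR [simp]: "coords (r *\<^sub>R x) i = r *\<^sub>R coords x i"
  by (simp add: scaleR_ell2.rep_eq)
lemma coords_sum [simp]: "coords (\<Sum>k\<in>A. f k) i = (\<Sum>k\<in>A. coords (f k) i)"
  by (induction A rule: infinite_finite_induct) auto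

lemma ell2_eqI: "(\<And>i. coords x i = coords y i) \<Longrightarrow> x = y"
  by (simp add: coords_inject[symmetric] fun_eq_iff)

lemma coords_Ell2: "(\<lambda>i. (norm (x i))\<^sup>2) summable_on UNIV \<Longrightarrow> coords (Ell2 x) = x"
  by (simp add: Ell2_inverse)

lemma norm_ell2_sq: "(norm x)\<^sup>2 = (\<Sum>\<^sub>\<infinity>i. (norm (coords x i))\<^sup>2)"
  by (simp add: power2_norm_eq_inner inner_ell2_def)

lemma sum_coords_le: "finite F \<Longrightarrow> (\<Sum>i\<in>F. (norm (coords x i))\<^sup>2) \<le> (norm x)\<^sup>2"
  unfolding norm_ell2_sq by (rule finite_sum_le_infsum) (auto intro: coords_sq_summable)

lemma norm_ell2_le:
  assumes "0 \<le> c" "\<And>F. finite F \<Longrightarrow> (\<Sum>i\<in>F. (norm (coords x i))\<^sup>2) \<le> c\<^sup>2"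
  shows "norm x \<le> c"
proof -
  have "(norm x)\<^sup>2 \<le> c\<^sup>2"
    unfolding norm_ell2_sq by (rule infsum_le_finite_sums) (auto intro: coords_sq_summable assms)
  with assms(1) show ?thesis by (rule power2_le_imp_le[rotated])
qed

lemma norm_coords_le: "norm (coords x i) \<le> norm x"
  by (rule power2_le_imp_le) (use sum_coords_le[of "{i}" x] in simp_all)

lemma bounded_linear_coords: "bounded_linear (\<lambda>x. coords x i)"
  by (rule bounded_linear_intro[where K = 1]) (auto simp: norm_coords_le)

lemma sq_summable_of_bounded:
  fixes x :: "'i \<Rightarrow> 'k::real_normed_vector"
  assumes "\<And>F. finite F \<Longrightarrow> F \<subseteq> A \<Longrightarrow> (\<Sum>i\<in>F. (norm (x i))\<^sup>2) \<le> c"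
  shows "(\<lambda>i. (norm (x i))\<^sup>2) summable_on A"
  by (rule nonneg_bdd_above_summable_on) (auto intro!: bdd_aboveI[where M = c] assms)

text \<open>Coordinates converge; the Cauchy estimate passes to the limit in each finite partial sum
  of squares, with a bound that does not depend on the finite set.\<close>

instance ell2 :: (type, rclike) banach
proof
  fix X :: "nat \<Rightarrow> ('a, 'b) ell2"
  assume X: "Cauchy X"
  have "\<exists>l. (\<lambda>n. coords (X n) i) \<longlonglongrightarrow> l" for i
    using bounded_linear.Cauchy[OF bounded_linear_coords X]
    by (simp add: Cauchy_convergent_iff convergent_def)
  then obtain l where l: "\<And>i. (\<lambda>n. coords (X n) i) \<longlonglongrightarrow> l i" by metis
  have le: "(\<Sum>i\<in>F. (norm (coords (X m) i - l i))\<^sup>2) \<le> e\<^sup>2"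
    if F: "finite F" and e: "\<And>n. n \<ge> N \<Longrightarrow> norm (X m - X n) \<le> e" for F m e N
  proof (rule tendsto_upperbound)
    show "(\<lambda>n. \<Sum>i\<in>F. (norm (coords (X m) i - coords (X n) i))\<^sup>2)
        \<longlonglongrightarrow> (\<Sum>i\<in>F. (norm (coords (X m) i - l i))\<^sup>2)"
      by (intro tendsto_intros l)
    have "(\<Sum>i\<in>F. (norm (coords (X m) i - coords (X n) i))\<^sup>2) \<le> e\<^sup>2" if "n \<ge> N" for n
    proof -
      have "(\<Sum>i\<in>F. (norm (coords (X m) i - coords (X n) i))\<^sup>2) \<le> (norm (X m - X n))\<^sup>2"
        using sum_coords_le[OF F, of "X m - X n"] by simp
      also have "\<dots> \<le> e\<^sup>2" by (rule power_mono) (use e that in auto)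
      finally show ?thesis .
    qed
    then show "\<forall>\<^sub>F n in sequentially.
        (\<Sum>i\<in>F. (norm (coords (X m) i - coords (X n) i))\<^sup>2) \<le> e\<^sup>2"
      by (auto simp: eventually_sequentially)
  qed simp
  obtain N1 where N1: "\<And>m n. m \<ge> N1 \<Longrightarrow> n \<ge> N1 \<Longrightarrow> norm (X m - X n) < 1"
    using CauchyD[OF X, of 1] by auto
  have "(\<lambda>i. (norm (coords (X N1) i - l i))\<^sup>2) summable_on UNIV"
    by (rule sq_summable_of_bounded, rule le[of _ N1 N1 1]) (auto intro: less_imp_le N1)
  from sq_summable_add[OF this, of "\<lambda>i. - coords (X N1) i"]
  have "(\<lambda>i. (norm (l i))\<^sup>2) summable_on UNIV"
    by (simp add: coords_sq_summable)
  then have L: "coords (Ell2 l) = l" by (rule coords_Ell2)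
  have "X \<longlonglongrightarrow> Ell2 l"
  proof (rule LIMSEQ_I)
    fix e :: real assume "e > 0"
    then obtain N where N: "\<And>m n. m \<ge> N \<Longrightarrow> n \<ge> N \<Longrightarrow> norm (X m - X n) < e / 2"
      using CauchyD[OF X, of "e / 2"] by auto
    have "norm (X m - Ell2 l) < e" if "m \<ge> N" for m
    proof -
      have "norm (X m - Ell2 l) \<le> e / 2"
      proof (rule norm_ell2_le)
        fix F :: "'a set" assume "finite F"
        then show "(\<Sum>i\<in>F. (norm (coords (X m - Ell2 l) i))\<^sup>2) \<le> (e / 2)\<^sup>2"
          using le[of F N m "e / 2"] N[OF that] by (simp add: L less_imp_le)
      qed (use \<open>e > 0\<close> in simp)
      with \<open>e > 0\<close> show ?thesis by simp
    qed
    then show "\<exists>N. \<forall>m\<ge>N. norm (X m - Ell2 l) < e" by blast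
  qed
  then show "convergent X" by (auto simp: convergent_def)
qed

section \<open>Scalar action, scalar-valued inner product and rank one operators on
  \<open>ell2\<close>\<close>

lift_definition ksc :: "'k \<Rightarrow> ('i, 'k::rclike) ell2 \<Rightarrow> ('i, 'k) ell2" is "\<lambda>c x i. c * x i"
  by (simp add: sq_summable_cmult)

lemma coords_ksc [simp]: "coords (ksc c x) i = c * coords x i" by (simp add: ksc.rep_eq)

definition cinner :: "('i, 'k::rclike) ell2 \<Rightarrow> ('i, 'k) ell2 \<Rightarrow> 'k"
  where "cinner x y = (\<Sum>\<^sub>\<infinity>i. coords x i * kconj (coords y i))"

lemma coords_cinner_summable: "(\<lambda>i. coords x i * kconj (coords y i)) summable_on A"
  by (rule sq_summable_mult[OF coords_sq_summable[of x] coords_sq_summable[of y]])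
    (simp add: norm_mult)

lemma has_sum_cinner: "((\<lambda>i. coords x i * kconj (coords y i)) has_sum cinner x y) UNIV"
  unfolding cinner_def by (rule has_sum_infsum[OF coords_cinner_summable])

lemma cinner_add_left: "cinner (x + y) z = cinner x z + cinner y z"
  unfolding cinner_def by (simp add: distrib_right infsum_add coords_cinner_summable)

lemma cinner_ksc_left [simp]: "cinner (ksc c x) y = c * cinner x y"
  unfolding cinner_def by (simp add: mult.assoc infsum_cmult_right')

lemma cinner_commute: "cinner y x = kconj (cinner x y)"
proof -
  have "((\<lambda>i. kconj (coords x i * kconj (coords y i))) has_sum kconj (cinner x y)) UNIV"
    by (rule has_sum_bounded_linear[OF bounded_linear_kconj has_sum_cinner])
  then have "((\<lambda>i. coords y i * kconj (coords x i)) has_sum kconj (cinner x y)) UNIV"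
    by (simp add: kconj_mult mult.commute)
  from has_sum_unique[OF has_sum_cinner this] show ?thesis .
qed

lemma cinner_add_right: "cinner x (y + z) = cinner x y + cinner x z"
  by (metis cinner_add_left cinner_commute kconj_add)

lemma cinner_ksc_right [simp]: "cinner x (ksc c y) = kconj c * cinner x y"
  by (metis cinner_ksc_left cinner_commute kconj_mult)

lemma cinner_one: "cinner x y \<bullet> 1 = x \<bullet> y"
proof -
  have "((\<lambda>i. (coords x i * kconj (coords y i)) \<bullet> 1) has_sum cinner x y \<bullet> 1) UNIV"
    by (rule has_sum_bounded_linear[OF bounded_linear_inner_left has_sum_cinner])
  then have "((\<lambda>i. coords x i \<bullet> coords y i) has_sum cinner x y \<bullet> 1) UNIV"
    by (simp add: inner_rclike[symmetric])
  then show ?thesis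
    unfolding inner_ell2_def by (simp add: infsumI)
qed

lemma cinner_self: "cinner x x = of_real ((norm x)\<^sup>2)" for x :: "('i, 'b::rclike) ell2"
proof -
  have "((\<lambda>i. of_real ((norm (coords x i))\<^sup>2)) has_sum (of_real ((norm x)\<^sup>2) :: 'b)) UNIV"
    unfolding norm_ell2_sq
    by (intro has_sum_bounded_linear[OF bounded_linear_of_real] has_sum_infsum coords_sq_summable)
  then show ?thesis
    using has_sum_cinner[of x x] by (simp add: mult_kconj_of_real has_sum_unique)
qed

lemma ksc_ksc [simp]: "ksc c (ksc d x) = ksc (c * d) x"
  by (rule ell2_eqI) (simp add: algebra_simps)
lemma ksc_one [simp]: "ksc 1 x = x"
  by (rule ell2_eqI) simp
lemma ksc_of_real: "ksc (of_real r) x = r *\<^sub>R x"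
  by (rule ell2_eqI) (simp add: scaleR_conv_of_real)

lemma norm_ksc [simp]: "norm (ksc c x) = norm c * norm x"
proof -
  have "(norm (ksc c x))\<^sup>2 = (norm c * norm x)\<^sup>2"
    unfolding power_mult_distrib norm_ell2_sq
    by (simp add: norm_mult power_mult_distrib infsum_cmult_right')
  then show ?thesis by (simp add: power2_eq_iff_nonneg)
qed

lemma bounded_bilinear_ksc: "bounded_bilinear ksc"
proof
  show "\<exists>K. \<forall>a b. norm (ksc a b :: ('i, 'k) ell2) \<le> norm (a::'k::rclike) * norm b * K"
    by (rule exI[of _ 1]) simp
qed (auto intro!: ell2_eqI simp: algebra_simps)

text \<open>Cauchy--Schwarz follows from the real one after rotating \<open>x\<close>.\<close>

lemma norm_cinner_le: "norm (cinner x y) \<le> norm x * norm y"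
proof -
  have "(norm (cinner x y))\<^sup>2 = (kconj (cinner x y) * cinner x y) \<bullet> 1"
    using mult_kconj_of_real[of "cinner x y"]
    by (simp add: mult.commute del: of_real_power)
  also have "\<dots> = ksc (kconj (cinner x y)) x \<bullet> y"
    by (simp add: cinner_one[symmetric])
  also have "\<dots> \<le> norm (cinner x y) * norm x * norm y"
    by (metis norm_cauchy_schwarz norm_ksc norm_kconj)
  finally show ?thesis
    by (cases "cinner x y = 0") (auto simp: power2_eq_square)
qed

lemma bounded_bilinear_cinner:
  "bounded_bilinear (cinner :: ('i, 'k::rclike) ell2 \<Rightarrow> ('i, 'k) ell2 \<Rightarrow> 'k)"
proof
  show "\<exists>K. \<forall>a b. norm (cinner a b :: 'k) \<le> norm (a :: ('i, 'k) ell2) * norm b * K"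
    by (rule exI[of _ 1]) (simp add: norm_cinner_le)
  fix r :: real and a b :: "('i, 'k) ell2"
  show "cinner (r *\<^sub>R a) b = r *\<^sub>R cinner a b"
    by (simp add: ksc_of_real[symmetric] scaleR_conv_of_real)
  show "cinner a (r *\<^sub>R b) = r *\<^sub>R cinner a b"
    by (simp add: ksc_of_real[symmetric] scaleR_conv_of_real)
qed (auto simp: cinner_add_left cinner_add_right)

interpretation ksc: bounded_bilinear ksc by (rule bounded_bilinear_ksc)
interpretation cinner: bounded_bilinear cinner by (rule bounded_bilinear_cinner)

lemmas continuous_on_cinner [continuous_intros] = cinner.continuous_on
lemmas continuous_on_ksc [continuous_intros] = ksc.continuous_on
lemmas tendsto_cinner [tendsto_intros] = cinner.tendsto
lemmas tendsto_ksc [tendsto_intros] = ksc.tendsto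
lemmas continuous_on_coords [continuous_intros] = bounded_linear.continuous_on[OF bounded_linear_coords]

lemma cinner_eqI: "(\<And>z. cinner x z = cinner y z) \<Longrightarrow> x = y"
  by (metis cinner.diff_left cinner_one inner_eq_zero_iff inner_zero_left right_minus_eq)

definition rk :: "('i, 'k::rclike) ell2 \<Rightarrow> ('i, 'k) ell2 \<Rightarrow> ('i, 'k) ell2 \<Rightarrow>\<^sub>L ('i, 'k) ell2"
  where "rk a b = Blinfun (\<lambda>x. ksc (cinner x b) a)"

lemma rk_apply [simp]: "blinfun_apply (rk a b) x = ksc (cinner x b) a"
  unfolding rk_def
  by (subst bounded_linear_Blinfun_apply)
    (auto intro: bounded_linear_compose[OF ksc.bounded_linear_left cinner.bounded_linear_left])

lemma bounded_bilinear_rk: "bounded_bilinear rk"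
proof
  show "\<exists>K. \<forall>a b. norm (rk a b) \<le> norm (a :: ('i, 'k::rclike) ell2) * norm b * K"
  proof (rule exI[of _ 1], intro allI norm_blinfun_bound)
    fix a b x :: "('i, 'k) ell2"
    show "norm (rk a b x) \<le> norm a * norm b * 1 * norm x"
      using mult_right_mono[OF norm_cinner_le[of x b], of "norm a"] by (simp add: mult_ac)
  qed simp
qed (auto intro!: blinfun_eqI simp: blinfun.add_left blinfun.scaleR_left ksc.add_left ksc.add_right
  cinner.add_right ksc.scaleR_left ksc.scaleR_right cinner.scaleR_right)

interpretation rk: bounded_bilinear rk by (rule bounded_bilinear_rk)
lemmas continuous_on_rk [continuous_intros] = rk.continuous_on

section \<open>Extremally disconnected compact spaces\<close>

locale stonean =
  fixes T :: "'t::t2_space itself"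
  assumes compact_space: "compact (UNIV :: 't set)"
    and open_closure: "\<And>U :: 't set. open U \<Longrightarrow> open (closure U)"
begin

lemma compact_of_closed: "closed S \<Longrightarrow> compact (S :: 't set)"
  using compact_Int_closed[OF compact_space, of S] by simp

text \<open>Every point outside U has an open neighbourhood whose closure misses t. Finitely many of
  them cover the complement of U; the closure of their union is clopen by extremal disconnectedness,
  and A is its complement.\<close>

lemma clopen_nbhd:
  fixes t :: 't
  assumes "open U" "t \<in> U"
  obtains A where "open A" "closed A" "t \<in> A" "A \<subseteq> U"
proof -
  let ?V = "{V. open V \<and> t \<notin> closure V}"
  have "compact (- U)"
    by (rule compact_of_closed) (use assms in auto)
  moreover have "- U \<subseteq> \<Union>?V"
  proof
    fix y assume "y \<in> - U"
    then have "t \<noteq> y" using assms by auto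
    then obtain P V where "open P" "open V" "t \<in> P" "y \<in> V" "P \<inter> V = {}"
      by (metis hausdorff)
    then have "P \<inter> closure V = {}" by (simp add: open_Int_closure_eq_empty)
    with \<open>t \<in> P\<close> \<open>open V\<close> \<open>y \<in> V\<close> show "y \<in> \<Union>?V" by blast
  qed
  ultimately obtain D where D: "D \<subseteq> ?V" "finite D" "- U \<subseteq> \<Union>D"
    by (rule compactE) auto
  define A where "A = - closure (\<Union>D)"
  have "open (\<Union>D)" using D by auto
  then have "open A" "closed A" using open_closure by (auto simp: A_def)
  moreover have "closure (\<Union>D) = (\<Union>V\<in>D. closure V)"
    using D(2) by (induction D rule: finite_induct) auto
  then have "t \<in> A" using D(1) by (auto simp: A_def)
  moreover have "A \<subseteq> U" using D(3) closure_subset[of "\<Union>D"] by (auto simp: A_def)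
  ultimately show ?thesis using that by blast
qed

lemma fst_surjD: "fst ` M = UNIV \<Longrightarrow> \<exists>x. (t, x) \<in> M"
  by (metis UNIV_I imageE prod.collapse)

lemma in_fst_iff: "s \<in> fst ` M \<longleftrightarrow> (\<exists>z. (s, z) \<in> M)"
  by force

lemma fst_surjI: "(\<And>t. \<exists>x. (t, x) \<in> M) \<Longrightarrow> fst ` M = UNIV"
  by (metis UNIV_eq_I fst_conv image_eqI)

lemma closed_fst_image:
  fixes M :: "('t \<times> 'b::t2_space) set"
  assumes "compact M"
  shows "closed (fst ` M)"
  by (intro compact_imp_closed compact_continuous_image continuous_intros assms)

text \<open>
  Gleason's theorem: a minimal closed subset of \<open>G\<close> that still projects onto the whole space is the
  graph of a section.
\<close>

lemma minimal_closed_over: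
  fixes G :: "('t \<times> 'b::t2_space) set"
  assumes "compact G" "fst ` G = UNIV"
  obtains M where "closed M" "M \<subseteq> G" "fst ` M = UNIV"
    "\<And>M'. closed M' \<Longrightarrow> M' \<subseteq> M \<Longrightarrow> fst ` M' = UNIV \<Longrightarrow> M' = M"
proof -
  \<comment> \<open>Zorn is applied to complements: open sets have open unions, and the complement
    of a maximal member is a minimal closed set over T.\<close>
  define A where "A = {W. open W \<and> - G \<subseteq> W \<and> fst ` (- W) = UNIV}"
  have "closed G" using assms compact_imp_closed by blast
  have "\<exists>W\<in>A. \<forall>X\<in>A. W \<subseteq> X \<longrightarrow> X = W"
  proof (rule subset_Zorn_nonempty)
    have "- G \<in> A" using \<open>closed G\<close> assms(2) by (auto simp: A_def)
    then show "A \<noteq> {}" by blast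
    fix C assume C: "C \<noteq> {}" "subset.chain A C"
    then have CA: "C \<subseteq> A" by (auto simp: subset.chain_def)
    \<comment> \<open>If the union of the chain swallowed the fibre of G over t, compactness would
      let finitely many members, hence a single one, swallow it.\<close>
    have "\<exists>x. (t, x) \<notin> \<Union>C" for t
    proof (rule ccontr)
      assume *: "\<nexists>x. (t, x) \<notin> \<Union>C"
      have "compact (G \<inter> {t} \<times> UNIV)"
        by (intro compact_Int_closed assms closed_Times) auto
      moreover have "G \<inter> {t} \<times> UNIV \<subseteq> \<Union>C" using * by auto
      ultimately obtain D where D: "D \<subseteq> C" "finite D" "G \<inter> {t} \<times> UNIV \<subseteq> \<Union>D"
        by (rule compactE) (use CA in \<open>auto simp: A_def\<close>)
      obtain x0 where "(t, x0) \<in> G" using fst_surjD[OF assms(2)] by blast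
      with D(3) have "D \<noteq> {}" by blast
      moreover have "subset.chain A D"
        using C(2) subset_trans[OF D(1) CA] D(1) unfolding subset.chain_def
        by (meson subsetD)
      ultimately have "\<Union>D \<in> A" using Union_in_chain[OF D(2)] D(1) CA by blast
      then obtain x where x: "(t, x) \<notin> \<Union>D"
        using fst_surjD[of "- \<Union>D" t] by (auto simp: A_def)
      moreover have "(t, x) \<in> G" using \<open>\<Union>D \<in> A\<close> x by (auto simp: A_def)
      ultimately show False using D(3) by auto
    qed
    then have "fst ` (- \<Union>C) = UNIV" by (intro fst_surjI) blast
    moreover obtain W0 where W0: "W0 \<in> C" using C(1) by blast
    then have "- G \<subseteq> W0" using CA by (auto simp: A_def)
    then have "- G \<subseteq> \<Union>C" using W0 by blast
    moreover have "open (\<Union>C)" using CA by (auto simp: A_def)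
    ultimately show "\<Union>C \<in> A" by (simp add: A_def)
  qed
  then obtain W where W: "W \<in> A" "\<And>X. X \<in> A \<Longrightarrow> W \<subseteq> X \<Longrightarrow> X = W" by blast
  show ?thesis
  proof (rule that[of "- W"])
    fix M' assume M': "closed M'" "M' \<subseteq> - W" "fst ` M' = UNIV"
    then have "- M' \<in> A" "W \<subseteq> - M'" using W(1) by (auto simp: A_def)
    then show "M' = - W" using W(2) by auto
  qed (use W(1) in \<open>auto simp: A_def\<close>)
qed

text \<open>Minimality puts t into the closure of \<open>core R\<close> whenever R is an open
  neighbourhood of some point of the fibre over t. Two points of one fibre would have disjoint
  neighbourhoods, whose cores are disjoint open sets and so, in an extremally disconnected space,
  have disjoint closures; t would lie in both. Continuity of the section is then the closed graph
  argument for compact M.\<close>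

lemma gleason_section:
  fixes G :: "('t \<times> 'b::t2_space) set"
  assumes "compact G" "fst ` G = UNIV"
  obtains f where "continuous_on UNIV f" "\<And>t. (t, f t) \<in> G"
proof -
  obtain M where M: "closed M" "M \<subseteq> G" "fst ` M = UNIV"
    and min: "\<And>M'. closed M' \<Longrightarrow> M' \<subseteq> M \<Longrightarrow> fst ` M' = UNIV \<Longrightarrow> M' = M"
    using minimal_closed_over[OF assms] by blast
  have "compact M"
    using compact_Int_closed[OF assms(1) M(1)] M(2) by (simp add: Int_absorb1)
  then have cM: "closed (fst ` (M \<inter> UNIV \<times> F))" if "closed F" for F
    by (intro closed_fst_image compact_Int_closed closed_Times that) auto
  define core where "core R = {s. \<forall>z. (s, z) \<in> M \<longrightarrow> z \<in> R}" for R :: "'b set"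
  have core_eq: "core R = - fst ` (M \<inter> UNIV \<times> - R)" for R
    by (auto simp: core_def in_fst_iff)
  have open_core: "open (core R)" if "open R" for R
    using cM[of "- R"] that by (simp add: core_eq open_Compl closed_Compl)
  \<comment> \<open>Otherwise removing the open box over the complement of that closure leaves a
    smaller closed set. By minimality some fibre is lost, so it lies wholly in the box, which places
    its base point in \<open>core R\<close> after all.\<close>
  have in_closure: "t \<in> closure (core R)" if "(t, x) \<in> M" "x \<in> R" "open R" for t x R
  proof (rule ccontr)
    assume t: "t \<notin> closure (core R)"
    let ?O = "- closure (core R)"
    let ?M' = "M - ?O \<times> R"
    have "open (?O \<times> R)" using \<open>open R\<close> by (intro open_Times) auto
    then have "closed ?M'" using M(1) by (simp add: closed_Diff)
    moreover have "?M' \<noteq> M" using that t by auto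
    ultimately have "fst ` ?M' \<noteq> UNIV" using min by blast
    then obtain s where s: "s \<notin> fst ` ?M'" by blast
    obtain z where z: "(s, z) \<in> M" using M(3) fst_surjD by metis
    have s': "(s, z) \<in> ?O \<times> R" if "(s, z) \<in> M" for z
      using s that unfolding in_fst_iff by blast
    then have "s \<in> ?O" using z by blast
    moreover have "s \<in> core R" using s' by (simp add: core_def)
    ultimately show False using closure_subset by auto
  qed
  have uniq: "x = y" if "(t, x) \<in> M" "(t, y) \<in> M" for t x y
  proof (rule ccontr)
    assume "x \<noteq> y"
    then obtain P Q where PQ: "open P" "open Q" "x \<in> P" "y \<in> Q" "P \<inter> Q = {}"
      by (metis hausdorff)
    have "core P \<inter> core Q = {}"
    proof -
      have False if "s \<in> core P" "s \<in> core Q" for s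
      proof -
        obtain z where "(s, z) \<in> M" using M(3) fst_surjD by metis
        then have "z \<in> P" "z \<in> Q" using that by (simp_all add: core_def)
        then show False using PQ by auto
      qed
      then show ?thesis by auto
    qed
    then have "core P \<inter> closure (core Q) = {}"
      using open_Int_closure_eq_empty open_core PQ(1) by blast
    then have "closure (core Q) \<inter> closure (core P) = {}"
      using open_Int_closure_eq_empty[OF open_closure[OF open_core[OF PQ(2)]]] by blast
    moreover have "t \<in> closure (core P)" "t \<in> closure (core Q)"
      using in_closure that PQ by blast+
    ultimately show False by auto
  qed
  have "\<exists>x. (t, x) \<in> M" for t using M(3) fst_surjD by metis
  then obtain f where f: "\<And>t. (t, f t) \<in> M" by metis
  have "continuous_on UNIV f"
  proof (subst continuous_on_closed_vimage, simp, intro allI impI)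
    fix F :: "'b set" assume "closed F"
    have "f -` F \<inter> UNIV = fst ` (M \<inter> UNIV \<times> F)"
      using f uniq unfolding set_eq_iff in_fst_iff by (auto dest: uniq)
    with cM[OF \<open>closed F\<close>] show "closed (f -` F \<inter> UNIV)" by simp
  qed
  with f M(2) show ?thesis using that by blast
qed

text \<open>Gleason's theorem is applied to the closure of the graph over U, completed by the
  constant c off the closure of U. Over U itself the closure adds no point, because U is open and f
  is continuous, so the section extends f.\<close>

lemma extend_from_open:
  fixes f :: "'t \<Rightarrow> 'b::t2_space"
  assumes U: "open U" and f: "continuous_on U f" "f ` U \<subseteq> C" "compact C"
  obtains F where "continuous_on UNIV F" "\<And>t. t \<in> U \<Longrightarrow> F t = f t"
    "\<And>t. t \<notin> closure U \<Longrightarrow> F t = c"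
proof -
  define g where "g = (\<lambda>t. (t, f t)) ` U"
  define G where "G = closure g \<union> (- closure U) \<times> {c}"
  have "compact (UNIV \<times> C :: ('t \<times> 'b) set)" by (rule compact_Times[OF compact_space f(3)])
  moreover have "g \<subseteq> UNIV \<times> C" using f(2) by (auto simp: g_def)
  ultimately have "compact (closure g)"
    by (metis closed_closure closure_minimal compact_Int_closed compact_imp_closed inf.absorb2)
  moreover have "closed (- closure U)" using open_closure[OF U] by (simp add: closed_Compl)
  then have "compact ((- closure U) \<times> {c})"
    by (intro compact_Times compact_of_closed) auto
  ultimately have "compact G" by (simp add: G_def compact_Un)
  have "closed (fst ` closure g)" by (rule closed_fst_image[OF \<open>compact (closure g)\<close>])
  moreover have "U \<subseteq> fst ` closure g"
    using closure_subset[of g] by (force simp: g_def image_iff)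
  ultimately have clU: "closure U \<subseteq> fst ` closure g" by (simp add: closure_minimal)
  have "fst ` G = UNIV"
  proof -
    have "fst ` G = fst ` closure g \<union> (- closure U)" by (simp add: G_def image_Un)
    then show ?thesis using clU by auto
  qed
  with \<open>compact G\<close> obtain F where F: "continuous_on UNIV F" "\<And>t. (t, F t) \<in> G"
    using gleason_section by blast
  have "F t = f t" if "t \<in> U" for t
  proof (rule ccontr)
    assume "F t \<noteq> f t"
    then obtain P Q where PQ: "open P" "open Q" "F t \<in> P" "f t \<in> Q" "P \<inter> Q = {}"
      by (metis hausdorff)
    obtain O' where O': "open O'" "O' \<inter> U = f -` Q \<inter> U"
      using f(1) PQ(2) by (metis continuous_on_open_invariant)
    have "open ((O' \<inter> U) \<times> P)" using O'(1) U PQ(1) by (intro open_Times open_Int)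
    moreover have "((O' \<inter> U) \<times> P) \<inter> g = {}" using O' PQ by (auto simp: g_def)
    ultimately have "((O' \<inter> U) \<times> P) \<inter> closure g = {}"
      by (simp add: open_Int_closure_eq_empty)
    moreover have "(t, F t) \<in> closure g"
      using F(2)[of t] that closure_subset by (auto simp: G_def)
    moreover have "t \<in> O' \<inter> U" using O' PQ that by auto
    ultimately show False using PQ by auto
  qed
  moreover have "F t = c" if "t \<notin> closure U" for t
  proof -
    have "(t, F t) \<notin> closure g"
    proof
      assume "(t, F t) \<in> closure g"
      moreover have "open ((- closure U) \<times> (UNIV :: 'b set))" by (intro open_Times) auto
      moreover have "(- closure U) \<times> (UNIV :: 'b set) \<inter> g = {}"
        using closure_subset by (auto simp: g_def)
      ultimately have "(t, F t) \<notin> (- closure U) \<times> UNIV"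
        by (metis disjoint_iff open_Int_closure_eq_empty)
      with that show False by auto
    qed
    then show ?thesis using F(2)[of t] by (auto simp: G_def)
  qed
  ultimately show ?thesis using that F(1) by blast
qed

lemma continuous_on_realI:
  fixes f :: "'t \<Rightarrow> real"
  assumes "\<And>r. open {t. r < f t}" "\<And>r. open {t. f t < r}"
  shows "continuous_on UNIV f"
  unfolding continuous_on_def
proof (intro ballI order_tendstoI)
  fix t a
  show "\<forall>\<^sub>F x in at t within UNIV. a < f x" if "a < f t"
    using eventually_nhds_in_open[OF assms(1)[of a]] that eventually_nhds_conv_at by auto
  show "\<forall>\<^sub>F x in at t within UNIV. f x < a" if "f t < a"
    using eventually_nhds_in_open[OF assms(2)[of a]] that eventually_nhds_conv_at by auto
qed

text \<open>Order completeness of the real continuous functions, after Stone. The closures G r of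
  the open sets where some member exceeds r are clopen and decrease in r; the function with these
  level sets is continuous and is the least continuous upper bound, in general larger than the
  pointwise supremum.\<close>

lemma continuous_sup_exists:
  fixes g :: "'j \<Rightarrow> 't \<Rightarrow> real"
  assumes J: "J \<noteq> {}" and g: "\<And>j. j \<in> J \<Longrightarrow> continuous_on UNIV (g j)"
    and pos: "\<And>j t. j \<in> J \<Longrightarrow> 0 \<le> g j t" and C: "\<And>j t. j \<in> J \<Longrightarrow> g j t \<le> C"
  obtains f where "continuous_on UNIV f" "\<And>j t. j \<in> J \<Longrightarrow> g j t \<le> f t"
    "\<And>h t. continuous_on UNIV h \<Longrightarrow> (\<And>j t. j \<in> J \<Longrightarrow> g j t \<le> h t) \<Longrightarrow> f t \<le> h t"
proof -
  define S where "S r = (\<Union>j\<in>J. {t. r < g j t})" for r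
  have S_iff: "t \<in> S r \<longleftrightarrow> (\<exists>j\<in>J. r < g j t)" for t r by (simp add: S_def)
  define G where "G r = closure (S r)" for r
  have openS: "open (S r)" for r
    unfolding S_def by (intro open_UN ballI open_Collect_less continuous_intros g)
  have clopen: "open (G r)" "closed (G r)" for r
    using open_closure[OF openS] by (auto simp: G_def)
  have SG: "t \<in> S r \<Longrightarrow> t \<in> G r" for t r
    unfolding G_def using closure_subset by (rule subsetD)
  have mono: "t \<in> G q" if "q \<le> r" "t \<in> G r" for q r t
  proof -
    have "S r \<subseteq> S q" using that(1) unfolding subset_iff S_iff by (meson le_less_trans)
    then show ?thesis using that(2) closure_mono unfolding G_def by blast
  qed
  have neg: "t \<in> G r" if "r < 0" for r t
  proof (rule SG)
    obtain j where j: "j \<in> J" using J by auto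
    then have "r < g j t" using pos[OF j, of t] that by simp
    with j show "t \<in> S r" by (auto simp: S_iff)
  qed
  have bound: "r < C" if "t \<in> G r" for r t
  proof (rule ccontr)
    assume "\<not> r < C"
    then have "s \<notin> S r" for s using C[of _ s] unfolding S_iff by (meson le_less_trans not_less)
    then have "S r = {}" by auto
    with that show False by (simp add: G_def)
  qed
  define f where "f t = Sup {r. t \<in> G r}" for t
  have ne: "{r. t \<in> G r} \<noteq> {}" for t using neg[of "-1" t] by auto
  have bdd: "bdd_above {r. t \<in> G r}" for t
    by (rule bdd_aboveI[of _ C]) (simp add: bound less_imp_le)
  have fu: "r \<le> f t" if "t \<in> G r" for r t
    unfolding f_def by (rule cSup_upper) (simp_all add: that bdd)
  have fl: "f t \<le> q" if "t \<notin> G q" for t q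
    unfolding f_def
  proof (rule cSup_least[OF ne])
    fix r assume "r \<in> {r. t \<in> G r}"
    then show "r \<le> q" using mono[of q r t] that by force
  qed
  have "continuous_on UNIV f"
  proof (rule continuous_on_realI)
    fix r
    have "r < f t \<longleftrightarrow> (\<exists>q\<in>{r<..}. t \<in> G q)" for t
      using less_cSup_iff[OF ne bdd, of r t] by (auto simp: f_def)
    then have "{t. r < f t} = (\<Union>q\<in>{r<..}. G q)" by auto
    then show "open {t. r < f t}" using clopen by auto
    have "f t < r \<longleftrightarrow> (\<exists>q\<in>{..<r}. t \<notin> G q)" for t
    proof
      assume "f t < r"
      then obtain q where "f t < q" "q < r" using dense by blast
      then show "\<exists>q\<in>{..<r}. t \<notin> G q" using fu[of t q] by force
    next
      assume "\<exists>q\<in>{..<r}. t \<notin> G q"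
      then show "f t < r" using fl[of t] by force
    qed
    then have "{t. f t < r} = (\<Union>q\<in>{..<r}. - G q)" by auto
    then show "open {t. f t < r}" using clopen(2) by (simp add: open_UN open_Compl)
  qed
  moreover have "g j t \<le> f t" if "j \<in> J" for j t
  proof (rule dense_le)
    fix r assume "r < g j t"
    then have "t \<in> S r" using that by (auto simp: S_iff)
    then show "r \<le> f t" by (intro fu SG)
  qed
  moreover have "f t \<le> h t"
    if h: "continuous_on UNIV h" "\<And>j t. j \<in> J \<Longrightarrow> g j t \<le> h t" for h t
    unfolding f_def
  proof (rule cSup_least[OF ne])
    fix r assume r: "r \<in> {r. t \<in> G r}"
    have "closed {t. r \<le> h t}"
      by (intro closed_Collect_le continuous_intros h(1))
    moreover have "S r \<subseteq> {t. r \<le> h t}"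
      unfolding subset_iff S_iff mem_Collect_eq by (meson h(2) less_imp_le less_le_trans)
    ultimately have "G r \<subseteq> {t. r \<le> h t}"
      unfolding G_def by (intro closure_minimal)
    with r show "r \<le> h t" by auto
  qed
  ultimately show ?thesis by (rule that)
qed

end

section \<open>Positive operators\<close>

text \<open>Elements of the \<open>blinfun\<close> type are only real linear, and an adjoint for
  \<open>cinner\<close> exists exactly when the operator commutes with \<open>ksc\<close>
  (\<open>adjoint_exists\<close>, \<open>cadj_ksc\<close>). Adjointness is therefore a relation,
  which also carries the linearity over the scalars.\<close>

definition cadj :: "(('i, 'k::rclike) ell2 \<Rightarrow>\<^sub>L ('i, 'k) ell2) \<Rightarrow> (('i, 'k) ell2 \<Rightarrow>\<^sub>L ('i, 'k) ell2) \<Rightarrow> bool"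
  where "cadj A B \<longleftrightarrow> (\<forall>x y. cinner (A x) y = cinner x (B y))"

text \<open>Over the reals a nonnegative quadratic form does not force symmetry, so symmetry is part
  of positivity.\<close>

definition cpos :: "(('i, 'k::rclike) ell2 \<Rightarrow>\<^sub>L ('i, 'k) ell2) \<Rightarrow> bool"
  where "cpos A \<longleftrightarrow> cadj A A \<and> (\<forall>x. 0 \<le> A x \<bullet> x)"

lemma cadjD: "cadj A B \<Longrightarrow> cinner (A x) y = cinner x (B y)"
  by (simp add: cadj_def)

lemma cadj_inner: "cadj A B \<Longrightarrow> A x \<bullet> y = x \<bullet> B y"
  by (simp add: cinner_one[symmetric] cadjD)

lemma cadj_commute: "cadj A B \<Longrightarrow> cadj B A"
  unfolding cadj_def by (metis cinner_commute)

lemma cadj_unique: "cadj A B \<Longrightarrow> cadj A C \<Longrightarrow> B = C"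
proof (rule blinfun_eqI, rule cinner_eqI)
  fix x z assume "cadj A B" "cadj A C"
  then show "cinner (B x) z = cinner (C x) z"
    by (metis cadjD cadj_commute)
qed

lemma cadj_ksc:
  assumes "cadj A B"
  shows "A (ksc c x) = ksc c (A x)"
  by (rule cinner_eqI) (simp add: cadjD[OF assms])

lemma cadj_norm_le:
  assumes "cadj A B"
  shows "norm B \<le> norm A"
proof (rule norm_blinfun_bound)
  fix y
  have "(norm (B y))\<^sup>2 = A (B y) \<bullet> y"
    by (simp add: cadj_inner[OF assms] power2_norm_eq_inner)
  also have "\<dots> \<le> norm (A (B y)) * norm y" by (rule norm_cauchy_schwarz)
  also have "\<dots> \<le> norm A * norm (B y) * norm y"
    by (intro mult_right_mono norm_blinfun) simp
  finally have "norm (B y) * norm (B y) \<le> norm (B y) * (norm A * norm y)"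
    by (simp add: power2_eq_square mult_ac)
  then show "norm (B y) \<le> norm A * norm y"
    by (cases "B y = 0") auto
qed simp

lemma cadj_rk: "cadj (rk a b) (rk b a)"
  unfolding cadj_def by (simp add: cinner_commute[of a] mult.commute)

lemma cadj_diff: "cadj A B \<Longrightarrow> cadj A' B' \<Longrightarrow> cadj (A - A') (B - B')"
  by (simp add: cadj_def blinfun.diff_left cinner.diff_left cinner.diff_right)

lemma cadj_sum: "(\<And>k. k \<in> K \<Longrightarrow> cadj (A k) (B k)) \<Longrightarrow> cadj (\<Sum>k\<in>K. A k) (\<Sum>k\<in>K. B k)"
  by (simp add: cadj_def blinfun.sum_left cinner.sum_left cinner.sum_right)

lemma cadj_lim:
  assumes "A \<longlonglongrightarrow> A'" "B \<longlonglongrightarrow> B'" "\<And>n. cadj (A n) (B n)"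
  shows "cadj A' B'"
  unfolding cadj_def
proof (intro allI)
  fix x y
  have "(\<lambda>n. cinner (A n x) y) \<longlonglongrightarrow> cinner (A' x) y"
    by (intro tendsto_intros assms)
  moreover have "(\<lambda>n. cinner x (B n y)) \<longlonglongrightarrow> cinner x (B' y)"
    by (intro tendsto_intros assms)
  ultimately show "cinner (A' x) y = cinner x (B' y)"
    unfolding cadjD[OF assms(3)] by (rule LIMSEQ_unique)
qed

text \<open>The vector w = A z - r z satisfies A w = - r w, and a nonnegative A has no eigenvector
  for a negative eigenvalue. This is how eigenvectors of a square root are read off from those of
  the square.\<close>

lemma eigen_of_square:
  fixes A :: "('i, 'k::rclike) ell2 \<Rightarrow>\<^sub>L ('i, 'k) ell2"
  assumes pos: "\<And>x. 0 \<le> A x \<bullet> x" and sq: "A (A z) = r\<^sup>2 *\<^sub>R z" and "0 < r"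
  shows "A z = r *\<^sub>R z"
proof -
  let ?w = "A z - r *\<^sub>R z"
  have "A ?w = - r *\<^sub>R ?w"
    by (simp add: blinfun.diff_right blinfun.scaleR_right sq power2_eq_square algebra_simps)
  then have "0 \<le> - r * (?w \<bullet> ?w)" using pos[of ?w] by (simp del: scaleR_minus_left)
  then have "?w \<bullet> ?w \<le> 0" using \<open>0 < r\<close> by (simp add: mult_le_0_iff)
  then have "?w \<bullet> ?w = 0" using inner_ge_zero[of ?w] by linarith
  then have "?w = 0" by (simp only: inner_eq_zero_iff)
  then show ?thesis by (simp only: right_minus_eq)
qed

lemma almost_norming:
  fixes A :: "'a::real_normed_vector \<Rightarrow>\<^sub>L 'b::real_normed_vector"
  assumes "b < norm A" "0 \<le> b"
  shows "\<exists>x. norm x \<le> 1 \<and> b < norm (A x)"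
proof (rule ccontr)
  assume *: "\<not> ?thesis"
  have "norm A \<le> b"
  proof (rule norm_blinfun_bound)
    fix x
    show "norm (A x) \<le> b * norm x"
    proof (cases "x = 0")
      case False
      have "norm (A (x /\<^sub>R norm x)) \<le> b"
        using * False by (metis norm_sgn order_refl not_less sgn_div_norm)
      with False show ?thesis by (simp add: blinfun.scaleR_right field_simps)
    qed simp
  qed fact
  with assms show False by simp
qed

text \<open>For a norming sequence x the images A x accumulate at some z in C, although x itself
  need not converge. The defect A A x - l^2 x tends to 0, which makes z an eigenvector of A A, hence
  of A. Since z is a limit of images, its norm is l, the normalization needed later.\<close>

lemma top_eigenvector:
  fixes A :: "('i, 'k::rclike) ell2 \<Rightarrow>\<^sub>L ('i, 'k) ell2"
  assumes A: "cpos A" and C: "compact C" "A ` cball 0 1 \<subseteq> C"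
  shows "\<exists>y\<in>C. norm y = norm A \<and> A y = norm A *\<^sub>R y"
proof (cases "norm A = 0")
  case True
  have "A 0 \<in> A ` cball 0 1" by (rule imageI) simp
  then have "0 \<in> C" using C(2) by (auto simp: blinfun.zero_right)
  then show ?thesis using True by (intro bexI[of _ 0]) simp_all
next
  case False
  define l where "l = norm A"
  have l: "0 < l" using False by (simp add: l_def)
  have "\<exists>x. norm x \<le> 1 \<and> max 0 (l - 1 / real (Suc n)) < norm (A x)" for n
    by (rule almost_norming) (use l in \<open>auto simp: l_def\<close>)
  then obtain x where x: "\<And>n. norm (x n) \<le> 1" "\<And>n. max 0 (l - 1 / real (Suc n)) < norm (A (x n))"
    by metis
  have xl: "norm (A (x n)) \<le> l" for n
    using norm_blinfun[of A "x n"] mult_left_mono[OF x(1)[of n], of l] l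
    unfolding l_def by linarith
  have "seq_compact C" using C(1) by (rule compact_imp_seq_compact)
  moreover have "\<forall>n. A (x n) \<in> C" using x(1) C(2) by auto
  ultimately obtain z r where z: "z \<in> C" "strict_mono r" "((\<lambda>n. A (x n)) \<circ> r) \<longlonglongrightarrow> z"
    by (rule seq_compactE)
  have z3: "(\<lambda>n. A (x (r n))) \<longlonglongrightarrow> z" using z(3) by (simp add: o_def)
  have "(\<lambda>n. norm (A (x n))) \<longlonglongrightarrow> l"
  proof (rule tendsto_sandwich)
    show "(\<lambda>n. l - 1 / real (Suc n)) \<longlonglongrightarrow> l"
      using tendsto_diff[OF tendsto_const LIMSEQ_inverse_real_of_nat, of l]
      by (simp add: inverse_eq_divide)
    show "\<forall>\<^sub>F n in sequentially. l - 1 / real (Suc n) \<le> norm (A (x n))"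
      using x(2) by (intro always_eventually allI less_imp_le) (simp add: max_less_iff_conj)
  qed (auto simp: xl)
  then have nl: "(\<lambda>n. norm (A (x (r n)))) \<longlonglongrightarrow> l"
    using LIMSEQ_subseq_LIMSEQ[OF _ z(2)] by (auto simp: o_def)
  then have "norm z = l" using tendsto_norm[OF z3] by (rule LIMSEQ_unique[rotated])
  define d where "d n = A (A (x n)) - l\<^sup>2 *\<^sub>R x n" for n
  \<comment> \<open>Expand the square: symmetry turns the mixed term into |A x|^2, and |A A x| \<le>
    l |A x|. What remains vanishes along a norming sequence.\<close>
  have dle: "(norm (d n))\<^sup>2 \<le> l\<^sup>2 * (l\<^sup>2 - (norm (A (x n)))\<^sup>2)" for n
  proof -
    have "(norm (d n))\<^sup>2 = (norm (A (A (x n))))\<^sup>2 - 2 * l\<^sup>2 * (A (A (x n)) \<bullet> x n)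
        + l\<^sup>2 * l\<^sup>2 * (norm (x n))\<^sup>2"
      unfolding d_def power2_norm_eq_inner inner_diff_left inner_diff_right
      by (simp add: inner_commute power2_norm_eq_inner)
    moreover have "A (A (x n)) \<bullet> x n = (norm (A (x n)))\<^sup>2"
      using A by (simp add: cpos_def cadj_inner power2_norm_eq_inner)
    moreover have "(norm (A (A (x n))))\<^sup>2 \<le> l\<^sup>2 * (norm (A (x n)))\<^sup>2"
      using norm_blinfun[of A "A (x n)"] unfolding power_mult_distrib[symmetric] l_def
      by (rule power_mono) simp
    moreover have "l\<^sup>2 * l\<^sup>2 * (norm (x n))\<^sup>2 \<le> l\<^sup>2 * l\<^sup>2 * 1"
      using x(1)[of n] by (intro mult_left_mono) (auto simp: power_le_one)
    ultimately show ?thesis by (simp add: algebra_simps)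
  qed
  have "(\<lambda>n. l\<^sup>2 * (l\<^sup>2 - (norm (A (x (r n))))\<^sup>2)) \<longlonglongrightarrow> l\<^sup>2 * (l\<^sup>2 - l\<^sup>2)"
    by (intro tendsto_intros nl)
  then have lim: "(\<lambda>n. l\<^sup>2 * (l\<^sup>2 - (norm (A (x (r n))))\<^sup>2)) \<longlonglongrightarrow> 0" by simp
  have "(\<lambda>n. (norm (d (r n)))\<^sup>2) \<longlonglongrightarrow> 0"
    by (rule tendsto_sandwich[OF always_eventually always_eventually tendsto_const lim])
      (use dle in auto)
  then have "(\<lambda>n. sqrt ((norm (d (r n)))\<^sup>2)) \<longlonglongrightarrow> sqrt 0" by (rule tendsto_real_sqrt)
  then have "(\<lambda>n. d (r n)) \<longlonglongrightarrow> 0" by (simp add: tendsto_norm_zero_iff)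
  \<comment> \<open>A is applied once more because only the images A x, not the vectors x, are known
    to converge.\<close>
  then have "(\<lambda>n. A (d (r n))) \<longlonglongrightarrow> A 0" by (intro tendsto_intros)
  moreover have "(\<lambda>n. A (d (r n))) \<longlonglongrightarrow> A (A z) - l\<^sup>2 *\<^sub>R z"
    unfolding d_def blinfun.diff_right blinfun.scaleR_right by (intro tendsto_intros z3)
  ultimately have "A 0 = A (A z) - l\<^sup>2 *\<^sub>R z" by (rule LIMSEQ_unique)
  then have "A (A z) = l\<^sup>2 *\<^sub>R z" by (simp add: blinfun.zero_right)
  then have "A z = l *\<^sub>R z"
    using A l by (intro eigen_of_square) (auto simp: cpos_def)
  with z(1) \<open>norm z = l\<close> show ?thesis by (auto simp: l_def)
qed

section \<open>Orthonormal systems padded by zeros\<close>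

definition oz :: "(nat \<Rightarrow> ('i, 'k::rclike) ell2) \<Rightarrow> bool"
  where "oz e \<longleftrightarrow> (\<forall>m n. cinner (e m) (e n) = (if m = n \<and> e n \<noteq> 0 then 1 else 0))"

lemma ozD: "oz e \<Longrightarrow> cinner (e m) (e n) = (if m = n \<and> e n \<noteq> 0 then 1 else 0)"
  by (simp add: oz_def)

lemma oz_norm: "oz e \<Longrightarrow> e n \<noteq> 0 \<Longrightarrow> norm (e n) = 1"
proof -
  assume "oz e" "e n \<noteq> 0"
  then have "e n \<bullet> e n = 1" using ozD[of e n n] by (simp add: cinner_one[symmetric])
  then show ?thesis by (simp add: norm_eq_sqrt_inner)
qed

lemma oz_norm_le: "oz e \<Longrightarrow> norm (e n) \<le> 1"
  using oz_norm[of e n] by (cases "e n = 0") auto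

definition proj_off :: "(nat \<Rightarrow> ('i, 'k::rclike) ell2) \<Rightarrow> nat set \<Rightarrow> ('i, 'k) ell2 \<Rightarrow> ('i, 'k) ell2"
  where "proj_off e F x = x - (\<Sum>k\<in>F. ksc (cinner x (e k)) (e k))"

lemma proj_off_orth:
  assumes "oz e" "finite F" "j \<in> F"
  shows "cinner (proj_off e F x) (e j) = 0"
proof -
  have "(\<Sum>k\<in>F. cinner x (e k) * cinner (e k) (e j)) = (\<Sum>k\<in>F. if k = j then cinner x (e j) else 0)"
    by (rule sum.cong) (auto simp: ozD[OF assms(1)] cinner.zero_right)
  also have "\<dots> = cinner x (e j)" using assms by simp
  finally show ?thesis by (simp add: proj_off_def cinner.diff_left cinner.sum_left)
qed

text \<open>Only an inequality, since the coefficients at the zero members contribute nothing to the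
  left side.\<close>

lemma norm_oz_sum:
  assumes "oz e" "finite F"
  shows "(norm (\<Sum>k\<in>F. ksc (c k) (e k)))\<^sup>2 \<le> (\<Sum>k\<in>F. (norm (c k))\<^sup>2)"
proof -
  have "cinner (\<Sum>k\<in>F. ksc (c k) (e k)) (\<Sum>k\<in>F. ksc (c k) (e k))
      = (\<Sum>k\<in>F. \<Sum>j\<in>F. if j = k then (if e k = 0 then 0 else of_real ((norm (c k))\<^sup>2)) else 0)"
    unfolding cinner.sum_left cinner.sum_right
    by (intro sum.cong refl)
      (auto simp: ozD[OF assms(1)] mult_kconj_of_real[symmetric] mult.commute simp del: of_real_power)
  also have "\<dots> = of_real (\<Sum>k\<in>F. if e k = 0 then 0 else (norm (c k))\<^sup>2)"
    using assms(2) by (simp add: if_distrib[of of_real] cong: if_cong)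
  finally have "(norm (\<Sum>k\<in>F. ksc (c k) (e k)))\<^sup>2 = (\<Sum>k\<in>F. if e k = 0 then 0 else (norm (c k))\<^sup>2)"
    unfolding cinner_self by (simp only: of_real_eq_iff)
  also have "\<dots> \<le> (\<Sum>k\<in>F. (norm (c k))\<^sup>2)" by (intro sum_mono) auto
  finally show ?thesis .
qed

lemma norm_proj_off:
  assumes "oz e" "finite F"
  shows "(norm (proj_off e F x))\<^sup>2 + (\<Sum>k\<in>F. (norm (cinner x (e k)))\<^sup>2) = (norm x)\<^sup>2"
proof -
  let ?p = "proj_off e F x"
  have "of_real ((norm ?p)\<^sup>2) = cinner ?p x - (\<Sum>k\<in>F. kconj (cinner x (e k)) * cinner ?p (e k))"
    unfolding cinner_self[symmetric]
    by (subst (2) proj_off_def) (simp add: cinner.diff_right cinner.sum_right)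
  also have "(\<Sum>k\<in>F. kconj (cinner x (e k)) * cinner ?p (e k)) = 0"
    by (intro sum.neutral ballI) (simp add: proj_off_orth[OF assms])
  also have "cinner ?p x = of_real ((norm x)\<^sup>2) - (\<Sum>k\<in>F. cinner x (e k) * kconj (cinner x (e k)))"
    by (simp add: proj_off_def cinner.diff_left cinner.sum_left cinner_self cinner_commute[of x "e _"]
        del: of_real_power)
  also have "\<dots> = of_real ((norm x)\<^sup>2 - (\<Sum>k\<in>F. (norm (cinner x (e k)))\<^sup>2))"
    by (simp add: mult_kconj_of_real)
  finally have "(norm ?p)\<^sup>2 = (norm x)\<^sup>2 - (\<Sum>k\<in>F. (norm (cinner x (e k)))\<^sup>2)"
    by (simp only: of_real_eq_iff diff_0_right)
  then show ?thesis by simp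
qed

lemma norm_proj_off_le:
  assumes "oz e" "finite F"
  shows "norm (proj_off e F x) \<le> norm x"
proof (rule power2_le_imp_le)
  show "(norm (proj_off e F x))\<^sup>2 \<le> (norm x)\<^sup>2"
    using norm_proj_off[OF assms, of x]
      sum_nonneg[of F "\<lambda>k. (norm (cinner x (e k)))\<^sup>2", OF zero_le_power2]
    by linarith
qed simp

lemma bessel:
  assumes "oz e" "finite F"
  shows "(\<Sum>k\<in>F. (norm (cinner x (e k)))\<^sup>2) \<le> (norm x)\<^sup>2"
  using norm_proj_off[OF assms, of x] zero_le_power2[of "norm (proj_off e F x)"] by linarith

section \<open>Successive removal of top eigenvectors\<close>

text \<open>As the eigenvalue of g is |g|^2, the operator \<open>rk g g\<close> is exactly the part
  of A on the line of g. So A - \<open>rk g g\<close> is A composed with the orthogonal projection p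
  off g, and p neither destroys positivity nor increases the norm.\<close>

lemma deflate:
  fixes A :: "('i, 'k::rclike) ell2 \<Rightarrow>\<^sub>L ('i, 'k) ell2"
  assumes A: "cpos A" and g: "A g = (norm g)\<^sup>2 *\<^sub>R g"
  shows "cpos (A - rk g g)" "norm (A - rk g g) \<le> norm A"
proof -
  have sym: "cadj A A" using A by (simp add: cpos_def)
  \<comment> \<open>For g = 0 the quotient is 0 and p is the identity, so no case distinction is
    needed.\<close>
  define c where "c x = cinner x g / of_real ((norm g)\<^sup>2)" for x
  define p where "p x = x - ksc (c x) g" for x
  have cg: "c x * of_real ((norm g)\<^sup>2) = cinner x g" for x
    by (cases "g = 0") (auto simp: c_def cinner.zero_right)
  have pg: "cinner (p x) g = 0" for x
    using cg[of x] by (simp add: p_def cinner.diff_left cinner_self)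
  have Ap: "(A - rk g g) x = A (p x)" for x
  proof -
    have "A (ksc (c x) g) = ksc (c x * of_real ((norm g)\<^sup>2)) g"
      by (simp only: cadj_ksc[OF sym] g ksc_of_real[symmetric] ksc_ksc)
    then show ?thesis
      by (simp only: p_def cg blinfun.diff_left blinfun.diff_right rk_apply)
  qed
  have "cinner (A (p x)) g = 0" for x
    by (simp add: cadjD[OF sym] g pg cinner.scaleR_right)
  then have "A (p x) \<bullet> ksc (c x) g = 0" for x
    by (simp add: cinner_one[symmetric])
  then have "(A - rk g g) x \<bullet> x = A (p x) \<bullet> p x" for x
    unfolding Ap by (simp add: p_def inner_diff_right)
  then have "0 \<le> (A - rk g g) x \<bullet> x" for x using A by (simp add: cpos_def)
  then show "cpos (A - rk g g)"
    by (simp add: cpos_def cadj_diff[OF sym cadj_rk])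
  have np: "norm (p x) \<le> norm x" for x
  proof (rule power2_le_imp_le)
    have "p x \<bullet> ksc (c x) g = 0" by (simp add: cinner_one[symmetric] pg)
    then have "x \<bullet> x = p x \<bullet> p x + ksc (c x) g \<bullet> ksc (c x) g"
      by (simp add: p_def inner_diff_left inner_diff_right inner_commute)
    then show "(norm (p x))\<^sup>2 \<le> (norm x)\<^sup>2" by (simp add: power2_norm_eq_inner)
  qed simp
  show "norm (A - rk g g) \<le> norm A"
  proof (rule norm_blinfun_bound)
    fix x
    have "norm (A (p x)) \<le> norm A * norm (p x)" by (rule norm_blinfun)
    also have "\<dots> \<le> norm A * norm x" by (intro mult_left_mono np) simp
    finally show "norm ((A - rk g g) x) \<le> norm A * norm x" by (simp only: Ap)
  qed simp
qed

text \<open>Intended for A 0 = v' v with v' the adjoint of v: the eigenvalue |g n|^2 of the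
  remainder is then a squared singular value, and s n = |g n| is the singular value itself.\<close>

locale deflation =
  fixes A :: "nat \<Rightarrow> ('i, 'k::rclike) ell2 \<Rightarrow>\<^sub>L ('i, 'k) ell2" and g :: "nat \<Rightarrow> ('i, 'k) ell2"
  assumes A_Suc: "A (Suc n) = A n - rk (g n) (g n)"
    and pos: "cpos (A n)"
    and norm_g: "(norm (g n))\<^sup>2 = norm (A n)"
    and eigen: "A n (g n) = norm (A n) *\<^sub>R g n"
begin

definition s :: "nat \<Rightarrow> real" where "s n = norm (g n)"
definition e :: "nat \<Rightarrow> ('i, 'k) ell2" where "e n = g n /\<^sub>R norm (g n)"

lemma sym: "cadj (A n) (A n)" using pos[of n] by (simp add: cpos_def)

lemma s_nonneg: "0 \<le> s n" by (simp add: s_def)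

lemma e_nonzero: "e n \<noteq> 0 \<longleftrightarrow> s n \<noteq> 0" by (simp add: e_def s_def)

lemma s_sq: "(s n)\<^sup>2 = norm (A n)" by (simp add: s_def norm_g)

lemma s_e: "s n *\<^sub>R e n = g n" by (cases "g n = 0") (simp_all add: s_def e_def)

lemma antimono_s: "m \<le> n \<Longrightarrow> s n \<le> s m"
proof (induction n rule: dec_induct)
  case (step n)
  have "norm (A (Suc n)) \<le> norm (A n)"
    unfolding A_Suc by (rule deflate(2)[OF pos]) (simp add: eigen norm_g)
  then have "s (Suc n) \<le> s n"
    unfolding s_sq[symmetric] by (rule power2_le_imp_le) (rule s_nonneg)
  with step show ?case by simp
qed simp

text \<open>Each claim feeds the other. If A n kills g m, then symmetry and the nonzero eigenvalue
  of g n force orthogonality; orthogonality in turn lets the subtraction of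
  \<open>rk (g n) (g n)\<close> keep g m in the kernel.\<close>

lemma kills: "m < n \<Longrightarrow> A n (g m) = 0" and orth: "m < n \<Longrightarrow> cinner (g n) (g m) = 0"
proof -
  have orth': "cinner (g n) (g m) = 0" if "A n (g m) = 0" for m n
  proof (cases "g n = 0")
    case False
    have "norm (A n) *\<^sub>R cinner (g n) (g m) = cinner (A n (g n)) (g m)"
      by (simp add: eigen cinner.scaleR_left)
    also have "\<dots> = 0" by (simp add: cadjD[OF sym] that cinner.zero_right)
    finally show ?thesis using False norm_g[of n] by auto
  qed (simp add: cinner.zero_left)
  have kills: "A n (g m) = 0" if "m < n" for m n
    using that
  proof (induction n)
    case (Suc n)
    show ?case
    proof (cases "m = n")
      case True
      then show ?thesis
        using norm_g[of n] cinner_self[of "g n"]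
        by (simp add: A_Suc blinfun.diff_left eigen ksc_of_real del: of_real_power)
    next
      case False
      with Suc have "A n (g m) = 0" by simp
      moreover from this have "cinner (g m) (g n) = 0"
        using orth' cinner_commute[of "g m" "g n"] by simp
      ultimately show ?thesis by (simp add: A_Suc blinfun.diff_left ksc.zero_left)
    qed
  qed simp
  show "m < n \<Longrightarrow> A n (g m) = 0" by (rule kills)
  show "m < n \<Longrightarrow> cinner (g n) (g m) = 0" by (rule orth'[OF kills])
qed

lemma oz_e: "oz e"
proof -
  have *: "cinner (e m) (e n) = 0" if "m \<noteq> n" for m n
  proof -
    have "cinner (g m) (g n) = 0"
      using that orth[of m n] orth[of n m] cinner_commute[of "g m" "g n"] by (cases "m < n") auto
    then show ?thesis by (simp add: e_def cinner.scaleR_left cinner.scaleR_right)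
  qed
  have "cinner (e n) (e n) = 1" if "e n \<noteq> 0" for n
    using that by (simp add: cinner_self e_def)
  with * show ?thesis by (auto simp: oz_def cinner.zero_left cinner.zero_right)
qed

lemma A_0: "A 0 x = A n x + (\<Sum>k<n. ksc (cinner x (g k)) (g k))"
  by (induction n) (simp_all add: A_Suc blinfun.diff_left)

lemma A_0_e: "A 0 (e n) = (s n)\<^sup>2 *\<^sub>R e n"
proof -
  have "(\<Sum>k<n. ksc (cinner (e n) (g k)) (g k)) = 0"
    by (intro sum.neutral ballI) (simp add: e_def cinner.scaleR_left orth ksc.zero_left)
  then show ?thesis
    unfolding A_0[of _ n] by (simp add: e_def blinfun.scaleR_right eigen s_sq mult.commute)
qed

lemma A_0_orth:
  assumes "\<And>k. k < n \<Longrightarrow> cinner x (e k) = 0"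
  shows "A 0 x = A n x"
proof -
  have "(\<Sum>k<n. ksc (cinner x (g k)) (g k)) = 0"
    by (intro sum.neutral ballI)
      (simp add: s_e[symmetric] cinner.scaleR_right assms ksc.zero_left del: scaleR_eq_0_iff)
  then show ?thesis by (simp add: A_0[of _ n])
qed

text \<open>A trace estimate. For each k < n the number s n squared is at most \<langle>A 0 e k, e
  k\<rangle>, that is, at most d plus the contribution of the finite rank operator. Summing over k <
  n, Bessel's inequality bounds the finite rank contributions independently of n, so s n squared is
  at most d plus a constant over n.\<close>

lemma s_decay:
  fixes a b :: "nat \<Rightarrow> ('i, 'k) ell2"
  assumes near: "norm (A 0 - (\<Sum>j<N. rk (a j) (b j))) \<le> d"
  shows "real n * (s n)\<^sup>2 \<le> real n * d + (\<Sum>j<N. (norm (a j))\<^sup>2 + (norm (b j))\<^sup>2)"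
proof (cases "s n = 0")
  case True
  have "0 \<le> d" using near norm_ge_zero order_trans by blast
  then show ?thesis using True by (simp add: sum_nonneg)
next
  case False
  let ?S = "\<Sum>j<N. rk (a j) (b j)"
  have *: "(s n)\<^sup>2 \<le> d + (\<Sum>j<N. (norm (cinner (a j) (e k)))\<^sup>2 + (norm (cinner (b j) (e k)))\<^sup>2)"
    if "k < n" for k
  proof -
    have sk: "s n \<le> s k" using that by (simp add: antimono_s)
    then have "s k \<noteq> 0" using False s_nonneg[of n] by auto
    then have ek: "norm (e k) = 1" using oz_norm[OF oz_e] e_nonzero by blast
    have "(s n)\<^sup>2 \<le> (s k)\<^sup>2" using sk s_nonneg by (rule power_mono)
    also have "\<dots> = A 0 (e k) \<bullet> e k"
      using ek by (simp add: A_0_e dot_square_norm)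
    also have "\<dots> = (A 0 - ?S) (e k) \<bullet> e k + ?S (e k) \<bullet> e k"
      by (simp add: blinfun.diff_left inner_diff_left)
    also have "(A 0 - ?S) (e k) \<bullet> e k \<le> d"
    proof -
      have "(A 0 - ?S) (e k) \<bullet> e k \<le> norm ((A 0 - ?S) (e k)) * norm (e k)"
        by (rule norm_cauchy_schwarz)
      also have "\<dots> \<le> norm (A 0 - ?S)" using norm_blinfun[of "A 0 - ?S" "e k"] ek by simp
      finally show ?thesis using near by simp
    qed
    also have "?S (e k) \<bullet> e k = (\<Sum>j<N. (cinner (e k) (b j) * cinner (a j) (e k)) \<bullet> 1)"
      by (simp add: blinfun.sum_left inner_sum_left) (simp add: cinner_one[symmetric])
    also have "\<dots> \<le> (\<Sum>j<N. (norm (cinner (a j) (e k)))\<^sup>2 + (norm (cinner (b j) (e k)))\<^sup>2)"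
    proof (rule sum_mono)
      fix j
      let ?x = "norm (cinner (a j) (e k))" and ?y = "norm (cinner (b j) (e k))"
      have "(cinner (e k) (b j) * cinner (a j) (e k)) \<bullet> 1
          \<le> norm (cinner (e k) (b j) * cinner (a j) (e k)) * norm (1::'k)"
        by (rule norm_cauchy_schwarz)
      also have "\<dots> = ?y * ?x"
        using cinner_commute[of "e k" "b j"] by (simp add: norm_mult)
      also have "\<dots> \<le> ?x\<^sup>2 + ?y\<^sup>2"
        using sum_squares_bound[of ?x ?y] mult_nonneg_nonneg[OF norm_ge_zero norm_ge_zero, of "cinner (a j) (e k)" "cinner (b j) (e k)"]
          mult.commute[of ?x ?y]
        by linarith
      finally show "(cinner (e k) (b j) * cinner (a j) (e k)) \<bullet> 1 \<le> ?x\<^sup>2 + ?y\<^sup>2" .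
    qed
    finally show ?thesis by simp
  qed
  have "real n * (s n)\<^sup>2 = (\<Sum>k<n. (s n)\<^sup>2)" by simp
  also have "\<dots> \<le> (\<Sum>k<n. d + (\<Sum>j<N. (norm (cinner (a j) (e k)))\<^sup>2 + (norm (cinner (b j) (e k)))\<^sup>2))"
    using * by (intro sum_mono) auto
  also have "\<dots> = real n * d + (\<Sum>j<N. (\<Sum>k<n. (norm (cinner (a j) (e k)))\<^sup>2) + (\<Sum>k<n. (norm (cinner (b j) (e k)))\<^sup>2))"
    by (simp add: sum.distrib sum.swap[of _ "{..<N}" "{..<n}"])
  also have "\<dots> \<le> real n * d + (\<Sum>j<N. (norm (a j))\<^sup>2 + (norm (b j))\<^sup>2)"
    by (intro add_mono sum_mono bessel[OF oz_e]) auto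
  finally show ?thesis .
qed

end

section \<open>Continuous families of compact operators\<close>

definition rk_sum :: "nat \<Rightarrow> (nat \<Rightarrow> 't \<Rightarrow> ('i, 'k::rclike) ell2) \<Rightarrow> (nat \<Rightarrow> 't \<Rightarrow> ('i, 'k) ell2)
    \<Rightarrow> 't \<Rightarrow> ('i, 'k) ell2 \<Rightarrow>\<^sub>L ('i, 'k) ell2"
  where "rk_sum N a b t = (\<Sum>j<N. rk (a j t) (b j t))"

text \<open>The rank bound N is common to all t. This single condition yields norm continuity, a
  common compact set for the images of the unit ball, and decay of singular values uniform in t; it
  also survives adjoints and deflation.\<close>

definition fin_approx :: "('t::topological_space \<Rightarrow> ('i, 'k::rclike) ell2 \<Rightarrow>\<^sub>L ('i, 'k) ell2) \<Rightarrow> bool"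
  where "fin_approx w \<longleftrightarrow> (\<forall>d>0. \<exists>N a b.
    (\<forall>j. continuous_on UNIV (a j)) \<and> (\<forall>j. continuous_on UNIV (b j)) \<and>
    (\<forall>t. norm (w t - rk_sum N a b t) \<le> d))"

lemma fin_approxE:
  assumes "fin_approx w" "d > 0"
  obtains N a b where "\<And>j. continuous_on UNIV (a j)" "\<And>j. continuous_on UNIV (b j)"
    "\<And>t. norm (w t - rk_sum N a b t) \<le> d"
  using assms unfolding fin_approx_def by meson

lemma continuous_on_rk_sum:
  "(\<And>j. continuous_on S (a j)) \<Longrightarrow> (\<And>j. continuous_on S (b j)) \<Longrightarrow> continuous_on S (rk_sum N a b)"
  unfolding rk_sum_def by (intro continuous_intros)

lemma fin_approx_continuous:
  fixes w :: "'t::topological_space \<Rightarrow> ('i, 'k::rclike) ell2 \<Rightarrow>\<^sub>L ('i, 'k) ell2"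
  assumes "fin_approx w"
  shows "continuous_on UNIV w"
proof -
  have "\<exists>S. continuous_on UNIV S \<and> (\<forall>t. norm (w t - S t) \<le> inverse (real (Suc n)))" for n
  proof -
    have pos: "0 < inverse (real (Suc n))" by simp
    obtain N a b where "\<And>j. continuous_on UNIV (a j)" "\<And>j. continuous_on UNIV (b j)"
      "\<And>t. norm (w t - rk_sum N a b t) \<le> inverse (real (Suc n))"
      by (rule fin_approxE[OF assms pos]) (rule that)
    then show ?thesis
      by (intro exI[of _ "rk_sum N a b"] conjI allI continuous_on_rk_sum)
  qed
  then obtain S where S: "\<And>n. continuous_on UNIV (S n)"
    "\<And>n t. norm (w t - S n t) \<le> inverse (real (Suc n))" by metis
  have "uniform_limit UNIV S w sequentially"
    unfolding uniform_limit_iff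
  proof (intro allI impI)
    fix d :: real assume "d > 0"
    have "\<forall>\<^sub>F n in sequentially. inverse (real (Suc n)) < d"
      using LIMSEQ_inverse_real_of_nat \<open>d > 0\<close> by (rule order_tendstoD)
    then show "\<forall>\<^sub>F n in sequentially. \<forall>t\<in>UNIV. dist (S n t) (w t) < d"
    proof eventually_elim
      case (elim n)
      show ?case
      proof
        fix t
        show "dist (S n t) (w t) < d"
          using S(2)[where n = n and t = t] elim by (simp add: dist_norm norm_minus_commute)
      qed
    qed
  qed
  then show ?thesis
    by (rule uniform_limit_theorem[rotated]) (use S(1) in auto)
qed

lemma fin_approx_diff_rk:
  assumes "fin_approx w" "continuous_on UNIV g"
  shows "fin_approx (\<lambda>t. w t - rk (g t) (g t))"
  unfolding fin_approx_def
proof (intro allI impI)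
  fix d :: real assume d: "d > 0"
  obtain N a b where ab: "\<And>j. continuous_on UNIV (a j)" "\<And>j. continuous_on UNIV (b j)"
    "\<And>t. norm (w t - rk_sum N a b t) \<le> d"
    by (rule fin_approxE[OF assms(1) d]) (rule that)
  let ?a = "\<lambda>j. if j = N then (\<lambda>t. - g t) else a j" and ?b = "\<lambda>j. if j = N then g else b j"
  have "rk_sum (Suc N) ?a ?b t = rk_sum N a b t - rk (g t) (g t)" for t
    by (simp add: rk_sum_def rk.minus_left)
  then have "norm (w t - rk (g t) (g t) - rk_sum (Suc N) ?a ?b t) \<le> d" for t
    using ab(3)[of t] by simp
  moreover have "continuous_on UNIV (?a j)" "continuous_on UNIV (?b j)" for j
    using ab assms(2) by (auto intro!: continuous_intros)
  ultimately show "\<exists>N a b. (\<forall>j. continuous_on UNIV (a j)) \<and> (\<forall>j. continuous_on UNIV (b j)) \<and>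
      (\<forall>t. norm (w t - rk (g t) (g t) - rk_sum N a b t) \<le> d)"
    by (intro exI[of _ "Suc N"] exI[of _ ?a] exI[of _ ?b] conjI allI)
qed

text \<open>No adjoint of v t is presupposed: the adjoints of the finite rank approximants are
  explicit, and \<open>cadj_norm_le\<close> makes them a Cauchy sequence with the same rate, whose
  limit is the adjoint.\<close>

lemma fin_approx_adj:
  fixes v :: "'t::topological_space \<Rightarrow> ('i, 'k::rclike) ell2 \<Rightarrow>\<^sub>L ('i, 'k) ell2"
  assumes "fin_approx v"
  obtains v' where "fin_approx v'" "\<And>t. cadj (v t) (v' t)"
proof -
  have "\<exists>N a b. (\<forall>j. continuous_on UNIV (a j)) \<and> (\<forall>j. continuous_on UNIV (b j)) \<and>
      (\<forall>t. norm (v t - rk_sum N a b t) \<le> inverse (real (Suc n)))" for n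
    using assms unfolding fin_approx_def by simp
  then obtain N a b where ab: "\<And>n j. continuous_on UNIV (a n j)" "\<And>n j. continuous_on UNIV (b n j)"
    and near: "\<And>n t. norm (v t - rk_sum (N n) (a n) (b n) t) \<le> inverse (real (Suc n))"
    by metis
  define S where "S t n = rk_sum (N n) (a n) (b n) t" for t n
  define S' where "S' t n = rk_sum (N n) (b n) (a n) t" for t n
  have adj: "cadj (S t n) (S' t n)" for t n
    unfolding S_def S'_def rk_sum_def by (intro cadj_sum cadj_rk)
  have Sv: "S t \<longlonglongrightarrow> v t" for t
  proof (rule LIMSEQ_I)
    fix d :: real assume "d > 0"
    then obtain M where "inverse (real (Suc M)) < d" using reals_Archimedean by blast
    moreover have "norm (S t n - v t) \<le> inverse (real (Suc M))" if "n \<ge> M" for n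
    proof -
      have "norm (S t n - v t) \<le> inverse (real (Suc n))"
        using near[of t n] by (simp only: S_def norm_minus_commute)
      also have "\<dots> \<le> inverse (real (Suc M))"
        by (rule le_imp_inverse_le) (use that in auto)
      finally show ?thesis .
    qed
    ultimately have "norm (S t n - v t) < d" if "n \<ge> M" for n
      using that by (meson order_le_less_trans)
    then show "\<exists>no. \<forall>n\<ge>no. norm (S t n - v t) < d" by blast
  qed
  have le: "norm (S' t n - S' t m) \<le> inverse (real (Suc n)) + inverse (real (Suc m))" for t m n
  proof -
    have "norm (S' t n - S' t m) \<le> norm (S t n - S t m)"
      by (intro cadj_norm_le cadj_diff adj)
    also have "\<dots> = norm ((v t - S t m) - (v t - S t n))" by simp
    also have "\<dots> \<le> norm (v t - S t m) + norm (v t - S t n)" by (rule norm_triangle_ineq4)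
    finally show ?thesis using near[of t m] near[of t n] by (simp add: S_def)
  qed
  have "convergent (S' t)" for t
  proof (rule Cauchy_convergent, rule CauchyI)
    fix d :: real assume "d > 0"
    then obtain M where M: "inverse (real (Suc M)) < d / 2"
      using reals_Archimedean[of "d / 2"] by auto
    have "norm (S' t m - S' t n) < d" if "m \<ge> M" "n \<ge> M" for m n
    proof -
      have "inverse (real (Suc n)) \<le> inverse (real (Suc M))"
        "inverse (real (Suc m)) \<le> inverse (real (Suc M))"
        by (rule le_imp_inverse_le; use that in simp)+
      then show ?thesis using le[of t m n] M by linarith
    qed
    then show "\<exists>M. \<forall>m\<ge>M. \<forall>n\<ge>M. norm (S' t m - S' t n) < d" by blast
  qed
  then obtain v' where v': "\<And>t. S' t \<longlonglongrightarrow> v' t" unfolding convergent_def by metis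
  have le': "norm (v' t - S' t n) \<le> inverse (real (Suc n))" for t n
  proof (rule LIMSEQ_le)
    show "(\<lambda>m. norm (S' t m - S' t n)) \<longlonglongrightarrow> norm (v' t - S' t n)"
      by (intro tendsto_intros v')
    show "(\<lambda>m. inverse (real (Suc n)) + inverse (real (Suc m))) \<longlonglongrightarrow> inverse (real (Suc n))"
      using tendsto_add[OF tendsto_const LIMSEQ_inverse_real_of_nat, of "inverse (real (Suc n))"] by simp
    show "\<exists>M. \<forall>m\<ge>M. norm (S' t m - S' t n) \<le> inverse (real (Suc n)) + inverse (real (Suc m))"
      using le[of t _ n] by (auto simp: add.commute)
  qed
  have "fin_approx v'"
    unfolding fin_approx_def
  proof (intro allI impI)
    fix d :: real assume "d > 0"
    then obtain n where "inverse (real (Suc n)) < d" using reals_Archimedean by blast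
    then have "norm (v' t - rk_sum (N n) (b n) (a n) t) \<le> d" for t
      using le'[of t n] by (simp add: S'_def)
    with ab show "\<exists>N a b. (\<forall>j. continuous_on UNIV (a j)) \<and> (\<forall>j. continuous_on UNIV (b j)) \<and>
        (\<forall>t. norm (v' t - rk_sum N a b t) \<le> d)"
      by (intro exI[of _ "N n"] exI[of _ "b n"] exI[of _ "a n"] conjI allI)
  qed
  moreover have "cadj (v t) (v' t)" for t
    by (rule cadj_lim[OF Sv v' adj])
  ultimately show ?thesis by (rule that)
qed

section \<open>Common compact images, continuous eigenvector sections and uniform decay\<close>

context stonean
begin

lemma bounded_of_continuous:
  fixes f :: "'t \<Rightarrow> 'b::real_normed_vector"
  assumes "continuous_on UNIV f"
  obtains B where "B > 0" "\<And>t. norm (f t) \<le> B"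
  using compact_imp_bounded[OF compact_continuous_image[OF assms compact_space]]
  by (auto simp: bounded_pos)

lemma rk_sum_compact:
  fixes a b :: "nat \<Rightarrow> 't \<Rightarrow> ('i, 'k::rclike) ell2"
  assumes "\<And>j. continuous_on UNIV (a j)" "\<And>j. continuous_on UNIV (b j)"
  shows "\<exists>D. compact D \<and> (\<forall>t x. norm x \<le> 1 \<longrightarrow> rk_sum N a b t x \<in> D)"
proof (induction N)
  case 0
  show ?case by (rule exI[of _ "{0}"]) (simp add: rk_sum_def)
next
  case (Suc N)
  then obtain D where D: "compact D" "\<And>t x. norm x \<le> 1 \<Longrightarrow> rk_sum N a b t x \<in> D" by blast
  obtain B where B: "B > 0" "\<And>t. norm (b N t) \<le> B"
    using bounded_of_continuous[OF assms(2)[of N]] by blast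
  define E where "E = (\<lambda>(t, c). ksc c (a N t)) ` (UNIV \<times> cball 0 B)"
  have "continuous_on (UNIV \<times> cball 0 B) (\<lambda>p. ksc (snd p) (a N (fst p)))"
    by (intro continuous_intros continuous_on_compose2[OF assms(1)[of N]]) auto
  then have "compact E"
    unfolding E_def
    by (intro compact_continuous_image compact_Times compact_space compact_cball)
      (simp add: case_prod_unfold)
  then have "compact {x + y | x y. x \<in> D \<and> y \<in> E}" by (rule compact_sums[OF D(1)])
  moreover have "rk_sum (Suc N) a b t x \<in> {x + y | x y. x \<in> D \<and> y \<in> E}" if "norm x \<le> 1" for t x
  proof -
    have "norm (cinner x (b N t)) \<le> norm x * norm (b N t)" by (rule norm_cinner_le)
    also have "\<dots> \<le> 1 * B" by (intro mult_mono that B) auto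
    finally have "ksc (cinner x (b N t)) (a N t) \<in> E"
      unfolding E_def by (intro image_eqI[of _ _ "(t, cinner x (b N t))"]) auto
    moreover have "rk_sum (Suc N) a b t x = rk_sum N a b t x + ksc (cinner x (b N t)) (a N t)"
      by (simp add: rk_sum_def blinfun.add_left)
    ultimately show ?thesis using D(2)[OF that] by blast
  qed
  ultimately show ?case by blast
qed

text \<open>The finite rank approximants send the unit ball, for all t together, into one compact
  set. Hence the union of the images under all w t is totally bounded; its closure supplies the
  compact fibre space for Gleason's theorem.\<close>

lemma fin_approx_compact:
  fixes w :: "'t \<Rightarrow> ('i, 'k::rclike) ell2 \<Rightarrow>\<^sub>L ('i, 'k) ell2"
  assumes "fin_approx w"
  obtains C where "compact C" "\<And>t. w t ` cball 0 1 \<subseteq> C"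
proof -
  define B where "B = (\<Union>t. w t ` cball 0 1)"
  have "\<exists>K. finite K \<and> closure B \<subseteq> (\<Union>x\<in>K. ball x d)" if "d > 0" for d
  proof -
    have d4: "d / 4 > 0" using that by simp
    obtain N a b where ab: "\<And>j. continuous_on UNIV (a j)" "\<And>j. continuous_on UNIV (b j)"
      "\<And>t. norm (w t - rk_sum N a b t) \<le> d / 4"
      by (rule fin_approxE[OF assms d4]) (rule that)
    have "\<exists>D. compact D \<and> (\<forall>t x. norm x \<le> 1 \<longrightarrow> rk_sum N a b t x \<in> D)"
      by (rule rk_sum_compact) (rule ab)+
    then obtain D where D': "compact D" "\<forall>t x. norm x \<le> 1 \<longrightarrow> rk_sum N a b t x \<in> D"
      by (elim exE conjE) (rule that)
    then have D: "compact D" "\<And>t x. norm x \<le> 1 \<Longrightarrow> rk_sum N a b t x \<in> D"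
      by auto
    have cover: "D \<subseteq> (\<Union>x\<in>D. ball x (d / 4))" using d4 by auto
    obtain K where K: "K \<subseteq> D" "finite K" "D \<subseteq> (\<Union>x\<in>K. ball x (d / 4))"
      by (rule compactE_image[OF D(1) open_ball cover]) (rule that)
    have "B \<subseteq> (\<Union>x\<in>K. cball x (d / 2))"
    proof
      fix y assume "y \<in> B"
      then obtain t z where y: "y = w t z" "norm z \<le> 1" by (auto simp: B_def)
      obtain x where x: "x \<in> K" "dist x (rk_sum N a b t z) < d / 4"
        using D(2)[OF y(2), of t] K(3) by auto
      have "dist (rk_sum N a b t z) y = norm ((w t - rk_sum N a b t) z)"
        by (simp add: y blinfun.diff_left dist_norm norm_minus_commute)
      also have "\<dots> \<le> norm (w t - rk_sum N a b t) * norm z" by (rule norm_blinfun)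
      also have "\<dots> \<le> d / 4 * 1" by (intro mult_mono ab y(2)) (use d4 in auto)
      finally have "dist x y \<le> d / 2"
        using x(2) dist_triangle[of x y "rk_sum N a b t z"] by simp
      with x(1) show "y \<in> (\<Union>x\<in>K. cball x (d / 2))" by auto
    qed
    moreover have "closed (\<Union>x\<in>K. cball x (d / 2))" using K(2) by (intro closed_UN) auto
    ultimately have "closure B \<subseteq> (\<Union>x\<in>K. cball x (d / 2))" by (rule closure_minimal)
    also have "\<dots> \<subseteq> (\<Union>x\<in>K. ball x d)" using that by (intro UN_mono) auto
    finally show ?thesis using K(2) by (intro exI[of _ K] conjI)
  qed
  then have "compact (closure B)"
    unfolding compact_eq_totally_bounded by (simp add: complete_eq_closed)
  moreover have "w t ` cball 0 1 \<subseteq> closure B" for t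
    using closure_subset[of B] unfolding B_def by blast
  ultimately show ?thesis using that by blast
qed

end

context stonean
begin

text \<open>With the norm tied to the eigenvalue, the conditions on (t, y) are equations between
  continuous functions on T \<times> C, so G is compact; where w t = 0 its fibre consists of the
  zero vector alone.\<close>

lemma eigenvector_section:
  fixes w :: "'t \<Rightarrow> ('i, 'k::rclike) ell2 \<Rightarrow>\<^sub>L ('i, 'k) ell2"
  assumes w: "fin_approx w" and pos: "\<And>t. cpos (w t)"
  obtains y where "continuous_on UNIV y" "\<And>t. norm (y t) = norm (w t)"
    "\<And>t. w t (y t) = norm (w t) *\<^sub>R y t"
proof -
  obtain C where C: "compact C" "\<And>t. w t ` cball 0 1 \<subseteq> C"
    by (rule fin_approx_compact[OF w]) (rule that)
  define G where "G = (UNIV \<times> C) \<inter> {p. norm (snd p) = norm (w (fst p))}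
      \<inter> {p. w (fst p) (snd p) = norm (w (fst p)) *\<^sub>R snd p}"
  have cw: "continuous_on UNIV (\<lambda>p :: 't \<times> ('i, 'k) ell2. w (fst p))"
    by (rule continuous_on_compose2[OF fin_approx_continuous[OF w], of UNIV fst])
      (auto intro!: continuous_intros)
  have "closed {p :: 't \<times> ('i, 'k) ell2. norm (snd p) = norm (w (fst p))}"
    by (intro closed_Collect_eq continuous_intros cw)
  moreover have "closed {p :: 't \<times> ('i, 'k) ell2. w (fst p) (snd p) = norm (w (fst p)) *\<^sub>R snd p}"
    by (intro closed_Collect_eq continuous_intros cw)
  ultimately have "compact G"
    unfolding G_def by (intro compact_Int_closed compact_Times compact_space C(1))
  moreover have "fst ` G = UNIV"
  proof (rule fst_surjI)
    fix t
    obtain y where "y \<in> C" "norm y = norm (w t)" "w t y = norm (w t) *\<^sub>R y"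
      using top_eigenvector[OF pos C] by blast
    then show "\<exists>y. (t, y) \<in> G" by (auto simp: G_def)
  qed
  ultimately obtain y where "continuous_on UNIV y" "\<And>t. (t, y t) \<in> G"
    by (rule gleason_section) (rule that)
  then show ?thesis using that[of y] by (auto simp: G_def)
qed

text \<open>Dividing by the square root of the norm could be singular at zeros of y, but the
  quotient has norm sqrt |y| and tends to 0 there.\<close>

lemma scaled_eigenvector_section:
  fixes w :: "'t \<Rightarrow> ('i, 'k::rclike) ell2 \<Rightarrow>\<^sub>L ('i, 'k) ell2"
  assumes w: "fin_approx w" and pos: "\<And>t. cpos (w t)"
  obtains g where "continuous_on UNIV g" "\<And>t. (norm (g t))\<^sup>2 = norm (w t)"
    "\<And>t. w t (g t) = norm (w t) *\<^sub>R g t"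
proof -
  obtain y where y: "continuous_on UNIV y" "\<And>t. norm (y t) = norm (w t)"
    "\<And>t. w t (y t) = norm (w t) *\<^sub>R y t"
    by (rule eigenvector_section[OF w pos]) (rule that)
  define g where "g t = y t /\<^sub>R sqrt (norm (y t))" for t
  have ng: "norm (g t) = sqrt (norm (y t))" for t
    by (cases "y t = 0") (simp_all add: g_def real_div_sqrt divide_inverse_commute[symmetric])
  have "continuous_on UNIV g"
    unfolding continuous_on_def
  proof (intro ballI)
    fix t
    have yt: "(y \<longlongrightarrow> y t) (at t)" using y(1) by (simp add: continuous_on_def)
    show "(g \<longlongrightarrow> g t) (at t within UNIV)"
    proof (cases "y t = 0")
      case False
      then show ?thesis unfolding g_def by (intro tendsto_intros yt) auto
    next
      case True
      have "((\<lambda>s. sqrt (norm (y s))) \<longlongrightarrow> sqrt (norm (y t))) (at t)"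
        by (intro tendsto_intros yt)
      then have "((\<lambda>s. norm (g s)) \<longlongrightarrow> 0) (at t)" using True by (simp add: ng)
      then have "(g \<longlongrightarrow> 0) (at t)" by (rule tendsto_norm_zero_cancel)
      then show ?thesis using True by (simp add: g_def[of t])
    qed
  qed
  moreover have "(norm (g t))\<^sup>2 = norm (w t)" for t by (simp add: ng y(2))
  moreover have "w t (g t) = norm (w t) *\<^sub>R g t" for t
    by (simp add: g_def blinfun.scaleR_right y(3))
  ultimately show ?thesis by (rule that)
qed

lemma deflation_family:
  fixes w :: "'t \<Rightarrow> ('i, 'k::rclike) ell2 \<Rightarrow>\<^sub>L ('i, 'k) ell2"
  assumes "fin_approx w" and "\<And>t. cpos (w t)"
  obtains W g where "\<And>t. W t 0 = w t" "\<And>t. deflation (W t) (g t)"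
    "\<And>n. continuous_on UNIV (\<lambda>t. g t n)"
proof -
  define P where "P w \<longleftrightarrow> fin_approx w \<and> (\<forall>t. cpos (w t))"
    for w :: "'t \<Rightarrow> ('i, 'k) ell2 \<Rightarrow>\<^sub>L ('i, 'k) ell2"
  \<comment> \<open>Eigenvector sections are chosen for all admissible families at once, so that one
    deflation step becomes a function of the family and can be iterated.\<close>
  have "\<exists>g. P w \<longrightarrow> continuous_on UNIV g \<and> (\<forall>t. (norm (g t))\<^sup>2 = norm (w t)) \<and>
      (\<forall>t. w t (g t) = norm (w t) *\<^sub>R g t)" for w
  proof (cases "P w")
    case True
    then have w: "fin_approx w" "\<And>t. cpos (w t)" by (simp_all add: P_def)
    obtain g where "continuous_on UNIV g" "\<And>t. (norm (g t))\<^sup>2 = norm (w t)"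
      "\<And>t. w t (g t) = norm (w t) *\<^sub>R g t"
      by (rule scaled_eigenvector_section[OF w]) (rule that)
    then show ?thesis by (intro exI[of _ g] impI conjI allI)
  qed simp
  then obtain G where G': "\<And>w. P w \<longrightarrow> continuous_on UNIV (G w) \<and>
      (\<forall>t. (norm (G w t))\<^sup>2 = norm (w t)) \<and> (\<forall>t. w t (G w t) = norm (w t) *\<^sub>R G w t)"
    by metis
  have G: "continuous_on UNIV (G w)" "(norm (G w t))\<^sup>2 = norm (w t)"
    "w t (G w t) = norm (w t) *\<^sub>R G w t" if "P w" for w t
    using G'[of w] that by auto
  define V where "V n = ((\<lambda>w t. w t - rk (G w t) (G w t)) ^^ n) w" for n
  have V_Suc: "V (Suc n) = (\<lambda>t. V n t - rk (G (V n) t) (G (V n) t))" for n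
    by (simp add: V_def)
  have PV: "P (V n)" for n
  proof (induction n)
    case 0
    show ?case using assms by (simp add: P_def V_def)
  next
    case (Suc n)
    then have "fin_approx (V (Suc n))"
      unfolding V_Suc by (intro fin_approx_diff_rk G(1)) (auto simp: P_def)
    moreover have "cpos (V (Suc n) t)" for t
      unfolding V_Suc using Suc G(2,3)[OF Suc] by (intro deflate(1)) (auto simp: P_def)
    ultimately show ?case by (simp add: P_def)
  qed
  show ?thesis
  proof (rule that[of "\<lambda>t n. V n t" "\<lambda>t n. G (V n) t"])
    show "V 0 t = w t" for t by (simp add: V_def)
    show "continuous_on UNIV (\<lambda>t. G (V n) t)" for n using G(1)[OF PV] by simp
    show "deflation (\<lambda>n. V n t) (\<lambda>n. G (V n) t)" for t
      using G(2,3)[OF PV] PV by unfold_locales (simp_all add: V_Suc P_def)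
  qed
qed

text \<open>The constant in \<open>s_decay\<close> is a continuous function of t, hence bounded on T
  by some M. Half of d^2 is spent on the approximation, and n is taken so large that M is at most n
  times the other half.\<close>

lemma fin_approx_uniform_decay:
  fixes w :: "'t \<Rightarrow> ('i, 'k::rclike) ell2 \<Rightarrow>\<^sub>L ('i, 'k) ell2"
  assumes w: "fin_approx w" and W: "\<And>t. W t 0 = w t" "\<And>t. deflation (W t) (g t)" and "d > 0"
  shows "\<exists>n. \<forall>t. norm (g t n) \<le> d"
proof -
  have d2: "d\<^sup>2 / 2 > 0" using \<open>d > 0\<close> by simp
  obtain N a b where ab: "\<And>j. continuous_on UNIV (a j)" "\<And>j. continuous_on UNIV (b j)"
    "\<And>t. norm (w t - rk_sum N a b t) \<le> d\<^sup>2 / 2"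
    by (rule fin_approxE[OF w d2]) (rule that)
  have cont: "continuous_on UNIV (\<lambda>t. \<Sum>j<N. (norm (a j t))\<^sup>2 + (norm (b j t))\<^sup>2)"
    by (intro continuous_intros ab)
  obtain M where "M > 0" and M: "\<And>t. norm (\<Sum>j<N. (norm (a j t))\<^sup>2 + (norm (b j t))\<^sup>2) \<le> M"
    by (rule bounded_of_continuous[OF cont]) (rule that)
  obtain n where n: "real n > M / (d\<^sup>2 / 2)" using reals_Archimedean2 by blast
  then have Mn: "M < real n * (d\<^sup>2 / 2)" using d2 by (simp add: pos_divide_less_eq)
  have "n \<noteq> 0" using Mn \<open>M > 0\<close> by (intro notI) simp
  then have "real n > 0" by simp
  have "norm (g t n) \<le> d" for t
  proof -
    interpret deflation "W t" "g t" by (rule W)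
    have "real n * (s n)\<^sup>2 \<le> real n * (d\<^sup>2 / 2) + (\<Sum>j<N. (norm (a j t))\<^sup>2 + (norm (b j t))\<^sup>2)"
      by (rule s_decay) (use ab(3)[of t] in \<open>simp add: W rk_sum_def\<close>)
    also have "\<dots> \<le> real n * d\<^sup>2" using M[of t] Mn by simp
    finally have "(s n)\<^sup>2 \<le> d\<^sup>2" using \<open>real n > 0\<close> by simp
    then show ?thesis
      unfolding s_def[symmetric] by (rule power2_le_imp_le) (use \<open>d > 0\<close> in simp)
  qed
  then show ?thesis by blast
qed

end

section \<open>Singular value decomposition of a continuous family\<close>

text \<open>The vectors y are the right and x the left singular vectors. The last clause admits
  every finite F containing the first n indices, not only initial segments, because the series of
  the statement is summed over the net of finite sets.\<close>

definition svd_at :: "(('i, 'k::rclike) ell2 \<Rightarrow>\<^sub>L ('i, 'k) ell2) \<Rightarrow> (nat \<Rightarrow> real)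
    \<Rightarrow> (nat \<Rightarrow> ('i, 'k) ell2) \<Rightarrow> (nat \<Rightarrow> ('i, 'k) ell2) \<Rightarrow> bool"
  where "svd_at v s x y \<longleftrightarrow> decseq s \<and> (\<forall>n. 0 \<le> s n) \<and> oz x \<and> oz y \<and>
    (\<forall>n. x n \<noteq> 0 \<longleftrightarrow> s n \<noteq> 0) \<and> (\<forall>n. y n \<noteq> 0 \<longleftrightarrow> s n \<noteq> 0) \<and>
    (\<forall>n. v (y n) = s n *\<^sub>R x n) \<and> (\<exists>v'. cadj v v' \<and> (\<forall>n. v' (x n) = s n *\<^sub>R y n)) \<and>
    (\<forall>z F n. finite F \<and> {..<n} \<subseteq> F \<longrightarrow>
      norm (v z - (\<Sum>k\<in>F. s k *\<^sub>R ksc (cinner z (y k)) (x k))) \<le> s n * norm z)"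

text \<open>The remainder after the terms in F is v applied to the projection p of z off the chosen
  e k. As p is orthogonal to the first n of them, A 0 p = A n p, so |v p|^2 = \<langle>A n p,
  p\<rangle> is bounded by the norm of A n, which is s n squared, times |z|^2. Where s n = 0, the
  inverse 0 makes the left vector zero as required.\<close>

lemma (in deflation) svd_at_deflation:
  assumes v: "cadj v v'" "A 0 = v' o\<^sub>L v"
  shows "svd_at v s (\<lambda>n. v (e n) /\<^sub>R s n) e"
proof -
  let ?x = "\<lambda>n. v (e n) /\<^sub>R s n"
  have v'v: "v' (v (e n)) = (s n)\<^sup>2 *\<^sub>R e n" for n
    using A_0_e[of n] by (simp add: v)
  have vc: "cinner (v x) (v y) = cinner (A 0 x) y" for x y
    by (simp add: v cadjD[OF cadj_commute[OF v(1)]])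
  have vn: "(norm (v x))\<^sup>2 = A 0 x \<bullet> x" for x
    unfolding cinner_one[symmetric] vc[symmetric] by (simp add: cinner_one power2_norm_eq_inner)
  have vex: "v (e n) = s n *\<^sub>R ?x n" for n
    by (cases "s n = 0") (use e_nonzero[of n] in \<open>auto simp: blinfun.zero_right\<close>)
  have ozx: "cinner (?x m) (?x n) = (if m = n \<and> s n \<noteq> 0 then 1 else 0)" for m n
  proof -
    have "cinner (?x m) (?x n) = of_real (inverse (s m) * inverse (s n) * (s m)\<^sup>2) * cinner (e m) (e n)"
      by (simp add: cinner.scaleR_left cinner.scaleR_right vc A_0_e scaleR_conv_of_real mult_ac)
    then show ?thesis
      by (auto simp: ozD[OF oz_e] e_nonzero power2_eq_square field_simps)
  qed
  have x0: "?x n \<noteq> 0 \<longleftrightarrow> s n \<noteq> 0" for n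
    using ozx[of n n] by (auto simp: cinner.zero_left)
  have "oz ?x" unfolding oz_def by (intro allI) (simp only: ozx x0)
  moreover have "decseq s" unfolding decseq_def using antimono_s by blast
  moreover have "v' (?x n) = s n *\<^sub>R e n" for n
    by (cases "s n = 0") (auto simp: blinfun.scaleR_right v'v power2_eq_square blinfun.zero_right)
  moreover have "norm (v z - (\<Sum>k\<in>F. s k *\<^sub>R ksc (cinner z (e k)) (?x k))) \<le> s n * norm z"
    if F: "finite F" "{..<n} \<subseteq> F" for z F n
  proof -
    let ?p = "proj_off e F z"
    have kx: "s k *\<^sub>R ksc c (?x k) = v (ksc c (e k))" for k c
      unfolding cadj_ksc[OF v(1)] by (subst (2) vex) (simp add: ksc.scaleR_right)
    have vp: "v z - (\<Sum>k\<in>F. s k *\<^sub>R ksc (cinner z (e k)) (?x k)) = v ?p"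
      unfolding kx by (simp add: proj_off_def blinfun.diff_right blinfun.sum_right)
    have "A 0 ?p = A n ?p"
      by (rule A_0_orth, rule proj_off_orth[OF oz_e F(1)]) (use F(2) in auto)
    then have "(norm (v ?p))\<^sup>2 \<le> norm (A n ?p) * norm ?p"
      by (simp add: vn norm_cauchy_schwarz)
    also have "\<dots> \<le> norm (A n) * norm ?p * norm ?p"
      by (intro mult_right_mono norm_blinfun) simp
    also have "\<dots> \<le> norm (A n) * norm z * norm z"
      by (intro mult_mono norm_proj_off_le[OF oz_e F(1)]) auto
    also have "\<dots> = (s n * norm z)\<^sup>2" by (simp add: s_sq power_mult_distrib power2_eq_square[of "norm z"])
    finally have "norm (v ?p) \<le> s n * norm z"
      by (rule power2_le_imp_le) (simp add: s_nonneg)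
    then show ?thesis unfolding vp .
  qed
  ultimately show ?thesis
    unfolding svd_at_def using oz_e s_nonneg x0 e_nonzero vex v(1) by blast
qed

context stonean
begin

text \<open>Deflation is applied to the product of the adjoint with v, not to v itself. The left
  vectors arise as v y / s, so their continuity, too, is only claimed where s is nonzero.\<close>

theorem svd_family:
  fixes v :: "'t \<Rightarrow> ('i, 'k::rclike) ell2 \<Rightarrow>\<^sub>L ('i, 'k) ell2"
  assumes v: "fin_approx v"
  obtains s x y where "\<And>t. svd_at (v t) (\<lambda>n. s n t) (\<lambda>n. x n t) (\<lambda>n. y n t)"
    "\<And>n. continuous_on UNIV (s n)" "\<And>n. continuous_on {t. s n t \<noteq> 0} (x n)"
    "\<And>n. continuous_on {t. s n t \<noteq> 0} (y n)" "\<And>d. d > 0 \<Longrightarrow> \<exists>n. \<forall>t. s n t \<le> d"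
    "\<And>n t. cpos (v t) \<Longrightarrow> x n t = y n t"
proof -
  obtain v' where v': "fin_approx v'" "\<And>t. cadj (v t) (v' t)"
    by (rule fin_approx_adj[OF v]) (rule that)
  have cv: "continuous_on UNIV v" "continuous_on UNIV v'"
    using v v'(1) by (auto intro: fin_approx_continuous)
  obtain B where B: "B > 0" "\<And>t. norm (v t) \<le> B"
    by (rule bounded_of_continuous[OF cv(1)]) (rule that)
  define w where "w t = v' t o\<^sub>L v t" for t
  have "fin_approx w"
    unfolding fin_approx_def
  proof (intro allI impI)
    fix d :: real assume "d > 0"
    then have dB: "d / B > 0" using B by simp
    obtain N a b where ab: "\<And>j. continuous_on UNIV (a j)" "\<And>j. continuous_on UNIV (b j)"
      "\<And>t. norm (v' t - rk_sum N a b t) \<le> d / B"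
      by (rule fin_approxE[OF v'(1) dB]) (rule that)
    \<comment> \<open>Composing \<open>rk a b\<close> with v on the right replaces b by its image
      under the adjoint; thus the product inherits finite rank approximants of the same rank, and
      the error grows by at most the bound B.\<close>
    let ?b = "\<lambda>j t. v' t (b j t)"
    have "norm (w t - rk_sum N a ?b t) \<le> d" for t
    proof -
      have "rk_sum N a ?b t = rk_sum N a b t o\<^sub>L v t"
        by (rule blinfun_eqI) (simp add: rk_sum_def blinfun.sum_left cadjD[OF v'(2)])
      then have "w t - rk_sum N a ?b t = (v' t - rk_sum N a b t) o\<^sub>L v t"
        by (intro blinfun_eqI) (simp add: w_def blinfun.diff_left)
      then have "norm (w t - rk_sum N a ?b t) \<le> norm (v' t - rk_sum N a b t) * norm (v t)"
        by (simp add: norm_blinfun_compose)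
      also have "\<dots> \<le> d / B * B" by (intro mult_mono ab B) (use \<open>d / B > 0\<close> in auto)
      finally show ?thesis using B(1) by simp
    qed
    moreover have "continuous_on UNIV (?b j)" for j by (intro continuous_intros cv ab)
    ultimately show "\<exists>N a b. (\<forall>j. continuous_on UNIV (a j)) \<and> (\<forall>j. continuous_on UNIV (b j)) \<and>
        (\<forall>t. norm (w t - rk_sum N a b t) \<le> d)"
      by (intro exI[of _ N] exI[of _ a] exI[of _ ?b] conjI allI ab(1))
  qed
  moreover have "cpos (w t)" for t
    unfolding cpos_def cadj_def w_def using v'(2)[of t]
    by (auto simp: cadjD cadjD[OF cadj_commute] cadj_inner[OF cadj_commute])
  ultimately obtain W g where W: "\<And>t. W t 0 = w t" "\<And>t. deflation (W t) (g t)"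
    and g: "\<And>n. continuous_on UNIV (\<lambda>t. g t n)"
    by (rule deflation_family) (rule that)
  define s where "s n t = norm (g t n)" for n t
  define y where "y n t = g t n /\<^sub>R norm (g t n)" for n t
  define x where "x n t = v t (y n t) /\<^sub>R s n t" for n t
  have svd: "svd_at (v t) (\<lambda>n. s n t) (\<lambda>n. x n t) (\<lambda>n. y n t)" for t
  proof -
    interpret D: deflation "W t" "g t" by (rule W)
    have "D.s = (\<lambda>n. s n t)" "D.e = (\<lambda>n. y n t)"
      by (auto simp: fun_eq_iff s_def y_def D.e_def D.s_def)
    moreover have "W t 0 = v' t o\<^sub>L v t" by (simp add: W w_def)
    ultimately show ?thesis
      using D.svd_at_deflation[OF v'(2)[of t]] by (simp add: x_def)
  qed
  show ?thesis
  proof (rule that[of s x y])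
    show "svd_at (v t) (\<lambda>n. s n t) (\<lambda>n. x n t) (\<lambda>n. y n t)" for t by (rule svd)
    show "continuous_on UNIV (s n)" for n
      unfolding s_def by (intro continuous_intros g)
    have cy: "continuous_on {t. s n t \<noteq> 0} (y n)" for n
      unfolding y_def s_def by (intro continuous_intros continuous_on_subset[OF g]) auto
    then show "continuous_on {t. s n t \<noteq> 0} (y n)" for n .
    show "continuous_on {t. s n t \<noteq> 0} (x n)" for n
      unfolding x_def using cy[of n]
      by (intro continuous_intros continuous_on_subset[OF cv(1)]) (auto simp: s_def
          intro!: continuous_intros continuous_on_subset[OF g])
    show "\<exists>n. \<forall>t. s n t \<le> d" if "d > 0" for d
      unfolding s_def using fin_approx_uniform_decay[OF \<open>fin_approx w\<close> W that] .
    show "x n t = y n t" if "cpos (v t)" for n t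
    proof (cases "s n t = 0")
      case True
      moreover have "x n t \<noteq> 0 \<longleftrightarrow> s n t \<noteq> 0" "y n t \<noteq> 0 \<longleftrightarrow> s n t \<noteq> 0"
        using svd[of t] unfolding svd_at_def by auto
      ultimately show ?thesis by simp
    next
      case False
      have s: "s n t > 0" using False by (simp add: s_def)
      have "\<exists>u. cadj (v t) u \<and> (\<forall>n. u (x n t) = s n t *\<^sub>R y n t)"
        and vy: "v t (y n t) = s n t *\<^sub>R x n t"
        using svd[of t] by (simp_all add: svd_at_def)
      then obtain u where u: "cadj (v t) u" "u (x n t) = s n t *\<^sub>R y n t" by auto
      \<comment> \<open>For positive v t the two singular vector relations say that v t squared has
        eigenvalue s squared at y; \<open>eigen_of_square\<close> then gives the eigenvalue s of v
        t, so the left and right vectors coincide.\<close>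
      have "u = v t" using u(1) that by (auto simp: cpos_def intro: cadj_unique)
      then have "v t (v t (y n t)) = (s n t)\<^sup>2 *\<^sub>R y n t"
        by (simp add: vy blinfun.scaleR_right u(2)[unfolded \<open>u = v t\<close>] power2_eq_square)
      then have "v t (y n t) = s n t *\<^sub>R y n t"
        using that s by (intro eigen_of_square) (auto simp: cpos_def)
      with vy False show ?thesis by simp
    qed
  qed
qed

end

section \<open>Operators on the sequence space of the statement\<close>

definition ket :: "'i \<Rightarrow> ('i, 'k::rclike) ell2"
  where "ket i = Ell2 (\<lambda>j. if j = i then 1 else 0)"

lemma coords_ket: "coords (ket i :: ('i, 'k::rclike) ell2) j = (if j = i then 1 else 0)"
proof -
  have "(\<lambda>j. (norm (if j = i then 1 else 0 :: 'k))\<^sup>2) summable_on UNIV"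
  proof (rule sq_summable_of_bounded)
    fix F :: "'i set" assume "finite F"
    have "(\<Sum>j\<in>F. (norm (if j = i then 1 else 0 :: 'k))\<^sup>2) = (\<Sum>j\<in>F. if j = i then 1 else 0)"
      by (rule sum.cong) auto
    also have "\<dots> \<le> 1" using \<open>finite F\<close> by simp
    finally show "(\<Sum>j\<in>F. (norm (if j = i then 1 else 0 :: 'k))\<^sup>2) \<le> 1" .
  qed
  then show ?thesis by (simp add: ket_def coords_Ell2)
qed

lemma cinner_ket: "cinner x (ket i) = coords x i"
proof -
  have "cinner x (ket i) = (\<Sum>\<^sub>\<infinity>j\<in>{i}. coords x j * kconj (coords (ket i) j))"
    unfolding cinner_def by (rule infsum_cong_neutral) (auto simp: coords_ket)
  then show ?thesis by (simp add: coords_ket)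
qed

lemma ell2_approx:
  assumes "d > 0"
  obtains F where "finite F" "norm (x - (\<Sum>i\<in>F. ksc (coords x i) (ket i))) \<le> d"
proof -
  have "\<exists>F. finite F \<and> (norm x)\<^sup>2 - d\<^sup>2 < (\<Sum>i\<in>F. (norm (coords x i))\<^sup>2)"
  proof (rule ccontr)
    assume *: "\<not> ?thesis"
    have "(norm x)\<^sup>2 \<le> (norm x)\<^sup>2 - d\<^sup>2"
      unfolding norm_ell2_sq[of x]
      by (rule infsum_le_finite_sums[OF coords_sq_summable])
        (use * in \<open>auto simp: not_less norm_ell2_sq\<close>)
    with assms show False by simp
  qed
  then obtain F where F: "finite F" "(norm x)\<^sup>2 - d\<^sup>2 < (\<Sum>i\<in>F. (norm (coords x i))\<^sup>2)" by auto
  let ?r = "x - (\<Sum>i\<in>F. ksc (coords x i) (ket i))"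
  have r: "coords ?r j = (if j \<in> F then 0 else coords x j)" for j
    using F(1) by (simp add: coords_ket if_distrib[of "\<lambda>c. coords x _ * c"] cong: if_cong)
  have "norm ?r \<le> d"
  proof (rule norm_ell2_le)
    fix G :: "'a set" assume G: "finite G"
    have "(\<Sum>i\<in>G. (norm (coords ?r i))\<^sup>2) = (\<Sum>i\<in>G - F. (norm (coords x i))\<^sup>2)"
      unfolding r by (rule sum.mono_neutral_cong_right) (use G in auto)
    also have "\<dots> = (\<Sum>i\<in>(G - F) \<union> F. (norm (coords x i))\<^sup>2) - (\<Sum>i\<in>F. (norm (coords x i))\<^sup>2)"
      using G F(1) by (subst sum.union_disjoint) auto
    also have "\<dots> \<le> (norm x)\<^sup>2 - (\<Sum>i\<in>F. (norm (coords x i))\<^sup>2)"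
      using sum_coords_le[of "(G - F) \<union> F" x] G F(1) by simp
    also have "\<dots> \<le> d\<^sup>2" using F(2) by simp
    finally show "(\<Sum>i\<in>G. (norm (coords ?r i))\<^sup>2) \<le> d\<^sup>2" .
  qed (use assms in simp)
  with F(1) show ?thesis by (rule that)
qed

text \<open>The coordinates of the adjoint at y must be \<langle>y, A (ket i)\<rangle>. They are
  square summable: testing A on their own finite combination z gives a partial sum S of squares with
  S = \<langle>y, A z\<rangle> \<le> |A| |y| sqrt S. The adjoint relation holds on finite
  combinations of the \<open>ket\<close> vectors and extends by density.\<close>

lemma adjoint_exists:
  fixes A :: "('i, 'k::rclike) ell2 \<Rightarrow>\<^sub>L ('i, 'k) ell2"
  assumes lin: "\<And>c x. A (ksc c x) = ksc c (A x)"
  obtains B where "cadj A B"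
proof -
  have le: "(\<Sum>i\<in>F. (norm (cinner y (A (ket i))))\<^sup>2) \<le> (norm A * norm y)\<^sup>2" if F: "finite F" for F y
  proof -
    let ?b = "\<lambda>i. cinner y (A (ket i))"
    let ?z = "\<Sum>i\<in>F. ksc (?b i) (ket i)" and ?S = "\<Sum>i\<in>F. (norm (?b i))\<^sup>2"
    have cz: "coords ?z j = (if j \<in> F then ?b j else 0)" for j
      using F by (simp add: coords_ket if_distrib[of "\<lambda>c. cinner _ _ * c"] cong: if_cong)
    have "norm ?z \<le> sqrt ?S"
    proof (rule norm_ell2_le)
      fix G :: "'i set" assume G: "finite G"
      have "(\<Sum>i\<in>G. (norm (coords ?z i))\<^sup>2) = (\<Sum>i\<in>G \<inter> F. (norm (?b i))\<^sup>2)"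
        unfolding cz by (rule sum.mono_neutral_cong_right) (use G in auto)
      also have "\<dots> \<le> ?S" by (rule sum_mono2) (use F in auto)
      finally show "(\<Sum>i\<in>G. (norm (coords ?z i))\<^sup>2) \<le> (sqrt ?S)\<^sup>2" by (simp add: sum_nonneg)
    qed (simp add: sum_nonneg)
    have "of_real ?S = cinner y (A ?z)"
      by (simp add: blinfun.sum_right lin cinner.sum_right mult_kconj_of_real[symmetric] mult.commute
          del: of_real_power)
    then have "?S = norm (cinner y (A ?z))"
      using norm_of_real[of ?S, where 'a = 'k] by (simp add: sum_nonneg)
    also have "\<dots> \<le> norm y * norm (A ?z)" by (rule norm_cinner_le)
    also have "\<dots> \<le> norm y * (norm A * sqrt ?S)"
      using \<open>norm ?z \<le> sqrt ?S\<close>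
      by (intro mult_left_mono order_trans[OF norm_blinfun]) auto
    finally have *: "sqrt ?S * sqrt ?S \<le> (norm A * norm y) * sqrt ?S"
      by (simp add: sum_nonneg mult_ac)
    have "sqrt ?S \<le> norm A * norm y"
    proof (cases "sqrt ?S = 0")
      case False
      then have "0 < sqrt ?S" using real_sqrt_ge_zero[OF sum_nonneg, of F "\<lambda>i. (norm (?b i))\<^sup>2"]
        by (metis less_eq_real_def zero_le_power2)
      with * show ?thesis by (rule mult_right_le_imp_le)
    qed simp
    then have "(sqrt ?S)\<^sup>2 \<le> (norm A * norm y)\<^sup>2" by (rule power_mono) (simp add: sum_nonneg)
    then show ?thesis by (simp add: sum_nonneg)
  qed
  define B where "B y = Ell2 (\<lambda>i. cinner y (A (ket i)))" for y
  have cB: "coords (B y) i = cinner y (A (ket i))" for y i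
    unfolding B_def by (subst coords_Ell2) (auto intro!: sq_summable_of_bounded le)
  have "bounded_linear B"
  proof (rule bounded_linear_intro)
    show "B (x + y) = B x + B y" for x y by (rule ell2_eqI) (simp add: cB cinner.add_left)
    show "B (r *\<^sub>R x) = r *\<^sub>R B x" for r x by (rule ell2_eqI) (simp add: cB cinner.scaleR_left)
    show "norm (B x) \<le> norm x * norm A" for x
      using le[of _ x] by (intro norm_ell2_le) (auto simp: cB mult.commute)
  qed
  then have B: "blinfun_apply (Blinfun B) = B" by (rule bounded_linear_Blinfun_apply)
  have "cinner (A x) y = cinner x (B y)" for x y
  proof -
    let ?f = "\<lambda>x. cinner (A x) y - cinner x (B y)"
    have sum0: "?f (\<Sum>i\<in>F. ksc (c i) (ket i)) = 0" for F c
      by (simp add: blinfun.sum_right cinner.sum_left lin cB cinner_commute[of "ket _"] cinner_ket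
          cinner_commute[of y "A (ket _)"])
    have "norm (?f x) \<le> d" if "d > 0" for d
    proof -
      let ?K = "norm A * norm y + norm (B y) + 1"
      have K: "?K > 0" by (intro add_nonneg_pos add_nonneg_nonneg mult_nonneg_nonneg) auto
      then have dK: "d / ?K > 0" using \<open>d > 0\<close> by simp
      obtain F where F: "finite F" "norm (x - (\<Sum>i\<in>F. ksc (coords x i) (ket i))) \<le> d / ?K"
        by (rule ell2_approx[OF dK]) (rule that)
      let ?r = "x - (\<Sum>i\<in>F. ksc (coords x i) (ket i))"
      have "?f x = ?f ?r"
        using sum0[where c = "coords x" and F = F] by (simp add: blinfun.diff_right cinner.diff_left)
      also have "norm (?f ?r) \<le> norm (cinner (A ?r) y) + norm (cinner ?r (B y))"
        by (rule norm_triangle_ineq4)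
      also have "\<dots> \<le> norm (A ?r) * norm y + norm ?r * norm (B y)"
        by (intro add_mono norm_cinner_le)
      also have "\<dots> \<le> norm A * norm ?r * norm y + norm ?r * norm (B y)"
        by (intro add_right_mono mult_right_mono norm_blinfun) simp
      also have "\<dots> \<le> norm ?r * ?K" by (simp add: algebra_simps)
      also have "\<dots> \<le> d / ?K * ?K" using F(2) K by (intro mult_right_mono) auto
      finally show ?thesis using K by simp
    qed
    then have "norm (?f x) \<le> 0" by (rule field_le_epsilon[of _ 0, simplified])
    then show ?thesis by simp
  qed
  then have "cadj A (Blinfun B)" by (simp add: cadj_def B)
  then show ?thesis by (rule that)
qed

section \<open>Dictionary between operators on \<open>l2 I\<close> and bounded operators on
  \<open>ell2\<close>\<close>

definition supp_in :: "'i set \<Rightarrow> ('i, 'k::rclike) ell2 \<Rightarrow> bool"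
  where "supp_in I x \<longleftrightarrow> (\<forall>i. i \<notin> I \<longrightarrow> coords x i = 0)"

lemma l2_summable: "\<zeta> \<in> l2 I \<Longrightarrow> (\<lambda>i. (norm (\<zeta> i))\<^sup>2) summable_on UNIV"
  unfolding l2_def
  by (auto intro: summable_on_cong_neutral[THEN iffD1, rotated 3, of _ I])

lemma coords_l2 [simp]: "\<zeta> \<in> l2 I \<Longrightarrow> coords (Ell2 \<zeta>) = \<zeta>"
  by (intro coords_Ell2 l2_summable)

lemma supp_in_l2: "\<zeta> \<in> l2 I \<Longrightarrow> supp_in I (Ell2 \<zeta>)"
  by (simp add: supp_in_def) (simp add: l2_def)

lemma coords_in_l2: "coords x \<in> l2 I \<longleftrightarrow> supp_in I x"
  by (simp add: l2_def supp_in_def coords_sq_summable)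

lemma Ell2_coords [simp]: "Ell2 (coords x) = x"
  by (rule coords_inverse)

lemma l2_inner_coords: "supp_in I x \<Longrightarrow> l2_inner I (coords x) (coords y) = cinner x y"
  unfolding l2_inner_def cinner_def by (rule infsum_cong_neutral) (auto simp: supp_in_def)

lemma l2_norm_coords: "supp_in I x \<Longrightarrow> l2_norm I (coords x) = norm x"
proof -
  assume "supp_in I x"
  then have "(\<Sum>\<^sub>\<infinity>i\<in>I. (norm (coords x i))\<^sup>2) = (norm x)\<^sup>2"
    unfolding norm_ell2_sq by (intro infsum_cong_neutral) (auto simp: supp_in_def)
  then show ?thesis by (simp add: l2_norm_def)
qed

lemma l2_closed:
  assumes "\<zeta> \<in> l2 I" "\<omega> \<in> l2 I"
  shows "\<zeta> + \<omega> \<in> l2 I" "(\<lambda>i. c * \<zeta> i) \<in> l2 I"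
    "Ell2 (\<zeta> + \<omega>) = Ell2 \<zeta> + Ell2 \<omega>" "Ell2 (\<lambda>i. c * \<zeta> i) = ksc c (Ell2 \<zeta>)"
proof -
  show 1: "\<zeta> + \<omega> \<in> l2 I" "(\<lambda>i. c * \<zeta> i) \<in> l2 I"
    using assms by (auto simp: l2_def sq_summable_add sq_summable_cmult)
  show "Ell2 (\<zeta> + \<omega>) = Ell2 \<zeta> + Ell2 \<omega>"
    by (rule ell2_eqI) (simp add: coords_l2[OF 1(1)] coords_l2[OF assms(1)] coords_l2[OF assms(2)])
  show "Ell2 (\<lambda>i. c * \<zeta> i) = ksc c (Ell2 \<zeta>)"
    by (rule ell2_eqI) (simp add: coords_l2[OF 1(2)] coords_l2[OF assms(1)])
qed

text \<open>
  Operators on \<open>l2 I\<close> are extensional functions; \<open>A\<close> is the bounded operator on all square summable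
  families that agrees with \<open>y\<close> on \<open>l2 I\<close> and vanishes on the coordinates outside \<open>I\<close>.
\<close>

definition reps :: "'i set \<Rightarrow> (('i, 'k::rclike) ell2 \<Rightarrow>\<^sub>L ('i, 'k) ell2) \<Rightarrow> (('i \<Rightarrow> 'k) \<Rightarrow> 'i \<Rightarrow> 'k) \<Rightarrow> bool"
  where "reps I A y \<longleftrightarrow> y \<in> extensional (l2 I) \<and> (\<forall>\<zeta>\<in>l2 I. y \<zeta> = coords (A (Ell2 \<zeta>))) \<and>
    (\<forall>x. supp_in I (A x)) \<and> (\<forall>x. (\<forall>i\<in>I. coords x i = 0) \<longrightarrow> A x = 0) \<and>
    (\<forall>c x. A (ksc c x) = ksc c (A x))"

lemma reps_coords: "reps I A y \<Longrightarrow> supp_in I x \<Longrightarrow> y (coords x) = coords (A x)"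
  using coords_in_l2[of x I] by (simp add: reps_def)

definition trunc :: "'i set \<Rightarrow> ('i, 'k::rclike) ell2 \<Rightarrow> ('i, 'k) ell2"
  where "trunc I x = Ell2 (\<lambda>i. if i \<in> I then coords x i else 0)"

lemma coords_trunc [simp]: "coords (trunc I x) i = (if i \<in> I then coords x i else 0)"
proof -
  have "(\<lambda>i. (norm (if i \<in> I then coords x i else 0))\<^sup>2) summable_on UNIV"
    by (rule sq_summable_of_bounded[where c = "(norm x)\<^sup>2"])
      (auto intro!: order_trans[OF sum_mono sum_coords_le[of _ x]])
  then have "coords (trunc I x) = (\<lambda>i. if i \<in> I then coords x i else 0)"
    unfolding trunc_def by (rule coords_Ell2)
  then show ?thesis by simp
qed

lemma supp_in_trunc: "supp_in I (trunc I x)" by (simp add: supp_in_def)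

lemma reps_trunc: "reps I A y \<Longrightarrow> A (trunc I x) = A x"
proof -
  assume A: "reps I A y"
  have "A (x - trunc I x) = 0" using A by (simp add: reps_def)
  then show ?thesis by (simp add: blinfun.diff_right)
qed

lemma reps_unique:
  assumes "reps I A y" "reps I B y"
  shows "A = B"
proof (rule blinfun_eqI)
  fix x
  have "coords (A (trunc I x)) = coords (B (trunc I x))"
    by (simp only: reps_coords[OF assms(1) supp_in_trunc, symmetric]
        reps_coords[OF assms(2) supp_in_trunc, symmetric])
  then show "A x = B x"
    by (simp add: reps_trunc[OF assms(1)] reps_trunc[OF assms(2)] coords_inject)
qed

lemma reps_unique_right: "reps I A y \<Longrightarrow> reps I A z \<Longrightarrow> y = z"
  unfolding reps_def by (intro extensionalityI[of _ "l2 I"]) auto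

lemma reps_exists:
  fixes y :: "('i \<Rightarrow> 'k::rclike) \<Rightarrow> 'i \<Rightarrow> 'k"
  assumes y: "y \<in> l2_ops I"
  obtains A where "reps I A y"
proof -
  have yl2: "y \<zeta> \<in> l2 I" if "\<zeta> \<in> l2 I" for \<zeta> using y that by (auto simp: l2_ops_def)
  have add: "y (\<zeta> + \<omega>) = y \<zeta> + y \<omega>" if "\<zeta> \<in> l2 I" "\<omega> \<in> l2 I" for \<zeta> \<omega>
    using y that by (simp add: l2_ops_def)
  have mul: "y (\<lambda>i. c * \<zeta> i) = (\<lambda>i. c * y \<zeta> i)" if "\<zeta> \<in> l2 I" for c \<zeta>
    using y that by (simp add: l2_ops_def)
  have "\<exists>K. \<forall>\<zeta>\<in>l2 I. l2_norm I (y \<zeta>) \<le> K * l2_norm I \<zeta>"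
    using y by (simp add: l2_ops_def)
  then obtain K where K: "\<And>\<zeta>. \<zeta> \<in> l2 I \<Longrightarrow> l2_norm I (y \<zeta>) \<le> K * l2_norm I \<zeta>"
    by blast
  define f where "f x = Ell2 (y (coords (trunc I x)))" for x
  have cl2: "coords (trunc I x) \<in> l2 I" for x by (simp add: coords_in_l2 supp_in_trunc)
  have cf: "coords (f x) = y (coords (trunc I x))" for x
    unfolding f_def by (rule coords_l2[OF yl2[OF cl2]])
  have c_add: "coords (trunc I (x + z)) = coords (trunc I x) + coords (trunc I z)" for x z :: "('i, 'k) ell2"
    by (auto simp: fun_eq_iff)
  have c_mul: "coords (trunc I (ksc c x)) = (\<lambda>i. c * coords (trunc I x) i)" for c and x :: "('i, 'k) ell2"
    by (auto simp: fun_eq_iff)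
  have f_mul: "f (ksc c x) = ksc c (f x)" for c x
    by (rule ell2_eqI) (simp only: cf c_mul mul[OF cl2] coords_ksc)
  have "bounded_linear f"
  proof (rule bounded_linear_intro)
    show "f (x + z) = f x + f z" for x z
      by (rule ell2_eqI) (simp only: cf c_add add[OF cl2 cl2] plus_fun_apply coords_add)
    show "f (r *\<^sub>R x) = r *\<^sub>R f x" for r x by (simp only: ksc_of_real[symmetric] f_mul)
    show "norm (f x) \<le> norm x * \<bar>K\<bar>" for x
    proof -
      have "supp_in I (f x)" using yl2[OF cl2] by (simp add: coords_in_l2[symmetric] cf)
      then have "norm (f x) = l2_norm I (y (coords (trunc I x)))"
        by (simp add: l2_norm_coords[symmetric] cf)
      also have "\<dots> \<le> K * norm (trunc I x)"
        using K[OF cl2] by (simp add: l2_norm_coords supp_in_trunc)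
      also have "\<dots> \<le> \<bar>K\<bar> * norm x"
      proof (intro mult_mono)
        show "norm (trunc I x) \<le> norm x"
          by (rule norm_ell2_le) (auto intro!: order_trans[OF sum_mono sum_coords_le[of _ x]])
      qed auto
      finally show ?thesis by (simp add: mult.commute)
    qed
  qed
  then have f: "blinfun_apply (Blinfun f) = f" by (rule bounded_linear_Blinfun_apply)
  have trunc_id: "coords (trunc I (Ell2 \<zeta>)) = \<zeta>" if "\<zeta> \<in> l2 I" for \<zeta> :: "'i \<Rightarrow> 'k"
    using that by (auto simp: fun_eq_iff) (auto simp: l2_def)
  have "reps I (Blinfun f) y"
    unfolding reps_def f
  proof (intro conjI allI ballI impI)
    show "y \<in> extensional (l2 I)" using y by (simp add: l2_ops_def PiE_def)
    show "y \<zeta> = coords (f (Ell2 \<zeta>))" if "\<zeta> \<in> l2 I" for \<zeta> using that by (simp add: cf trunc_id)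
    show "supp_in I (f x)" for x using yl2[OF cl2] by (simp add: coords_in_l2[symmetric] cf)
    show "f x = 0" if "\<forall>i\<in>I. coords x i = 0" for x
    proof -
      have "coords (trunc I x) = coords (trunc I (ksc 0 x))" using that by (auto simp: fun_eq_iff)
      then have "f x = f (ksc 0 x)" by (simp add: f_def)
      also have "\<dots> = ksc 0 (f x)" by (rule f_mul)
      finally show ?thesis by (simp only: ksc.zero_left)
    qed
    show "f (ksc c x) = ksc c (f x)" for c x by (rule f_mul)
  qed
  then show ?thesis by (rule that)
qed

lemma reps_in_ops:
  fixes y :: "('i \<Rightarrow> 'k::rclike) \<Rightarrow> 'i \<Rightarrow> 'k"
  assumes A: "reps I A y"
  shows "y \<in> l2_ops I"
  unfolding l2_ops_def
proof (intro CollectI conjI PiE_I ballI allI)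
  have eq: "y \<zeta> = coords (A (Ell2 \<zeta>))" if "\<zeta> \<in> l2 I" for \<zeta> :: "'i \<Rightarrow> 'k" using A that by (simp add: reps_def)
  have sA: "supp_in I (A x)" for x using A by (simp add: reps_def)
  fix \<zeta> :: "'i \<Rightarrow> 'k" assume \<zeta>: "\<zeta> \<in> l2 I"
  show "y \<zeta> \<in> l2 I" using sA by (simp add: eq \<zeta> coords_in_l2)
  show "y (\<zeta> + \<omega>) = y \<zeta> + y \<omega>" if "\<omega> \<in> l2 I" for \<omega> :: "'i \<Rightarrow> 'k"
    using l2_closed[OF \<zeta> that] by (simp add: eq \<zeta> that blinfun.add_right fun_eq_iff)
  show "y (\<lambda>i. c * \<zeta> i) = (\<lambda>i. c * y \<zeta> i)" for c
    using l2_closed(2,4)[OF \<zeta> \<zeta>, of c] A by (simp add: eq \<zeta> reps_def fun_eq_iff)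
next
  show "\<exists>B. \<forall>\<zeta>\<in>l2 I. l2_norm I (y \<zeta>) \<le> B * l2_norm I \<zeta>"
  proof (intro exI ballI)
    fix \<zeta> :: "'i \<Rightarrow> 'k" assume \<zeta>: "\<zeta> \<in> l2 I"
    have "l2_norm I (y \<zeta>) = norm (A (Ell2 \<zeta>))"
      using A \<zeta> by (simp add: reps_def l2_norm_coords)
    moreover have "l2_norm I \<zeta> = norm (Ell2 \<zeta>)"
      using l2_norm_coords[OF supp_in_l2[OF \<zeta>]] \<zeta> by simp
    ultimately show "l2_norm I (y \<zeta>) \<le> norm A * l2_norm I \<zeta>"
      using norm_blinfun[of A "Ell2 \<zeta>"] by simp
  qed
qed (use A in \<open>auto simp: reps_def extensional_def\<close>)

text \<open>The adjoint of an operator living on I again lives on I, by duality. Since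
  \<open>l2_adjoint\<close> is a definite description, a competitor is represented by some B' as
  well; testing against truncated vectors gives B' = B.\<close>

lemma reps_adjoint:
  assumes A: "reps I A y" and B: "cadj A B"
  shows "reps I B (l2_adjoint I y)"
proof -
  have sB: "supp_in I (B x)" for x
    unfolding supp_in_def
  proof (intro allI impI)
    fix i assume "i \<notin> I"
    then have "\<forall>j\<in>I. coords (ket i :: ('a, 'b) ell2) j = 0" by (auto simp: coords_ket)
    then have "A (ket i) = 0" using A by (simp add: reps_def)
    then have "cinner (ket i) (B x) = 0" by (simp add: cadjD[OF B, symmetric] cinner.zero_left)
    then show "coords (B x) i = 0" using cinner_commute[of "B x" "ket i"] by (simp add: cinner_ket)
  qed
  have kB: "B x = 0" if "\<forall>i\<in>I. coords x i = 0" for x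
  proof (rule cinner_eqI)
    fix z
    have "cinner (A z) x = 0"
    proof -
      have "coords (A z) i * kconj (coords x i) = 0" for i
        using A that by (cases "i \<in> I") (auto simp: reps_def supp_in_def)
      then show ?thesis unfolding cinner_def by (simp only: infsum_0)
    qed
    then show "cinner (B x) z = cinner 0 z"
      using cadjD[OF cadj_commute[OF B], of x z] cinner_commute[of x "A z"] by (simp add: cinner.zero_left)
  qed
  define z where "z = (\<lambda>\<zeta>\<in>l2 I. coords (B (Ell2 \<zeta>)))"
  have z: "reps I B z"
    unfolding reps_def z_def using sB kB cadj_ksc[OF cadj_commute[OF B]] by auto
  have inner_eq: "l2_inner I (y \<zeta>) \<omega> = l2_inner I \<zeta> (z \<omega>)" if "\<zeta> \<in> l2 I" "\<omega> \<in> l2 I" for \<zeta> \<omega>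
  proof -
    have "l2_inner I (coords (A (Ell2 \<zeta>))) (coords (Ell2 \<omega>)) = cinner (A (Ell2 \<zeta>)) (Ell2 \<omega>)"
      using A by (intro l2_inner_coords) (simp add: reps_def)
    moreover have "l2_inner I (coords (Ell2 \<zeta>)) (coords (B (Ell2 \<omega>))) = cinner (Ell2 \<zeta>) (B (Ell2 \<omega>))"
      by (rule l2_inner_coords[OF supp_in_l2[OF that(1)]])
    ultimately show ?thesis
      using A that by (simp add: reps_def z_def cadjD[OF B])
  qed
  have "l2_adjoint I y = z"
    unfolding l2_adjoint_def
  proof (rule the_equality)
    show "z \<in> l2_ops I \<and> (\<forall>\<zeta>\<in>l2 I. \<forall>\<omega>\<in>l2 I. l2_inner I (y \<zeta>) \<omega> = l2_inner I \<zeta> (z \<omega>))"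
      using reps_in_ops[OF z] inner_eq by simp
    fix z' assume z': "z' \<in> l2_ops I \<and> (\<forall>\<zeta>\<in>l2 I. \<forall>\<omega>\<in>l2 I. l2_inner I (y \<zeta>) \<omega> = l2_inner I \<zeta> (z' \<omega>))"
    then obtain B' where B': "reps I B' z'" using reps_exists by blast
    have "B' x = B x" for x
    proof (rule cinner_eqI)
      fix w
      have "l2_inner I (coords (trunc I w)) (z' (coords (trunc I x))) = l2_inner I (coords (trunc I w)) (z (coords (trunc I x)))"
        using z' inner_eq by (metis coords_in_l2 supp_in_trunc)
      then have "cinner (trunc I w) (B' x) = cinner (trunc I w) (B x)"
        by (simp add: reps_coords[OF B'] reps_coords[OF z] supp_in_trunc l2_inner_coords
            reps_trunc[OF B'] reps_trunc[OF z])
      moreover have "cinner (trunc I w) v = cinner w v" if "supp_in I v" for v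
        using that unfolding cinner_def supp_in_def by (intro infsum_cong) auto
      ultimately have "cinner w (B' x) = cinner w (B x)" using B' z by (simp add: reps_def)
      then show "cinner (B' x) w = cinner (B x) w" by (metis cinner_commute)
    qed
    then have "B' = B" by (rule blinfun_eqI)
    with B' z show "z' = z" using reps_unique_right by blast
  qed
  with z show ?thesis by simp
qed

lemma reps_compose:
  assumes "reps I A y" "reps I B z"
  shows "reps I (A o\<^sub>L B) (compose (l2 I) y z)"
proof -
  have "compose (l2 I) y z \<zeta> = coords (A (B (Ell2 \<zeta>)))" if "\<zeta> \<in> l2 I" for \<zeta>
    using assms that by (simp add: compose_def reps_coords[OF assms(1)] reps_def[of I B])
  then show ?thesis using assms
    unfolding reps_def by (auto simp: blinfun.zero_right compose_def)
qed

lemma reps_positive: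
  assumes A: "reps I A y"
  shows "l2_positive I y \<longleftrightarrow> cpos A"
proof -
  have inner_eq: "l2_inner I (y \<zeta>) \<zeta> = cinner (A (Ell2 \<zeta>)) (Ell2 \<zeta>)" if "\<zeta> \<in> l2 I" for \<zeta>
    using l2_inner_coords[of I "A (Ell2 \<zeta>)" "Ell2 \<zeta>"] A that by (simp add: reps_def)
  show ?thesis
  proof
    assume y: "l2_positive I y"
    obtain B where B: "cadj A B" using adjoint_exists[of A] A by (auto simp: reps_def)
    have "reps I B y" using reps_adjoint[OF A B] y by (simp add: l2_positive_def)
    then have "B = A" using A reps_unique by blast
    have "0 \<le> A x \<bullet> x" for x
    proof -
      have "supp_in I (A x)" using A by (simp add: reps_def)
      then have "cinner (A x) (trunc I x) = cinner (A x) x"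
        unfolding cinner_def supp_in_def by (intro infsum_cong) auto
      moreover have "coords (trunc I x) \<in> l2 I" by (simp add: coords_in_l2 supp_in_trunc)
      then have "cinner (A (trunc I x)) (trunc I x) \<in> \<real>\<^sub>\<ge>\<^sub>0"
        using y inner_eq[of "coords (trunc I x)"] unfolding l2_positive_def by (metis Ell2_coords)
      ultimately obtain r where "cinner (A x) x = of_real r" "r \<ge> 0"
        by (auto simp: reps_trunc[OF A] nonneg_Reals_def)
      then show ?thesis using cinner_one[of "A x" x] by simp
    qed
    with B \<open>B = A\<close> show "cpos A" by (simp add: cpos_def)
  next
    assume pos: "cpos A"
    then have sym: "cadj A A" by (simp add: cpos_def)
    have "l2_adjoint I y = y" using reps_adjoint[OF A sym] A reps_unique_right by blast
    moreover have "cinner (A x) x \<in> \<real>\<^sub>\<ge>\<^sub>0" for x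
    proof -
      \<comment> \<open>Symmetry makes this scalar its own conjugate, hence equal to its real
        part.\<close>
      have "kconj (cinner (A x) x) = cinner (A x) x"
        by (metis cadjD[OF sym] cinner_commute)
      then have "of_real (A x \<bullet> x) = cinner (A x) x"
        unfolding cinner_one[symmetric] of_real_inner_rclike by simp
      then show ?thesis using pos by (metis cpos_def nonneg_Reals_of_real_iff)
    qed
    ultimately show "l2_positive I y"
      using reps_in_ops[OF A] inner_eq by (simp add: l2_positive_def)
  qed
qed

section \<open>Singular values\<close>

lemma svd_atD:
  assumes "svd_at v s x y"
  shows "decseq s" "0 \<le> s n" "oz x" "oz y" "x n \<noteq> 0 \<longleftrightarrow> s n \<noteq> 0" "y n \<noteq> 0 \<longleftrightarrow> s n \<noteq> 0"
    "v (y n) = s n *\<^sub>R x n"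
    "finite F \<Longrightarrow> {..<n} \<subseteq> F \<Longrightarrow>
      norm (v z - (\<Sum>k\<in>F. s k *\<^sub>R ksc (cinner z (y k)) (x k))) \<le> s n * norm z"
  using assms by (simp_all add: svd_at_def)

lemma svd_at_adj:
  assumes "svd_at v s x y" "cadj v v'"
  shows "v' (x n) = s n *\<^sub>R y n"
proof -
  obtain u where u: "cadj v u" "\<forall>n. u (x n) = s n *\<^sub>R y n"
    using assms(1) unfolding svd_at_def by (elim conjE exE) (rule that)
  have "u = v'" by (rule cadj_unique[OF u(1) assms(2)])
  with u(2) show ?thesis by simp
qed

text \<open>A positive square root Z of the product v' v is forced by the decomposition: it has
  eigenvalue s n at y n by \<open>eigen_of_square\<close>, and off the first n vectors it has the
  same norm as v, hence at most s n.\<close>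

lemma abs_unique:
  assumes svd: "svd_at v s x y" and s0: "s \<longlonglongrightarrow> 0" and adj: "cadj v v'"
    and Z: "cpos Z" "Z o\<^sub>L Z = v' o\<^sub>L v"
  shows "Z (y n) = s n *\<^sub>R y n"
    and "norm (Z z - (\<Sum>k<n. s k *\<^sub>R ksc (cinner z (y k)) (y k))) \<le> s n * norm z"
proof -
  have ZZ: "Z (Z z) = v' (v z)" for z
    using arg_cong[OF Z(2), of "\<lambda>A. blinfun_apply A z"] by simp
  show Zy: "Z (y n) = s n *\<^sub>R y n" for n
  proof (cases "s n = 0")
    case True
    then show ?thesis using svd_atD(6)[OF svd, of n] by (simp add: blinfun.zero_right)
  next
    case False
    then have "0 < s n" using svd_atD(2)[OF svd, of n] by simp
    moreover have "Z (Z (y n)) = (s n)\<^sup>2 *\<^sub>R y n"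
      by (simp add: ZZ svd_atD(7)[OF svd] blinfun.scaleR_right svd_at_adj[OF svd adj] power2_eq_square)
    ultimately show ?thesis using Z(1) by (intro eigen_of_square) (auto simp: cpos_def)
  qed
  have sym: "cadj Z Z" using Z(1) by (simp add: cpos_def)
  show "norm (Z z - (\<Sum>k<n. s k *\<^sub>R ksc (cinner z (y k)) (y k))) \<le> s n * norm z"
  proof -
    let ?p = "proj_off y {..<n} z"
    have "Z ?p = Z z - (\<Sum>k<n. ksc (cinner z (y k)) (Z (y k)))"
      by (simp add: proj_off_def blinfun.diff_right blinfun.sum_right cadj_ksc[OF sym])
    then have 1: "Z ?p = Z z - (\<Sum>k<n. s k *\<^sub>R ksc (cinner z (y k)) (y k))"
      by (simp add: Zy ksc.scaleR_right)
    have "v ?p = v z - (\<Sum>k<n. ksc (cinner z (y k)) (v (y k)))"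
      by (simp add: proj_off_def blinfun.diff_right blinfun.sum_right cadj_ksc[OF adj])
    then have 2: "v ?p = v z - (\<Sum>k<n. s k *\<^sub>R ksc (cinner z (y k)) (x k))"
      by (simp add: svd_atD(7)[OF svd] ksc.scaleR_right)
    have "(norm (Z ?p))\<^sup>2 = Z (Z ?p) \<bullet> ?p"
      by (simp add: cadj_inner[OF sym] power2_norm_eq_inner)
    also have "\<dots> = (norm (v ?p))\<^sup>2"
      by (simp add: ZZ cadj_inner[OF cadj_commute[OF adj]] power2_norm_eq_inner)
    finally have "norm (Z ?p) = norm (v ?p)" by simp
    moreover have "norm (v ?p) \<le> s n * norm z"
      unfolding 2 by (rule svd_atD(8)[OF svd]) auto
    ultimately show ?thesis by (simp add: 1)
  qed
qed

text \<open>The partial sums converge in norm, since by Bessel's inequality the tail from m on has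
  norm at most s m. Squaring is checked along the partial sums: Y and v' send the corresponding
  truncations of Y z and v z to the same vector.\<close>

lemma abs_exists:
  assumes svd: "svd_at v s x y" and s0: "s \<longlonglongrightarrow> 0" and adj: "cadj v v'"
  obtains Y where "cpos Y" "Y o\<^sub>L Y = v' o\<^sub>L v" "\<And>z. (\<lambda>n. \<Sum>k<n. s k *\<^sub>R ksc (cinner z (y k)) (y k)) \<longlonglongrightarrow> Y z"
proof -
  define P where "P n = (\<Sum>k<n. s k *\<^sub>R rk (y k) (y k))" for n
  have Pz: "P n z = (\<Sum>k<n. s k *\<^sub>R ksc (cinner z (y k)) (y k))" for n z
    by (simp add: P_def blinfun.sum_left blinfun.scaleR_left)
  have s: "0 \<le> s n" for n by (rule svd_atD(2)[OF svd])
  have diff_le: "norm (P n - P m) \<le> s m" if "m \<le> n" for m n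
  proof (rule norm_blinfun_bound)
    fix z
    have "(P n - P m) z = (\<Sum>k\<in>{m..<n}. s k *\<^sub>R ksc (cinner z (y k)) (y k))"
      using that sum_diff[of "{..<n}" "{..<m}" "\<lambda>k. s k *\<^sub>R ksc (cinner z (y k)) (y k)"]
      by (simp add: blinfun.diff_left Pz ivl_diff lessThan_atLeast0)
    also have "\<dots> = (\<Sum>k\<in>{m..<n}. ksc (of_real (s k) * cinner z (y k)) (y k))"
      by (simp add: ksc_of_real[symmetric])
    finally have "(norm ((P n - P m) z))\<^sup>2 \<le> (\<Sum>k\<in>{m..<n}. (norm (of_real (s k) * cinner z (y k)))\<^sup>2)"
      by (simp only:) (rule norm_oz_sum[OF svd_atD(4)[OF svd]], simp)
    also have "\<dots> \<le> (\<Sum>k\<in>{m..<n}. (s m)\<^sup>2 * (norm (cinner z (y k)))\<^sup>2)"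
    proof (rule sum_mono)
      fix k assume "k \<in> {m..<n}"
      then have "s k \<le> s m" using svd_atD(1)[OF svd] by (simp add: decseqD)
      then have "(s k)\<^sup>2 \<le> (s m)\<^sup>2" using s by (rule power_mono)
      then show "(norm (of_real (s k) * cinner z (y k)))\<^sup>2 \<le> (s m)\<^sup>2 * (norm (cinner z (y k)))\<^sup>2"
        by (simp add: norm_mult power_mult_distrib mult_right_mono)
    qed
    also have "\<dots> \<le> (s m)\<^sup>2 * (norm z)\<^sup>2"
      unfolding sum_distrib_left[symmetric]
      by (intro mult_left_mono bessel[OF svd_atD(4)[OF svd]]) auto
    also have "\<dots> = (s m * norm z)\<^sup>2" by (simp add: power_mult_distrib)
    finally show "norm ((P n - P m) z) \<le> s m * norm z"
      by (rule power2_le_imp_le) (simp add: s)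
  qed (rule s)
  have "convergent P"
  proof (rule Cauchy_convergent, rule CauchyI')
    fix d :: real assume "d > 0"
    then have "\<forall>\<^sub>F n in sequentially. s n < d" by (rule order_tendstoD(2)[OF s0])
    then obtain M where M: "\<And>n. n \<ge> M \<Longrightarrow> s n < d" by (auto simp: eventually_sequentially)
    have "dist (P m) (P n) < d" if "m \<ge> M" "n > m" for m n
      using diff_le[of m n] M[OF that(1)] that(2) by (simp add: dist_norm norm_minus_commute)
    then show "\<exists>M. \<forall>m\<ge>M. \<forall>n>m. dist (P m) (P n) < d" by blast
  qed
  then obtain Y where Y: "P \<longlonglongrightarrow> Y" by (auto simp: convergent_def)
  have Yz: "(\<lambda>n. P n z) \<longlonglongrightarrow> Y z" for z by (intro tendsto_intros Y)
  have cP: "cadj (P n) (P n)" for n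
    unfolding P_def
  proof (rule cadj_sum)
    fix k
    show "cadj (s k *\<^sub>R rk (y k) (y k)) (s k *\<^sub>R rk (y k) (y k))"
      unfolding cadj_def
      by (simp only: blinfun.scaleR_left cinner.scaleR_left cinner.scaleR_right cadjD[OF cadj_rk]) simp
  qed
  have "cadj Y Y" by (rule cadj_lim[OF Y Y cP])
  moreover have "0 \<le> Y z \<bullet> z" for z
  proof (rule LIMSEQ_le_const)
    show "(\<lambda>n. P n z \<bullet> z) \<longlonglongrightarrow> Y z \<bullet> z" by (intro tendsto_intros Yz)
    have "0 \<le> P n z \<bullet> z" for n
    proof -
      have "ksc (cinner z (y k)) (y k) \<bullet> z = (norm (cinner z (y k)))\<^sup>2" for k
        using mult_kconj_of_real[of "cinner z (y k)"] cinner_commute[of "y k" z]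
        by (simp add: cinner_one[symmetric] del: of_real_power)
      then show ?thesis by (simp add: Pz inner_sum_left sum_nonneg s)
    qed
    then show "\<exists>N. \<forall>n\<ge>N. 0 \<le> P n z \<bullet> z" by blast
  qed
  ultimately have pos: "cpos Y" by (simp add: cpos_def)
  have Yy: "Y (y n) = s n *\<^sub>R y n" for n
  proof -
    have "P m (y n) = s n *\<^sub>R y n" if "m > n" for m
    proof -
      have "P m (y n) = (\<Sum>k<m. if k = n then s n *\<^sub>R y n else 0)"
        unfolding Pz
        by (intro sum.cong refl) (auto simp: ozD[OF svd_atD(4)[OF svd]] ksc.zero_left ksc.zero_right)
      then show ?thesis using that by simp
    qed
    then have "(\<lambda>m. P m (y n)) \<longlonglongrightarrow> s n *\<^sub>R y n"
      by (intro tendsto_eventually) (auto simp: eventually_sequentially intro: exI[of _ "Suc n"])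
    with Yz show ?thesis by (rule LIMSEQ_unique)
  qed
  have "Y o\<^sub>L Y = v' o\<^sub>L v"
  proof (rule blinfun_eqI)
    fix z
    have "(\<lambda>n. Y (P n z)) \<longlonglongrightarrow> Y (Y z)" by (intro tendsto_intros Yz)
    moreover have "(\<lambda>n. v' (\<Sum>k<n. s k *\<^sub>R ksc (cinner z (y k)) (x k))) \<longlonglongrightarrow> v' (v z)"
    proof (intro tendsto_intros)
      have "(\<lambda>n. s n * norm z) \<longlonglongrightarrow> 0" using tendsto_mult_left_zero[OF s0] .
      moreover have "\<forall>\<^sub>F n in sequentially.
          norm ((\<Sum>k<n. s k *\<^sub>R ksc (cinner z (y k)) (x k)) - v z) \<le> s n * norm z"
        using svd_atD(8)[OF svd, of "{..<_}"] by (simp add: norm_minus_commute)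
      ultimately have "(\<lambda>n. (\<Sum>k<n. s k *\<^sub>R ksc (cinner z (y k)) (x k)) - v z) \<longlonglongrightarrow> 0"
        by (rule Lim_null_comparison[rotated])
      then show "(\<lambda>n. \<Sum>k<n. s k *\<^sub>R ksc (cinner z (y k)) (x k)) \<longlonglongrightarrow> v z"
        by (simp add: LIM_zero_iff)
    qed
    moreover have "Y (P n z) = v' (\<Sum>k<n. s k *\<^sub>R ksc (cinner z (y k)) (x k))" for n
      by (simp add: Pz blinfun.sum_right blinfun.scaleR_right cadj_ksc[OF \<open>cadj Y Y\<close>]
          cadj_ksc[OF cadj_commute[OF adj]] Yy svd_at_adj[OF svd adj])
    ultimately have "Y (Y z) = v' (v z)" by (simp add: LIMSEQ_unique)
    then show "(Y o\<^sub>L Y) z = (v' o\<^sub>L v) z" by simp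
  qed
  with pos show ?thesis by (rule that) (use Yz in \<open>simp add: Pz\<close>)
qed

text \<open>Identifies the description \<open>l2_abs\<close>: \<open>abs_exists\<close> provides a
  candidate, and by \<open>abs_unique\<close> every competitor is the limit of the same partial
  sums.\<close>

lemma l2_abs_reps:
  assumes svd: "svd_at v s x y" and s0: "s \<longlonglongrightarrow> 0" and rep: "reps I v X"
  obtains Y where "reps I Y (l2_abs I X)"
    "\<And>z. (\<lambda>n. \<Sum>k<n. s k *\<^sub>R ksc (cinner z (y k)) (y k)) \<longlonglongrightarrow> Y z" "\<And>n. Y (y n) = s n *\<^sub>R y n"
    "cpos Y"
proof -
  obtain v' where adj: "cadj v v'" using adjoint_exists[of v] rep by (auto simp: reps_def)
  obtain Y where Y: "cpos Y" "Y o\<^sub>L Y = v' o\<^sub>L v"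
    and lim: "\<And>z. (\<lambda>n. \<Sum>k<n. s k *\<^sub>R ksc (cinner z (y k)) (y k)) \<longlonglongrightarrow> Y z"
    by (rule abs_exists[OF svd s0 adj]) (rule that)
  have rep': "reps I v' (l2_adjoint I X)" by (rule reps_adjoint[OF rep adj])
  have repc: "reps I (v' o\<^sub>L v) (compose (l2 I) (l2_adjoint I X) X)"
    by (rule reps_compose[OF rep' rep])
  have sym: "cadj Y Y" using Y(1) by (simp add: cpos_def)
  have nY: "norm (Y z) = norm (v z)" for z
  proof -
    have "Y (Y z) = v' (v z)" using arg_cong[OF Y(2), of "\<lambda>A. blinfun_apply A z"] by simp
    then have "Y z \<bullet> Y z = v z \<bullet> v z"
      by (simp add: cadj_inner[OF sym, symmetric] cadj_inner[OF cadj_commute[OF adj]])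
    then show ?thesis by (simp add: norm_eq_sqrt_inner)
  qed
  \<comment> \<open>Y inherits the kernel from v because |Y z| = |v z|; symmetry then confines its
    range to the coordinates in I.\<close>
  have kerY: "Y z = 0" if "\<forall>i\<in>I. coords z i = 0" for z
    using nY[of z] rep that by (simp add: reps_def)
  have suppY: "supp_in I (Y z)" for z
    unfolding supp_in_def
  proof (intro allI impI)
    fix i assume "i \<notin> I"
    then have "\<forall>j\<in>I. coords (ket i :: ('a, 'b) ell2) j = 0" by (auto simp: coords_ket)
    then have "Y (ket i) = 0" by (rule kerY)
    then have "cinner (Y z) (ket i) = 0" by (simp add: cadjD[OF sym] cinner.zero_right)
    then show "coords (Y z) i = 0" by (simp add: cinner_ket)
  qed
  define Yl where "Yl = (\<lambda>\<zeta>\<in>l2 I. coords (Y (Ell2 \<zeta>)))"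
  have repY: "reps I Y Yl"
    unfolding reps_def Yl_def using suppY kerY cadj_ksc[OF sym] by auto
  have comp: "compose (l2 I) Yl Yl = compose (l2 I) (l2_adjoint I X) X"
    using reps_compose[OF repY repY] repc unfolding Y(2) by (rule reps_unique_right)
  have "l2_abs I X = Yl"
    unfolding l2_abs_def
  proof (rule the_equality)
    show "l2_positive I Yl \<and> compose (l2 I) Yl Yl = compose (l2 I) (l2_adjoint I X) X"
      using reps_positive[OF repY] Y(1) comp by simp
    fix z assume z: "l2_positive I z \<and> compose (l2 I) z z = compose (l2 I) (l2_adjoint I X) X"
    then obtain Z where Z: "reps I Z z"
      using reps_exists[of z I] by (auto simp: l2_positive_def)
    have posZ: "cpos Z" using z reps_positive[OF Z] by simp
    have ZZ: "Z o\<^sub>L Z = v' o\<^sub>L v"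
      using reps_compose[OF Z Z] repc z by (auto intro: reps_unique)
    have "Z w = Y w" for w
    proof -
      have sw: "(\<lambda>n. s n * norm w) \<longlonglongrightarrow> 0" using tendsto_mult_left_zero[OF s0] .
      have "(\<lambda>n. Z w - (\<Sum>k<n. s k *\<^sub>R ksc (cinner w (y k)) (y k))) \<longlonglongrightarrow> 0"
        by (rule Lim_null_comparison[OF always_eventually sw])
          (use abs_unique(2)[OF svd s0 adj posZ ZZ] in auto)
      then have "(\<lambda>n. Z w - (Z w - (\<Sum>k<n. s k *\<^sub>R ksc (cinner w (y k)) (y k)))) \<longlonglongrightarrow> Z w - 0"
        by (intro tendsto_intros)
      then have "(\<lambda>n. \<Sum>k<n. s k *\<^sub>R ksc (cinner w (y k)) (y k)) \<longlonglongrightarrow> Z w" by simp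
      then show ?thesis using lim by (rule LIMSEQ_unique)
    qed
    then have "Z = Y" by (rule blinfun_eqI)
    with Z repY show "z = Yl" using reps_unique_right by blast
  qed
  then have "reps I Y (l2_abs I X)" using repY by simp
  then show ?thesis
    using lim abs_unique(1)[OF svd s0 adj Y] Y(1) by (rule that)
qed

lemma sum_fun_apply: "(\<Sum>k\<in>A. f k) i = (\<Sum>k\<in>A. f k i)"
  by (induction A rule: infinite_finite_induct) auto

text \<open>An eigenvector of the absolute value for r > 0 is orthogonal to every y k with s k
  different from r, so its series reduces to the finitely many terms with s k = r. These y k are
  thus a basis of the eigenspace; the dimension is taken among plain functions, which is why
  everything passes through \<open>coords\<close>.\<close>

lemma eigen_mult_svd:
  fixes v :: "('i, 'k::rclike) ell2 \<Rightarrow>\<^sub>L ('i, 'k) ell2"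
  assumes svd: "svd_at v s x y" and s0: "s \<longlonglongrightarrow> 0" and rep: "reps I v X"
    and "r > 0"
  shows "finite {n. s n = r}" "eigen_mult I (l2_abs I X) r = card {n. s n = r}"
proof -
  let ?N = "{n. s n = r}"
  have "\<forall>\<^sub>F n in sequentially. s n < r" by (rule order_tendstoD(2)[OF s0 \<open>r > 0\<close>])
  then obtain M where M: "\<And>n. n \<ge> M \<Longrightarrow> s n < r" by (auto simp: eventually_sequentially)
  then have NM: "?N \<subseteq> {..<M}" by (force simp: not_less[symmetric])
  then show fin: "finite ?N" by (rule finite_subset) simp
  obtain Y where Y: "reps I Y (l2_abs I X)"
    and lim: "\<And>z. (\<lambda>n. \<Sum>k<n. s k *\<^sub>R ksc (cinner z (y k)) (y k)) \<longlonglongrightarrow> Y z"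
    and Yy: "\<And>n. Y (y n) = s n *\<^sub>R y n" and posY: "cpos Y"
    by (rule l2_abs_reps[OF svd s0 rep]) (rule that)
  have sym: "cadj Y Y" using posY by (simp add: cpos_def)
  have oz: "oz y" by (rule svd_atD(4)[OF svd])
  have y0: "y n \<noteq> 0" if "n \<in> ?N" for n
    using svd_atD(6)[OF svd, of n] that \<open>r > 0\<close> by auto
  have sy: "supp_in I (y n)" for n
  proof (cases "s n = 0")
    case True
    then show ?thesis using svd_atD(6)[OF svd, of n] by (simp add: supp_in_def)
  next
    case False
    have "supp_in I (Y (y n))" using Y by (simp add: reps_def)
    with False show ?thesis by (simp add: Yy supp_in_def)
  qed
  let ?V = "{\<zeta> \<in> l2 I. l2_abs I X \<zeta> = (\<lambda>i. of_real r * \<zeta> i)}"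
  let ?B = "(\<lambda>n. coords (y n)) ` ?N"
  interpret fs: vector_space "\<lambda>(c::'k) (\<zeta> :: 'i \<Rightarrow> 'k) i. c * \<zeta> i"
    by unfold_locales (auto simp: fun_eq_iff algebra_simps)
  have inj: "inj_on (\<lambda>n. coords (y n)) ?N"
  proof (rule inj_onI)
    fix m n assume mn: "m \<in> ?N" "n \<in> ?N" "coords (y m) = coords (y n)"
    then have "y m = y n" by (simp add: coords_inject)
    then have "cinner (y m) (y n) = 1" using ozD[OF oz, of n n] y0[OF mn(2)] by simp
    then show "m = n" using ozD[OF oz, of m n] by (auto split: if_splits)
  qed
  have "fs.dim ?V = card ?N"
  proof (rule fs.dim_unique)
    show "?B \<subseteq> ?V"
      using sy by (auto simp: coords_in_l2 reps_coords[OF Y] Yy fun_eq_iff scaleR_conv_of_real)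
    show "?V \<subseteq> fs.span ?B"
    proof
      fix \<zeta> assume \<zeta>: "\<zeta> \<in> ?V"
      define z where "z = Ell2 \<zeta>"
      have z: "coords z = \<zeta>" using \<zeta> by (auto simp: z_def)
      have Yz: "Y z = r *\<^sub>R z"
        by (rule ell2_eqI) (use \<zeta> Y in \<open>auto simp: reps_def z_def scaleR_conv_of_real fun_eq_iff\<close>)
      have ortho: "cinner z (y k) = 0" if "s k \<noteq> r" for k
      proof -
        have "r *\<^sub>R cinner z (y k) = cinner (Y z) (y k)" by (simp add: Yz cinner.scaleR_left)
        also have "\<dots> = s k *\<^sub>R cinner z (y k)" by (simp add: cadjD[OF sym] Yy cinner.scaleR_right)
        finally show ?thesis using that by simp
      qed
      have "(\<lambda>n. \<Sum>k<n. s k *\<^sub>R ksc (cinner z (y k)) (y k)) \<longlonglongrightarrow> (\<Sum>k\<in>?N. r *\<^sub>R ksc (cinner z (y k)) (y k))"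
      proof (rule tendsto_eventually, unfold eventually_sequentially, intro exI allI impI)
        fix n assume "n \<ge> M"
        then have "?N \<subseteq> {..<n}" using NM by auto
        then show "(\<Sum>k<n. s k *\<^sub>R ksc (cinner z (y k)) (y k)) = (\<Sum>k\<in>?N. r *\<^sub>R ksc (cinner z (y k)) (y k))"
          by (intro sum.mono_neutral_cong_right) (auto simp: ortho ksc.zero_left)
      qed
      with lim have "Y z = (\<Sum>k\<in>?N. r *\<^sub>R ksc (cinner z (y k)) (y k))" by (rule LIMSEQ_unique)
      then have "r *\<^sub>R z = r *\<^sub>R (\<Sum>k\<in>?N. ksc (cinner z (y k)) (y k))"
        by (simp add: Yz scaleR_sum_right)
      then have "z = (\<Sum>k\<in>?N. ksc (cinner z (y k)) (y k))" using \<open>r > 0\<close> by simp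
      then have "\<zeta> = coords (\<Sum>k\<in>?N. ksc (cinner z (y k)) (y k))" using z by simp
      also have "\<dots> = (\<Sum>k\<in>?N. (\<lambda>i. cinner z (y k) * coords (y k) i))"
        by (rule ext) (simp add: sum_fun_apply)
      also have "\<dots> \<in> fs.span ?B"
        by (intro fs.span_sum fs.span_scale fs.span_base) auto
      finally show "\<zeta> \<in> fs.span ?B" .
    qed
    show "fs.independent ?B"
    proof
      assume "fs.dependent ?B"
      then obtain c where c: "(\<Sum>b\<in>?B. (\<lambda>i. c b * b i)) = 0" "\<exists>b\<in>?B. c b \<noteq> 0"
        using fin by (subst (asm) fs.dependent_finite) auto
      have "0 = (\<Sum>n\<in>?N. (\<lambda>i. c (coords (y n)) * coords (y n) i))"
        using c(1) by (simp add: sum.reindex[OF inj] o_def)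
      also have "\<dots> = coords (\<Sum>n\<in>?N. ksc (c (coords (y n))) (y n))"
        by (rule ext) (simp add: sum_fun_apply)
      finally have zero: "(\<Sum>n\<in>?N. ksc (c (coords (y n))) (y n)) = 0"
        by (intro ell2_eqI) (simp add: fun_eq_iff)
      have "c (coords (y m)) = 0" if m: "m \<in> ?N" for m
      proof -
        have "0 = cinner (\<Sum>n\<in>?N. ksc (c (coords (y n))) (y n)) (y m)"
          by (simp only: zero cinner.zero_left)
        also have "\<dots> = (\<Sum>n\<in>?N. if n = m then c (coords (y m)) else 0)"
          unfolding cinner.sum_left cinner_ksc_left
          by (intro sum.cong refl) (use y0[OF m] in \<open>auto simp: ozD[OF oz]\<close>)
        also have "\<dots> = c (coords (y m))" using fin m by simp
        finally show ?thesis by simp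
      qed
      with c(2) show False by auto
    qed
    show "card ?B = card ?N" by (rule card_image[OF inj])
  qed
  then show "eigen_mult I (l2_abs I X) r = card ?N" by (simp add: eigen_mult_def)
qed

text \<open>An upper level set of a decreasing sequence is an initial segment, so its cardinality
  decides membership.\<close>

lemma decseq_level_card:
  fixes s :: "nat \<Rightarrow> real"
  assumes "decseq s" "finite {n. c \<le> s n}"
  shows "c \<le> s n \<longleftrightarrow> n < card {n. c \<le> s n}"
proof -
  let ?L = "{n. c \<le> s n}"
  have down: "m \<in> ?L" if "n \<in> ?L" "m \<le> n" for m n
    using that decseqD[OF assms(1) that(2)] by auto
  have "?L = {..<card ?L}"
  proof (cases "?L = {}")
    case False
    then have "Max ?L \<in> ?L" using assms(2) by (rule Max_in[rotated])
    then have "?L = {..Max ?L}" using down Max_ge[OF assms(2)] by blast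
    then have "card ?L = Suc (Max ?L)" by (metis card_atMost)
    with \<open>?L = {..Max ?L}\<close> show ?thesis by (simp add: lessThan_Suc_atMost)
  qed simp
  then show ?thesis by blast
qed

text \<open>Equal multiplicities give equal cardinalities of the level sets {n. c \<le> s n} for
  every c > 0, and these determine a decreasing nonnegative sequence. Convergence of s' to 0 is not
  assumed: its values from c upward occur with positive multiplicity, hence are among the finitely
  many such values of s, so its level sets are finite too.\<close>

lemma decseq_mult_unique:
  fixes s s' :: "nat \<Rightarrow> real"
  assumes s: "decseq s" "\<And>n. 0 \<le> s n" "s \<longlonglongrightarrow> 0"
    and s': "decseq s'" "\<And>n. 0 \<le> s' n" "\<And>r. r > 0 \<Longrightarrow> finite {n. s' n = r}"
    and eq: "\<And>r. r > 0 \<Longrightarrow> card {n. s' n = r} = card {n. s n = r}"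
    and fin: "\<And>r. r > 0 \<Longrightarrow> finite {n. s n = r}"
  shows "s' = s"
proof
  have level: "c \<le> s' n \<longleftrightarrow> c \<le> s n" if "c > 0" for c n
  proof -
    let ?L = "{n. c \<le> s n}" and ?L' = "{n. c \<le> s' n}"
    have "\<forall>\<^sub>F n in sequentially. s n < c" by (rule order_tendstoD(2)[OF s(3) \<open>c > 0\<close>])
    then obtain M where M: "\<And>n. n \<ge> M \<Longrightarrow> s n < c" by (auto simp: eventually_sequentially)
    have finL: "finite ?L"
      by (rule finite_subset[of _ "{..<M}"]) (use M in \<open>auto simp: not_less[symmetric]\<close>)
    let ?R = "s ` ?L"
    have R: "r \<ge> c" if "r \<in> ?R" for r using that by auto
    have mem: "r \<in> ?R" if "s' n = r" "c \<le> r" for r n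
    proof -
      have "r > 0" using that(2) \<open>c > 0\<close> by simp
      then have "card {n. s' n = r} > 0" using s'(3) that(1) by (auto simp: card_gt_0_iff)
      then have "card {n. s n = r} \<noteq> 0" using eq[OF \<open>r > 0\<close>] by simp
      then have "{n. s n = r} \<noteq> {}" by (intro notI) (simp only: card.empty)
      then show ?thesis using that(2) by auto
    qed
    have L: "?L = (\<Union>r\<in>?R. {n. s n = r})" by auto
    have aux: "c \<le> s' m \<longleftrightarrow> s' m \<in> ?R" for m
      by (rule iffI) (rule mem[OF refl], assumption, rule R, assumption)
    have L': "?L' = (\<Union>r\<in>?R. {n. s' n = r})" unfolding aux by blast
    have pos: "r > 0" if "r \<in> ?R" for r using R[OF that] \<open>c > 0\<close> by simp
    have finL': "finite ?L'" unfolding L' by (intro finite_UN_I finite_imageI finL s'(3) pos)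
    have "card ?L' = (\<Sum>r\<in>?R. card {n. s' n = r})"
      unfolding L' by (rule card_UN_disjoint) (simp_all add: finL pos s'(3) disjoint_iff)
    also have "\<dots> = (\<Sum>r\<in>?R. card {n. s n = r})"
      by (rule sum.cong[OF refl]) (rule eq[OF pos])
    also have "\<dots> = card (\<Union>r\<in>?R. {n. s n = r})"
    proof (rule card_UN_disjoint[symmetric])
      show "finite ?R" using finL by (rule finite_imageI)
      show "\<forall>r\<in>?R. finite {n. s n = r}" using fin[OF pos] by (rule ballI)
      show "\<forall>r\<in>?R. \<forall>q\<in>?R. r \<noteq> q \<longrightarrow> {n. s n = r} \<inter> {n. s n = q} = {}"
        by (intro ballI impI) (simp add: disjoint_iff)
    qed
    also have "\<dots> = card ?L" by (rule arg_cong[OF L[symmetric]])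
    finally have "card ?L' = card ?L" .
    then show ?thesis
      by (simp only: decseq_level_card[OF s(1) finL, of n] decseq_level_card[OF s'(1) finL', of n])
  qed
  fix n
  show "s' n = s n"
  proof (rule antisym)
    show "s' n \<le> s n"
      using level[of "s' n" n] s'(2)[of n] s(2)[of n] by (cases "s' n = 0") auto
    show "s n \<le> s' n"
      using level[of "s n" n] s'(2)[of n] s(2)[of n] by (cases "s n = 0") auto
  qed
qed

theorem singular_values_svd:
  assumes svd: "svd_at v s x y" and s0: "s \<longlonglongrightarrow> 0" and rep: "reps I v X"
  shows "singular_values I X = s"
  unfolding singular_values_def
proof (rule the_equality)
  have em: "r > 0 \<Longrightarrow> finite {n. s n = r}"
    "r > 0 \<Longrightarrow> eigen_mult I (l2_abs I X) r = card {n. s n = r}" for r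
    using eigen_mult_svd[OF svd s0 rep] by auto
  have s: "decseq s" "\<And>n. 0 \<le> s n" using svd_atD[OF svd] by auto
  show "decseq s \<and> (\<forall>n. 0 \<le> s n) \<and>
      (\<forall>r>0. finite {n. s n = r} \<and> card {n. s n = r} = eigen_mult I (l2_abs I X) r)"
    using s em by simp
  fix s' assume "decseq s' \<and> (\<forall>n. 0 \<le> s' n) \<and>
      (\<forall>r>0. finite {n. s' n = r} \<and> card {n. s' n = r} = eigen_mult I (l2_abs I X) r)"
  then show "s' = s"
    using em by (intro decseq_mult_unique s s0) auto
qed

section \<open>Normal measures and weak* sums\<close>

locale hyperstonean =
  fixes T :: "'t::t2_space itself"
  assumes hyper: "hyperstonian TYPE('t)"

sublocale hyperstonean \<subseteq> stonean T
  using hyper by unfold_locales (auto simp: hyperstonian_def)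

lemma apply_bcontfun_sum [simp]:
  "apply_bcontfun (\<Sum>i\<in>F. f i) t = (\<Sum>i\<in>F. apply_bcontfun (f i) t)"
  by (induction F rule: infinite_finite_induct) auto

lemma apply_bstar [simp]: "apply_bcontfun (bstar f) t = kconj (f t)"
proof -
  have "(\<lambda>t. kconj (f t)) \<in> bcontfun"
    by (rule bcontfun_normI[where b = "norm f"]) (auto intro!: continuous_intros simp: norm_bounded)
  then show ?thesis by (simp add: bstar_def Bcontfun_inverse)
qed

lemma normal_measureD:
  assumes "normal_measure M"
  shows "sets M = sets borel" "finite_measure M"
    "A \<in> sets borel \<Longrightarrow> emeasure M A = (SUP C\<in>{C. compact C \<and> C \<subseteq> A}. emeasure M C)"
  using assms by (auto simp: normal_measure_def)

context stonean
begin

lemma Bcontfun_continuous: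
  fixes f :: "'t \<Rightarrow> 'b::real_normed_vector"
  assumes "continuous_on UNIV f"
  shows "apply_bcontfun (Bcontfun f) = f"
proof -
  obtain B where "B > 0" "\<And>t. norm (f t) \<le> B" by (rule bounded_of_continuous[OF assms]) (rule that)
  then have "f \<in> bcontfun" using assms by (intro bcontfun_normI)
  then show ?thesis by (rule Bcontfun_inverse)
qed

lemma continuous_indicator:
  assumes "open A" "closed A"
  shows "continuous_on UNIV (indicator A :: 't \<Rightarrow> 'b::{topological_space, zero_neq_one})"
proof -
  have "continuous_on (A \<union> - A) (\<lambda>t. if t \<in> A then 1 else (0 :: 'b))"
    by (rule continuous_on_If) (use assms in \<open>auto simp: closed_Compl\<close>)
  then show ?thesis by (simp add: indicator_def[abs_def] of_bool_def)
qed

lemma normal_measurable: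
  fixes f :: "'t \<Rightarrow> 'b::{banach, second_countable_topology}"
  assumes "normal_measure M" "continuous_on UNIV f"
  shows "f \<in> borel_measurable M"
  using borel_measurable_continuous_onI[OF assms(2)] normal_measureD(1)[OF assms(1)]
  by (simp cong: measurable_cong_sets)

lemma normal_integrable:
  fixes f :: "'t \<Rightarrow> 'b::{banach, second_countable_topology}"
  assumes M: "normal_measure M" and f: "continuous_on UNIV f"
  shows "integrable M f"
proof -
  interpret finite_measure M using M by (rule normal_measureD)
  obtain B where "B > 0" "\<And>t. norm (f t) \<le> B" by (rule bounded_of_continuous[OF f]) (rule that)
  then show ?thesis
    by (intro integrable_const_bound[where B = B] normal_measurable M f) auto
qed

text \<open>Order continuity for indexed families of plain continuous functions, the form in which
  finite partial sums arise.\<close>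

lemma normal_sup:
  fixes f :: "'t \<Rightarrow> real" and g :: "'j \<Rightarrow> 't \<Rightarrow> real"
  assumes M: "normal_measure M" and J: "J \<noteq> {}" and g: "\<And>j. j \<in> J \<Longrightarrow> continuous_on UNIV (g j)"
    and dir: "\<And>i j. i \<in> J \<Longrightarrow> j \<in> J \<Longrightarrow> \<exists>k\<in>J. \<forall>t. g i t \<le> g k t \<and> g j t \<le> g k t"
    and f: "continuous_on UNIV f" and ub: "\<And>j t. j \<in> J \<Longrightarrow> g j t \<le> f t"
    and least: "\<And>h t. continuous_on UNIV h \<Longrightarrow> (\<And>j t. j \<in> J \<Longrightarrow> g j t \<le> h t) \<Longrightarrow> f t \<le> h t"
  shows "(\<integral>t. f t \<partial>M) = (SUP j\<in>J. \<integral>t. g j t \<partial>M)"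
proof -
  have B: "apply_bcontfun (Bcontfun (g j)) = g j" if "j \<in> J" for j
    using Bcontfun_continuous g that by blast
  let ?F = "(\<lambda>j. Bcontfun (g j)) ` J"
  have lub: "is_lub_C ?F (Bcontfun f)"
    unfolding is_lub_C_def Bcontfun_continuous[OF f]
  proof (intro conjI ballI allI impI)
    fix q t assume "q \<in> ?F"
    then show "apply_bcontfun q t \<le> f t" using B ub by auto
  next
    fix h t assume h: "\<forall>q\<in>?F. \<forall>t. apply_bcontfun q t \<le> apply_bcontfun h t"
    show "f t \<le> apply_bcontfun h t"
    proof (rule least)
      show "g j t \<le> apply_bcontfun h t" if "j \<in> J" for j t
        using h that B[OF that] by force
    qed simp
  qed
  have dirF: "\<forall>a\<in>?F. \<forall>b\<in>?F. \<exists>c\<in>?F. \<forall>t.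
      apply_bcontfun a t \<le> apply_bcontfun c t \<and> apply_bcontfun b t \<le> apply_bcontfun c t"
  proof (intro ballI)
    fix a b assume "a \<in> ?F" "b \<in> ?F"
    then obtain i j where ij: "i \<in> J" "j \<in> J" "a = Bcontfun (g i)" "b = Bcontfun (g j)" by auto
    obtain k where k: "k \<in> J" "\<forall>t. g i t \<le> g k t \<and> g j t \<le> g k t" using dir ij by blast
    show "\<exists>c\<in>?F. \<forall>t. apply_bcontfun a t \<le> apply_bcontfun c t \<and> apply_bcontfun b t \<le> apply_bcontfun c t"
      by (rule bexI[of _ "Bcontfun (g k)"]) (use ij k B in auto)
  qed
  have ne: "?F \<noteq> {}" using J by simp
  have "(\<integral>t. apply_bcontfun (Bcontfun f) t \<partial>M) = (SUP q\<in>?F. \<integral>t. apply_bcontfun q t \<partial>M)"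
    by (rule M[unfolded normal_measure_def, THEN conjunct2, THEN conjunct2, THEN conjunct2,
          THEN spec, THEN spec, THEN mp, OF conjI[OF ne conjI[OF dirF lub]]])
  also have "(SUP q\<in>?F. \<integral>t. apply_bcontfun q t \<partial>M) = (SUP j\<in>J. \<integral>t. g j t \<partial>M)"
    unfolding image_image by (intro SUP_cong refl) (simp add: B)
  finally show ?thesis by (simp add: Bcontfun_continuous[OF f])
qed

lemma integral_restricted:
  fixes f :: "'t \<Rightarrow> 'b::{banach, second_countable_topology}"
  assumes M: "normal_measure M" and A: "open A" and f: "continuous_on UNIV f"
  shows "(\<integral>t. f t \<partial>(density M (indicator A))) = (\<integral>t. indicator A t *\<^sub>R f t \<partial>M)"
proof -
  have "A \<in> sets M" using A normal_measureD(1)[OF M] by simp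
  then have "(\<integral>t. f t \<partial>(density M (\<lambda>t. ennreal (indicator A t)))) = (\<integral>t. indicator A t *\<^sub>R f t \<partial>M)"
    by (intro integral_density normal_measurable[OF M f]) auto
  then show ?thesis by (simp add: ennreal_indicator)
qed

text \<open>Cutting down to a clopen set multiplies integrands by a continuous indicator, which
  respects suprema among continuous functions. This permits localizing every argument with normal
  measures.\<close>

lemma normal_measure_restricted:
  fixes M :: "'t measure"
  assumes M: "normal_measure M" and A: "open A" "closed A"
  shows "normal_measure (density M (indicator A))"
  unfolding normal_measure_def
proof (intro conjI allI impI ballI)
  let ?N = "density M (indicator A)"
  note MD = normal_measureD[OF M]
  have Asets: "A \<in> sets M" using A MD(1) by simp
  show "sets ?N = sets borel" by (simp add: MD(1))
  show "finite_measure ?N" by (rule finite_measure.finite_measure_restricted[OF MD(2) Asets])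
  have eN: "emeasure ?N X = emeasure M (A \<inter> X)" if "X \<in> sets borel" for X
    using that MD(1) Asets by (intro emeasure_restricted) auto
  have cb: "C \<in> sets borel" if "compact C" for C :: "'t set"
    using that by (intro borel_closed compact_imp_closed)
  show "emeasure ?N X = (SUP C\<in>{C. compact C \<and> C \<subseteq> X}. emeasure ?N C)" if X: "X \<in> sets borel" for X
  proof (rule antisym)
    have AX: "A \<inter> X \<in> sets borel" using X A by auto
    show "emeasure ?N X \<le> (SUP C\<in>{C. compact C \<and> C \<subseteq> X}. emeasure ?N C)"
      unfolding eN[OF X] MD(3)[OF AX]
    proof (rule SUP_mono)
      fix C assume C: "C \<in> {C. compact C \<and> C \<subseteq> A \<inter> X}"
      then have "emeasure ?N C = emeasure M C" using eN[OF cb, of C] by (simp add: Int_absorb1)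
      then show "\<exists>D\<in>{C. compact C \<and> C \<subseteq> X}. emeasure M C \<le> emeasure ?N D" using C by auto
    qed
    show "(SUP C\<in>{C. compact C \<and> C \<subseteq> X}. emeasure ?N C) \<le> emeasure ?N X"
      by (rule SUP_least) (use X MD(1) in \<open>auto intro!: emeasure_mono\<close>)
  qed
  fix F :: "('t \<Rightarrow>\<^sub>C real) set" and f
  assume F: "F \<noteq> {} \<and> (\<forall>g\<in>F. \<forall>h\<in>F. \<exists>k\<in>F. \<forall>t. apply_bcontfun g t \<le> apply_bcontfun k t \<and>
      apply_bcontfun h t \<le> apply_bcontfun k t) \<and> is_lub_C F f"
  have cont: "continuous_on UNIV (apply_bcontfun q)" for q :: "'t \<Rightarrow>\<^sub>C real"
    by simp
  have ci: "continuous_on UNIV (\<lambda>t. indicator A t *\<^sub>R apply_bcontfun q t)" for q :: "'t \<Rightarrow>\<^sub>C real"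
    by (intro continuous_intros continuous_indicator A cont)
  have "(\<integral>t. indicator A t *\<^sub>R f t \<partial>M) = (SUP q\<in>F. \<integral>t. indicator A t *\<^sub>R apply_bcontfun q t \<partial>M)"
  proof (rule normal_sup[OF M _ ci _ ci])
    show "F \<noteq> {}" using F by blast
    fix a b assume "a \<in> F" "b \<in> F"
    then obtain k where k: "k \<in> F" "\<forall>t. apply_bcontfun a t \<le> apply_bcontfun k t \<and>
        apply_bcontfun b t \<le> apply_bcontfun k t"
      using F by blast
    then show "\<exists>k\<in>F. \<forall>t. indicator A t *\<^sub>R apply_bcontfun a t \<le> indicator A t *\<^sub>R apply_bcontfun k t \<and>
        indicator A t *\<^sub>R apply_bcontfun b t \<le> indicator A t *\<^sub>R apply_bcontfun k t"
      by (intro bexI[of _ k]) (auto simp: indicator_def)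
  next
    show "indicator A t *\<^sub>R apply_bcontfun j t \<le> indicator A t *\<^sub>R apply_bcontfun f t" if "j \<in> F" for j t
      using F that by (auto simp: is_lub_C_def indicator_def)
  next
    fix h t assume h: "continuous_on UNIV h"
      "\<And>j t. j \<in> F \<Longrightarrow> indicator A t *\<^sub>R apply_bcontfun j t \<le> h t"
    \<comment> \<open>An upper bound of the cut-off functions is completed to one of F itself: off A
      the constant \<open>norm f\<close> dominates f.\<close>
    let ?h = "\<lambda>t. indicator A t *\<^sub>R h t + indicator (- A) t *\<^sub>R norm f"
    have ch: "continuous_on UNIV ?h"
      by (intro continuous_intros continuous_indicator A h(1))
    have "apply_bcontfun q t \<le> ?h t" if "q \<in> F" for q t
    proof (cases "t \<in> A")
      case True
      then show ?thesis using h(2)[OF that, of t] by simp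
    next
      case False
      have "apply_bcontfun q t \<le> apply_bcontfun f t" using F that by (auto simp: is_lub_C_def)
      also have "\<dots> \<le> norm f" using norm_bounded[of f t] by simp
      finally show ?thesis using False by simp
    qed
    then have le: "\<forall>q\<in>F. \<forall>t. apply_bcontfun q t \<le> apply_bcontfun (Bcontfun ?h) t"
      unfolding Bcontfun_continuous[OF ch] by blast
    have "(\<forall>q\<in>F. \<forall>t. apply_bcontfun q t \<le> apply_bcontfun k t) \<longrightarrow>
        (\<forall>t. apply_bcontfun f t \<le> apply_bcontfun k t)" for k
      using F by (simp add: is_lub_C_def)
    from this[THEN mp, OF le] have fh: "apply_bcontfun f t \<le> ?h t"
      unfolding Bcontfun_continuous[OF ch] by (rule spec)
    show "indicator A t *\<^sub>R apply_bcontfun f t \<le> h t"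
    proof (cases "t \<in> A")
      case False
      obtain q where "q \<in> F" using F by auto
      from h(2)[OF this, of t] False show ?thesis by simp
    qed (use fh in simp)
  qed
  then show "(\<integral>t. apply_bcontfun f t \<partial>?N) = (SUP q\<in>F. \<integral>t. apply_bcontfun q t \<partial>?N)"
    by (simp only: integral_restricted[OF M A(1) cont])
qed

end

section \<open>Separation by normal measures, and weak* sums\<close>

context hyperstonean
begin

text \<open>If h t is nonzero, the real part of \<open>kconj (h t) * h\<close> is positive on a
  clopen neighbourhood A of t. The supports being dense, some normal M charges A, and its
  restriction to A does not annihilate h. Weak* limits are therefore unique.\<close>

lemma normal_measures_separate:
  fixes h :: "'t \<Rightarrow> 'k::rclike"
  assumes h: "continuous_on UNIV h" and zero: "\<And>M. normal_measure M \<Longrightarrow> (\<integral>t. h t \<partial>M) = 0"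
  shows "h t = 0"
proof (rule ccontr)
  assume "h t \<noteq> 0"
  define r where "r s = (kconj (h t) * h s) \<bullet> 1" for s
  have cr: "continuous_on UNIV r" unfolding r_def by (intro continuous_intros h)
  have "r t = (norm (h t))\<^sup>2"
    using mult_kconj_of_real[of "h t"] by (simp add: r_def mult.commute del: of_real_power)
  with \<open>h t \<noteq> 0\<close> have tr: "t \<in> {s. 0 < r s}" by simp
  have or: "open {s. 0 < r s}" by (intro open_Collect_less continuous_intros cr)
  obtain A where A: "open A" "closed A" "t \<in> A" "A \<subseteq> {s. 0 < r s}"
    by (rule clopen_nbhd[OF or tr]) (rule that)
  have "t \<in> closure (\<Union>M\<in>{M :: 't measure. normal_measure M}. measure_support M)"
    using hyper by (simp add: hyperstonian_def)
  with A(3) have "A \<inter> closure (\<Union>M\<in>{M :: 't measure. normal_measure M}. measure_support M) \<noteq> {}"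
    by blast
  then have "A \<inter> (\<Union>M\<in>{M :: 't measure. normal_measure M}. measure_support M) \<noteq> {}"
    unfolding open_Int_closure_eq_empty[OF A(1)] .
  then obtain M q where M: "normal_measure M" and q: "q \<in> A" "q \<in> measure_support M" by auto
  have MA: "emeasure M A > 0" using q A(1) by (auto simp: measure_support_def)
  have cir: "continuous_on UNIV (\<lambda>s. indicator A s *\<^sub>R r s)"
    and cih: "continuous_on UNIV (\<lambda>s. indicator A s *\<^sub>R h s)"
    by (intro continuous_intros continuous_indicator A cr h)+
  have bl: "bounded_linear (\<lambda>x. (kconj (h t) * x) \<bullet> 1)"
    by (intro bounded_linear_compose[OF bounded_linear_inner_left] bounded_linear_mult_right)
  have "(\<integral>s. indicator A s *\<^sub>R r s \<partial>M) = (\<integral>s. (kconj (h t) * (indicator A s *\<^sub>R h s)) \<bullet> 1 \<partial>M)"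
    by (simp add: r_def)
  also have "\<dots> = (kconj (h t) * (\<integral>s. indicator A s *\<^sub>R h s \<partial>M)) \<bullet> 1"
    by (rule integral_bounded_linear[OF bl normal_integrable[OF M cih]])
  also have "(\<integral>s. indicator A s *\<^sub>R h s \<partial>M) = 0"
    using zero[OF normal_measure_restricted[OF M A(1,2)]] integral_restricted[OF M A(1) h] by simp
  finally have "(\<integral>s. indicator A s *\<^sub>R r s \<partial>M) = 0" by simp
  moreover have nn: "0 \<le> indicator A s *\<^sub>R r s" for s
    using A(4) by (auto simp: indicator_def intro: less_imp_le)
  ultimately have "AE s in M. indicator A s *\<^sub>R r s = 0"
    using integral_nonneg_eq_0_iff_AE[OF normal_integrable[OF M cir]] by simp
  then have "AE s in M. s \<notin> A"
    by eventually_elim (use A(4) in \<open>auto simp: indicator_def\<close>)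
  moreover have Asets: "A \<in> sets M" using A normal_measureD(1)[OF M] by simp
  moreover have "{s \<in> space M. s \<in> A} = A" using sets.sets_into_space[OF Asets] by auto
  ultimately have "emeasure M A = 0"
    by (subst (asm) AE_iff_measurable[of A]) auto
  with MA show False by simp
qed

text \<open>Plain functions and general Banach values, so that real-valued components of a scalar
  sum can be treated by themselves.\<close>

definition weak_sum :: "('i \<Rightarrow> 't \<Rightarrow> 'b::{banach, second_countable_topology}) \<Rightarrow> ('t \<Rightarrow> 'b) \<Rightarrow> 'i set \<Rightarrow> bool"
  where "weak_sum f g I \<longleftrightarrow> continuous_on UNIV g \<and>
    (\<forall>M. normal_measure M \<longrightarrow> ((\<lambda>i. \<integral>t. f i t \<partial>M) has_sum (\<integral>t. g t \<partial>M)) I)"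

lemma weak_sum_unique:
  fixes g :: "'t \<Rightarrow> 'k::rclike"
  assumes "weak_sum f g I" "weak_sum f g' I"
  shows "g t = g' t"
proof -
  have c: "continuous_on UNIV g" "continuous_on UNIV g'" using assms by (auto simp: weak_sum_def)
  have "g t - g' t = 0"
  proof (rule normal_measures_separate)
    show "continuous_on UNIV (\<lambda>t. g t - g' t)" by (intro continuous_intros c)
    fix M :: "'t measure" assume M: "normal_measure M"
    then have "(\<integral>t. g t \<partial>M) = (\<integral>t. g' t \<partial>M)"
      using assms unfolding weak_sum_def by (blast intro: has_sum_unique)
    then show "(\<integral>t. g t - g' t \<partial>M) = 0"
      by (simp add: normal_integrable[OF M c(1)] normal_integrable[OF M c(2)])
  qed
  then show ?thesis by simp
qed

text \<open>Testing the cut-off sum against M is the same as testing the original sum against M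
  restricted to A, which is again normal.\<close>

lemma weak_sum_restrict:
  fixes f :: "'i \<Rightarrow> 't \<Rightarrow> 'b::{banach, second_countable_topology}"
  assumes "weak_sum f g I" and A: "open A" "closed A" and f: "\<And>i. i \<in> I \<Longrightarrow> continuous_on UNIV (f i)"
  shows "weak_sum (\<lambda>i t. indicator A t *\<^sub>R f i t) (\<lambda>t. indicator A t *\<^sub>R g t) I"
  unfolding weak_sum_def
proof (intro conjI allI impI)
  have g: "continuous_on UNIV g" using assms(1) by (simp add: weak_sum_def)
  show "continuous_on UNIV (\<lambda>t. indicator A t *\<^sub>R g t)"
    by (intro continuous_intros continuous_indicator A g)
  fix M :: "'t measure" assume M: "normal_measure M"
  have "((\<lambda>i. \<integral>t. f i t \<partial>(density M (indicator A))) has_sum (\<integral>t. g t \<partial>(density M (indicator A)))) I"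
    using assms(1) normal_measure_restricted[OF M A] by (simp add: weak_sum_def)
  then show "((\<lambda>i. \<integral>t. indicator A t *\<^sub>R f i t \<partial>M) has_sum (\<integral>t. indicator A t *\<^sub>R g t \<partial>M)) I"
    unfolding integral_restricted[OF M A(1) g]
    by (rule has_sum_cong[THEN iffD1, rotated]) (simp add: integral_restricted[OF M A(1) f])
qed

lemma weak_sum_bounded_linear:
  fixes f :: "'i \<Rightarrow> 't \<Rightarrow> 'b::{banach, second_countable_topology}"
    and L :: "'b \<Rightarrow> 'c::{banach, second_countable_topology}"
  assumes "weak_sum f g I" and L: "bounded_linear L" and f: "\<And>i. i \<in> I \<Longrightarrow> continuous_on UNIV (f i)"
  shows "weak_sum (\<lambda>i t. L (f i t)) (\<lambda>t. L (g t)) I"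
  unfolding weak_sum_def
proof (intro conjI allI impI)
  have g: "continuous_on UNIV g" using assms(1) by (simp add: weak_sum_def)
  then show "continuous_on UNIV (\<lambda>t. L (g t))" by (rule bounded_linear.continuous_on[OF L])
  fix M :: "'t measure" assume M: "normal_measure M"
  then have "((\<lambda>i. L (\<integral>t. f i t \<partial>M)) has_sum L (\<integral>t. g t \<partial>M)) I"
    using assms(1) by (intro has_sum_bounded_linear[OF L]) (simp add: weak_sum_def)
  then show "((\<lambda>i. \<integral>t. L (f i t) \<partial>M) has_sum (\<integral>t. L (g t) \<partial>M)) I"
    unfolding integral_bounded_linear[OF L normal_integrable[OF M g]]
    by (rule has_sum_cong[THEN iffD1, rotated])
      (simp add: integral_bounded_linear[OF L normal_integrable[OF M f]])
qed

lemma weak_sum_add: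
  fixes f :: "'i \<Rightarrow> 't \<Rightarrow> 'b::{banach, second_countable_topology}"
  assumes "weak_sum f g I" "weak_sum f' g' I"
    and f: "\<And>i. i \<in> I \<Longrightarrow> continuous_on UNIV (f i)" "\<And>i. i \<in> I \<Longrightarrow> continuous_on UNIV (f' i)"
  shows "weak_sum (\<lambda>i t. f i t + f' i t) (\<lambda>t. g t + g' t) I"
  unfolding weak_sum_def
proof (intro conjI allI impI)
  have g: "continuous_on UNIV g" "continuous_on UNIV g'" using assms(1,2) by (auto simp: weak_sum_def)
  show "continuous_on UNIV (\<lambda>t. g t + g' t)" by (intro continuous_intros g)
  fix M :: "'t measure" assume M: "normal_measure M"
  then have "((\<lambda>i. (\<integral>t. f i t \<partial>M) + (\<integral>t. f' i t \<partial>M)) has_sum (\<integral>t. g t \<partial>M) + (\<integral>t. g' t \<partial>M)) I"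
    using assms(1,2) by (intro has_sum_add) (auto simp: weak_sum_def)
  then show "((\<lambda>i. \<integral>t. f i t + f' i t \<partial>M) has_sum (\<integral>t. g t + g' t \<partial>M)) I"
    unfolding Bochner_Integration.integral_add[OF normal_integrable[OF M g(1)] normal_integrable[OF M g(2)]]
    by (rule has_sum_cong[THEN iffD1, rotated])
      (simp add: normal_integrable[OF M f(1)] normal_integrable[OF M f(2)])
qed

text \<open>The finite partial sums form a bounded directed family; its supremum in the continuous
  functions is the sum, because normal measures are order continuous. Leastness also makes every
  constant bound of the partial sums a bound of g, which later controls norms.\<close>

lemma weak_sum_nonneg_exists:
  fixes f :: "'i \<Rightarrow> 't \<Rightarrow> real"
  assumes f: "\<And>i. i \<in> I \<Longrightarrow> continuous_on UNIV (f i)" "\<And>i t. i \<in> I \<Longrightarrow> 0 \<le> f i t"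
    and C: "\<And>F t. finite F \<Longrightarrow> F \<subseteq> I \<Longrightarrow> (\<Sum>i\<in>F. f i t) \<le> C"
  obtains g where "weak_sum f g I" "\<And>F t. finite F \<Longrightarrow> F \<subseteq> I \<Longrightarrow> (\<Sum>i\<in>F. f i t) \<le> g t"
    "\<And>t D. (\<And>F s. finite F \<Longrightarrow> F \<subseteq> I \<Longrightarrow> (\<Sum>i\<in>F. f i s) \<le> D) \<Longrightarrow> g t \<le> D"
proof -
  let ?J = "{F. finite F \<and> F \<subseteq> I}"
  have J: "?J \<noteq> {}" by blast
  have cS: "continuous_on UNIV (\<lambda>t. \<Sum>i\<in>F. f i t)" if "F \<in> ?J" for F
    using that f(1) by (intro continuous_intros) auto
  have pos: "0 \<le> (\<Sum>i\<in>F. f i t)" if "F \<in> ?J" for F t using that f(2) by (intro sum_nonneg) auto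
  have bd: "(\<Sum>i\<in>F. f i t) \<le> C" if "F \<in> ?J" for F t using that C by auto
  obtain g where g: "continuous_on UNIV g" "\<And>F t. F \<in> ?J \<Longrightarrow> (\<Sum>i\<in>F. f i t) \<le> g t"
    "\<And>h t. continuous_on UNIV h \<Longrightarrow> (\<And>F t. F \<in> ?J \<Longrightarrow> (\<Sum>i\<in>F. f i t) \<le> h t) \<Longrightarrow> g t \<le> h t"
  proof (rule continuous_sup_exists[of ?J "\<lambda>F t. \<Sum>i\<in>F. f i t" C])
    fix g assume "continuous_on UNIV g" "\<And>F t. F \<in> ?J \<Longrightarrow> (\<Sum>i\<in>F. f i t) \<le> g t"
      "\<And>h t. continuous_on UNIV h \<Longrightarrow> (\<And>F t. F \<in> ?J \<Longrightarrow> (\<Sum>i\<in>F. f i t) \<le> h t) \<Longrightarrow> g t \<le> h t"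
    then show thesis by (rule that)
  qed (erule cS pos bd | rule J)+
  have "weak_sum f g I"
    unfolding weak_sum_def
  proof (intro conjI allI impI g(1))
    fix M :: "'t measure" assume M: "normal_measure M"
    have "(\<integral>t. g t \<partial>M) = (SUP F\<in>?J. \<integral>t. (\<Sum>i\<in>F. f i t) \<partial>M)"
    proof (rule normal_sup[where g = "\<lambda>F t. \<Sum>i\<in>F. f i t"])
      fix F G assume FG: "F \<in> ?J" "G \<in> ?J"
      show "\<exists>K\<in>?J. \<forall>t. (\<Sum>i\<in>F. f i t) \<le> (\<Sum>i\<in>K. f i t) \<and> (\<Sum>i\<in>G. f i t) \<le> (\<Sum>i\<in>K. f i t)"
        by (rule bexI[of _ "F \<union> G"]) (use FG f(2) in \<open>auto intro!: sum_mono2\<close>)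
    next
      fix h t assume "continuous_on UNIV h" "\<And>F t. F \<in> ?J \<Longrightarrow> (\<Sum>i\<in>F. f i t) \<le> h t"
      then show "g t \<le> h t" by (rule g(3))
    qed (rule M J g(1) | erule cS g(2))+
    also have "\<dots> = (SUP F\<in>?J. \<Sum>i\<in>F. \<integral>t. f i t \<partial>M)"
      by (intro SUP_cong refl Bochner_Integration.integral_sum normal_integrable[OF M f(1)]) auto
    finally have eq: "(\<integral>t. g t \<partial>M) = (SUP F\<in>?J. \<Sum>i\<in>F. \<integral>t. f i t \<partial>M)" .
    have nn: "0 \<le> (\<integral>t. f i t \<partial>M)" if "i \<in> I" for i
      by (rule Bochner_Integration.integral_nonneg) (rule f(2)[OF that])
    have "(\<lambda>i. \<integral>t. f i t \<partial>M) summable_on I"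
    proof (rule nonneg_bdd_above_summable_on)
      show "bdd_above (sum (\<lambda>i. \<integral>t. f i t \<partial>M) ` {F. F \<subseteq> I \<and> finite F})"
      proof (rule bdd_aboveI2)
        fix F assume F: "F \<in> {F. F \<subseteq> I \<and> finite F}"
        then have FJ: "F \<in> ?J" by auto
        have "(\<Sum>i\<in>F. \<integral>t. f i t \<partial>M) = (\<integral>t. (\<Sum>i\<in>F. f i t) \<partial>M)"
          using F by (intro Bochner_Integration.integral_sum[symmetric] normal_integrable[OF M f(1)]) auto
        also have "\<dots> \<le> (\<integral>t. g t \<partial>M)"
          by (intro integral_mono normal_integrable[OF M] g(1) g(2)[OF FJ] cS[OF FJ])
        finally show "(\<Sum>i\<in>F. \<integral>t. f i t \<partial>M) \<le> (\<integral>t. g t \<partial>M)" .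
      qed
    qed (rule nn)
    from has_sum_nonneg_SUPREMUM_real[OF this nn]
    show "((\<lambda>i. \<integral>t. f i t \<partial>M) has_sum (\<integral>t. g t \<partial>M)) I" unfolding eq .
  qed
  moreover have "g t \<le> D" if "\<And>F s. finite F \<Longrightarrow> F \<subseteq> I \<Longrightarrow> (\<Sum>i\<in>F. f i s) \<le> D" for t D
    by (rule g(3)[of "\<lambda>_. D"]) (use that in auto)
  ultimately show ?thesis using g(2) by (intro that) auto
qed

text \<open>Along each basis vector b, the component is the difference of the nonnegative families a
  + f \<bullet> b and a, both with bounded partial sums. The components are then recombined over the
  finite basis.\<close>

lemma weak_sum_exists:
  fixes f :: "'i \<Rightarrow> 't \<Rightarrow> 'b::euclidean_space"
  assumes f: "\<And>i. i \<in> I \<Longrightarrow> continuous_on UNIV (f i)"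
    and a: "\<And>i. i \<in> I \<Longrightarrow> continuous_on UNIV (a i)" "\<And>i t. i \<in> I \<Longrightarrow> norm (f i t) \<le> a i t"
    and C: "\<And>F t. finite F \<Longrightarrow> F \<subseteq> I \<Longrightarrow> (\<Sum>i\<in>F. a i t) \<le> C"
  obtains g where "weak_sum f g I"
proof -
  have a0: "0 \<le> a i t" if "i \<in> I" for i t using a(2)[OF that, of t] norm_ge_zero order_trans by blast
  obtain A where A: "weak_sum a A I"
    by (rule weak_sum_nonneg_exists[of I a C, OF a(1) a0 C]) (assumption | rule that)+
  have "\<exists>G. weak_sum (\<lambda>i t. f i t \<bullet> b) G I" if b: "b \<in> Basis" for b
  proof -
    have fb: "\<bar>f i t \<bullet> b\<bar> \<le> a i t" if "i \<in> I" for i t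
      using Basis_le_norm[OF b, of "f i t"] a(2)[OF that, of t] by simp
    have cb: "continuous_on UNIV (\<lambda>t. a i t + f i t \<bullet> b)" if "i \<in> I" for i
      by (intro continuous_intros a(1) f that)
    have nb: "0 \<le> a i t + f i t \<bullet> b" if "i \<in> I" for i t using fb[OF that, of t] by linarith
    have Cb: "(\<Sum>i\<in>F. a i t + f i t \<bullet> b) \<le> 2 * C" if F: "finite F" "F \<subseteq> I" for F t
    proof -
      have "(\<Sum>i\<in>F. a i t + f i t \<bullet> b) \<le> (\<Sum>i\<in>F. 2 * a i t)"
      proof (rule sum_mono)
        fix i assume "i \<in> F"
        then show "a i t + f i t \<bullet> b \<le> 2 * a i t" using fb[of i t] F(2) by force
      qed
      also have "\<dots> \<le> 2 * C" using C[OF F, of t] by (simp add: sum_distrib_left[symmetric])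
      finally show ?thesis .
    qed
    obtain G where G: "weak_sum (\<lambda>i t. a i t + f i t \<bullet> b) G I"
      by (rule weak_sum_nonneg_exists[of I "\<lambda>i t. a i t + f i t \<bullet> b" "2 * C", OF cb nb Cb]) (assumption | rule that)+
    have "weak_sum (\<lambda>i t. - a i t) (\<lambda>t. - A t) I"
      by (rule weak_sum_bounded_linear[OF A bounded_linear_minus[OF bounded_linear_ident] a(1)])
    from weak_sum_add[OF G this cb] a(1)
    have "weak_sum (\<lambda>i t. a i t + f i t \<bullet> b + - a i t) (\<lambda>t. G t + - A t) I"
      by (auto intro!: continuous_intros)
    then have "weak_sum (\<lambda>i t. f i t \<bullet> b) (\<lambda>t. G t + - A t) I" by simp
    then show ?thesis by blast
  qed
  then obtain G where G: "\<And>b. b \<in> Basis \<Longrightarrow> weak_sum (\<lambda>i t. f i t \<bullet> b) (G b) I" by metis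
  have "weak_sum (\<lambda>i t. \<Sum>b\<in>B. (f i t \<bullet> b) *\<^sub>R b) (\<lambda>t. \<Sum>b\<in>B. G b t *\<^sub>R b) I"
    if "finite B" "B \<subseteq> Basis" for B :: "'b set"
    using that
  proof (induction B rule: finite_induct)
    case empty
    show ?case by (simp add: weak_sum_def)
  next
    case (insert b B)
    have "weak_sum (\<lambda>i t. (f i t \<bullet> b) *\<^sub>R b) (\<lambda>t. G b t *\<^sub>R b) I"
      by (rule weak_sum_bounded_linear[OF G bounded_linear_scaleR_left])
        (use insert f in \<open>auto intro!: continuous_intros\<close>)
    moreover have "weak_sum (\<lambda>i t. \<Sum>b\<in>B. (f i t \<bullet> b) *\<^sub>R b) (\<lambda>t. \<Sum>b\<in>B. G b t *\<^sub>R b) I"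
      using insert by simp
    ultimately have "weak_sum (\<lambda>i t. (f i t \<bullet> b) *\<^sub>R b + (\<Sum>b\<in>B. (f i t \<bullet> b) *\<^sub>R b))
        (\<lambda>t. G b t *\<^sub>R b + (\<Sum>b\<in>B. G b t *\<^sub>R b)) I"
      by (rule weak_sum_add) (intro continuous_intros f, assumption)+
    then show ?case using insert.hyps by simp
  qed
  from this[OF finite_Basis subset_refl] show ?thesis
    by (intro that) (simp add: euclidean_representation)
qed

end

section \<open>Truncations\<close>

lemma trunc_diff: "trunc F (x - y) = trunc F x - trunc F y"
  by (rule ell2_eqI) simp

lemma trunc_finite:
  assumes "finite F"
  shows "trunc F x = (\<Sum>i\<in>F. ksc (coords x i) (ket i))"
  by (rule ell2_eqI)
    (use assms in \<open>simp add: coords_ket if_distrib[of "\<lambda>c. coords x _ * c"] cong: if_cong\<close>)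

lemma cinner_trunc:
  assumes "finite F"
  shows "cinner x (trunc F y) = (\<Sum>i\<in>F. coords x i * kconj (coords y i))"
  unfolding trunc_finite[OF assms] by (simp add: cinner.sum_right cinner_ket mult.commute)

lemma norm_trunc:
  assumes "finite F"
  shows "(norm (x - trunc F x))\<^sup>2 = (norm x)\<^sup>2 - (\<Sum>i\<in>F. (norm (coords x i))\<^sup>2)"
proof -
  have "of_real ((norm (x - trunc F x))\<^sup>2) = cinner (x - trunc F x) x - cinner (x - trunc F x) (trunc F x)"
    unfolding cinner_self[symmetric] by (rule cinner.diff_right)
  also have "cinner (x - trunc F x) (trunc F x) = 0"
    unfolding cinner_trunc[OF assms] by (intro sum.neutral ballI) simp
  also have "cinner (x - trunc F x) x = cinner x x - kconj (cinner x (trunc F x))"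
    by (simp only: cinner.diff_left cinner_commute[of "trunc F x" x])
  also have "kconj (cinner x (trunc F x)) = of_real (\<Sum>i\<in>F. (norm (coords x i))\<^sup>2)"
    unfolding cinner_trunc[OF assms] by (simp add: mult_kconj_of_real kconj_sum del: of_real_power)
  finally have "of_real ((norm (x - trunc F x))\<^sup>2)
      = (of_real ((norm x)\<^sup>2 - (\<Sum>i\<in>F. (norm (coords x i))\<^sup>2)) :: 'b)"
    unfolding cinner_self of_real_diff by simp
  then show ?thesis by (simp only: of_real_eq_iff)
qed

lemma norm_trunc_le: "finite F \<Longrightarrow> norm (x - trunc F x) \<le> norm x"
proof (rule power2_le_imp_le)
  assume "finite F"
  then show "(norm (x - trunc F x))\<^sup>2 \<le> (norm x)\<^sup>2"
    unfolding norm_trunc[OF \<open>finite F\<close>] by (simp add: sum_nonneg)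
qed simp

text \<open>A finite net of K needs only finitely many coordinates up to d / 2, and cutting off
  coordinates is a contraction, so the remaining points of K follow. Applied to ranges of norm
  continuous fields, this turns coordinatewise sums into uniformly convergent ones.\<close>

lemma compact_uniform_trunc:
  fixes K :: "('i, 'k::rclike) ell2 set"
  assumes K: "compact K" and d: "d > 0"
  obtains F1 where "finite F1" "\<And>F x. finite F \<Longrightarrow> F1 \<subseteq> F \<Longrightarrow> x \<in> K \<Longrightarrow> norm (x - trunc F x) \<le> d"
proof -
  have d2: "d / 2 > 0" using d by simp
  have cover: "K \<subseteq> (\<Union>y\<in>K. ball y (d / 2))" using d2 by auto
  obtain L where L: "L \<subseteq> K" "finite L" "K \<subseteq> (\<Union>y\<in>L. ball y (d / 2))"
    by (rule compactE_image[OF K open_ball cover]) (rule that)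
  have "\<exists>F. finite F \<and> norm (y - trunc F y) \<le> d / 2" for y :: "('i, 'k) ell2"
  proof -
    obtain F where "finite F" "norm (y - (\<Sum>i\<in>F. ksc (coords y i) (ket i))) \<le> d / 2"
      by (rule ell2_approx[OF d2]) (rule that)
    then show ?thesis by (intro exI[of _ F]) (simp add: trunc_finite)
  qed
  then obtain G where G: "\<And>y :: ('i, 'k) ell2. finite (G y) \<and> norm (y - trunc (G y) y) \<le> d / 2" by metis
  show ?thesis
  proof (rule that)
    show "finite (\<Union>y\<in>L. G y)" using L(2) G by blast
    fix F x assume F: "finite F" "(\<Union>y\<in>L. G y) \<subseteq> F" and "x \<in> K"
    then obtain y where y: "y \<in> L" "dist y x < d / 2" using L(3) by auto
    have "(norm (y - trunc F y))\<^sup>2 \<le> (norm (y - trunc (G y) y))\<^sup>2"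
    proof -
      have "(\<Sum>i\<in>G y. (norm (coords y i))\<^sup>2) \<le> (\<Sum>i\<in>F. (norm (coords y i))\<^sup>2)"
        by (rule sum_mono2[OF F(1)]) (use F(2) y(1) in auto)
      then show ?thesis using norm_trunc[OF F(1), of y] norm_trunc[of "G y" y] G[of y] by simp
    qed
    then have "norm (y - trunc F y) \<le> norm (y - trunc (G y) y)" by (rule power2_le_imp_le) simp
    then have 1: "norm (y - trunc F y) \<le> d / 2" using G[of y] by linarith
    have 2: "norm ((x - y) - trunc F (x - y)) \<le> d / 2"
      using norm_trunc_le[OF F(1), of "x - y"] y(2) by (simp add: dist_norm norm_minus_commute)
    have "x - trunc F x = (y - trunc F y) + ((x - y) - trunc F (x - y))"
      by (simp add: trunc_diff)
    then have "norm (x - trunc F x) \<le> norm (y - trunc F y) + norm ((x - y) - trunc F (x - y))"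
      by (simp only: norm_triangle_ineq)
    with 1 2 show "norm (x - trunc F x) \<le> d" by linarith
  qed
qed

lemma continuous_on_uniform_approx:
  fixes h :: "'a::topological_space \<Rightarrow> 'b::real_normed_vector"
  assumes "\<And>d. d > 0 \<Longrightarrow> \<exists>S. continuous_on A S \<and> (\<forall>t\<in>A. norm (h t - S t) \<le> d)"
  shows "continuous_on A h"
proof -
  have "\<exists>S. continuous_on A S \<and> (\<forall>t\<in>A. norm (h t - S t) \<le> inverse (real (Suc n)))" for n
    by (rule assms) simp
  then obtain S where S: "\<And>n. continuous_on A (S n) \<and> (\<forall>t\<in>A. norm (h t - S n t) \<le> inverse (real (Suc n)))"
    by metis
  have "uniform_limit A S h sequentially"
    unfolding uniform_limit_iff
  proof (intro allI impI)
    fix d :: real assume "d > 0"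
    have "\<forall>\<^sub>F n in sequentially. inverse (real (Suc n)) < d"
      using LIMSEQ_inverse_real_of_nat \<open>d > 0\<close> by (rule order_tendstoD)
    then show "\<forall>\<^sub>F n in sequentially. \<forall>t\<in>A. dist (S n t) (h t) < d"
    proof eventually_elim
      case (elim n)
      show ?case
      proof
        fix t assume "t \<in> A"
        then have "norm (h t - S n t) \<le> inverse (real (Suc n))" using S[of n] by blast
        then show "dist (S n t) (h t) < d" using elim by (simp add: dist_norm norm_minus_commute)
      qed
    qed
  qed
  then show ?thesis
    by (rule uniform_limit_theorem[rotated]) (use S in auto)
qed

lemma (in hyperstonean) weak_sum_uniform:
  fixes f :: "'i \<Rightarrow> 't \<Rightarrow> 'b::{banach, second_countable_topology}"
  assumes f: "\<And>i. i \<in> I \<Longrightarrow> continuous_on UNIV (f i)"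
    and h: "\<And>d. d > 0 \<Longrightarrow> \<exists>F0. finite F0 \<and> F0 \<subseteq> I \<and>
      (\<forall>F. finite F \<longrightarrow> F0 \<subseteq> F \<longrightarrow> F \<subseteq> I \<longrightarrow> (\<forall>t. norm (h t - (\<Sum>i\<in>F. f i t)) \<le> d))"
  shows "weak_sum f h I"
proof -
  have cS: "continuous_on UNIV (\<lambda>t. \<Sum>i\<in>F. f i t)" if "F \<subseteq> I" for F
    using that f by (intro continuous_intros) auto
  have ch: "continuous_on UNIV h"
  proof (rule continuous_on_uniform_approx)
    fix d :: real assume "d > 0"
    from h[OF this] obtain F0 where F0: "finite F0" "F0 \<subseteq> I" "\<forall>t. norm (h t - (\<Sum>i\<in>F0. f i t)) \<le> d"
      by auto
    then show "\<exists>S. continuous_on UNIV S \<and> (\<forall>t\<in>UNIV. norm (h t - S t) \<le> d)"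
      by (intro exI[of _ "\<lambda>t. \<Sum>i\<in>F0. f i t"] conjI cS) auto
  qed
  show ?thesis
    unfolding weak_sum_def
  proof (intro conjI ch allI impI)
    fix M :: "'t measure" assume M: "normal_measure M"
    interpret finite_measure M by (rule normal_measureD(2)[OF M])
    \<comment> \<open>The added 1 keeps d / m usable when the total mass is zero and makes the final
      estimate strict.\<close>
    define m where "m = measure M (space M) + 1"
    have m: "m > 0" by (simp add: m_def add_nonneg_pos)
    show "((\<lambda>i. \<integral>t. f i t \<partial>M) has_sum (\<integral>t. h t \<partial>M)) I"
      unfolding has_sum_def tendsto_iff eventually_finite_subsets_at_top
    proof (intro allI impI)
      fix d :: real assume d: "d > 0"
      then have "d / m > 0" using m by simp
      from h[OF this] obtain F0 where F0: "finite F0" "F0 \<subseteq> I"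
        and near: "\<forall>F. finite F \<longrightarrow> F0 \<subseteq> F \<longrightarrow> F \<subseteq> I \<longrightarrow> (\<forall>t. norm (h t - (\<Sum>i\<in>F. f i t)) \<le> d / m)"
        by auto
      have "dist (\<Sum>i\<in>F. \<integral>t. f i t \<partial>M) (\<integral>t. h t \<partial>M) < d" if F: "finite F" "F0 \<subseteq> F" "F \<subseteq> I" for F
      proof -
        have eq: "(\<Sum>i\<in>F. \<integral>t. f i t \<partial>M) = (\<integral>t. (\<Sum>i\<in>F. f i t) \<partial>M)"
          using F by (intro Bochner_Integration.integral_sum[symmetric] normal_integrable[OF M f]) auto
        have "dist (\<Sum>i\<in>F. \<integral>t. f i t \<partial>M) (\<integral>t. h t \<partial>M) = norm (\<integral>t. h t - (\<Sum>i\<in>F. f i t) \<partial>M)"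
          unfolding eq dist_norm
          by (subst Bochner_Integration.integral_diff)
            (auto intro!: normal_integrable[OF M] ch cS F simp: norm_minus_commute)
        also have "\<dots> \<le> (\<integral>t. norm (h t - (\<Sum>i\<in>F. f i t)) \<partial>M)" by (rule integral_norm_bound)
        also have "\<dots> \<le> (\<integral>t. d / m \<partial>M)"
        proof (rule integral_mono)
          show "integrable M (\<lambda>t. norm (h t - (\<Sum>i\<in>F. f i t)))"
            by (rule normal_integrable[OF M]) (intro continuous_intros ch cS F(3))
          show "norm (h t - (\<Sum>i\<in>F. f i t)) \<le> d / m" for t
            using near[rule_format, OF F] .
        qed simp
        also have "\<dots> = measure M (space M) * (d / m)" by simp
        also have "\<dots> < m * (d / m)"
          by (rule mult_strict_right_mono[OF _ \<open>d / m > 0\<close>]) (simp add: m_def)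
        also have "\<dots> = d" using m by simp
        finally show ?thesis .
      qed
      with F0 show "\<exists>X. finite X \<and> X \<subseteq> I \<and> (\<forall>Y. finite Y \<and> X \<subseteq> Y \<and> Y \<subseteq> I \<longrightarrow>
          dist (\<Sum>i\<in>Y. \<integral>t. f i t \<partial>M) (\<integral>t. h t \<partial>M) < d)"
        by (intro exI[of _ F0]) auto
    qed
  qed
qed

section \<open>The modules\<close>

locale module_family = hyperstonean T for T :: "'t::t2_space itself" +
  fixes I :: "'i set" and p :: "'i \<Rightarrow> ('t \<Rightarrow>\<^sub>C 'k::rclike)"
  assumes proj: "i \<in> I \<Longrightarrow> projection (p i)"
begin

definition fam :: "('i \<Rightarrow> ('t \<Rightarrow>\<^sub>C 'k)) \<Rightarrow> bool"
  where "fam \<xi> \<longleftrightarrow> (\<forall>i\<in>I. \<forall>t. p i t * \<xi> i t = \<xi> i t) \<and> (\<forall>i. i \<notin> I \<longrightarrow> \<xi> i = 0)"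

text \<open>For \<xi> in K this field is bounded, but only its coordinates need be continuous;
  \<open>Hmod_iff\<close> shows that norm continuity singles out H.\<close>

definition vec :: "('i \<Rightarrow> ('t \<Rightarrow>\<^sub>C 'k)) \<Rightarrow> 't \<Rightarrow> ('i, 'k) ell2"
  where "vec \<xi> t = Ell2 (\<lambda>i. \<xi> i t)"

lemma p_idem: "i \<in> I \<Longrightarrow> p i t * p i t = p i t"
  using proj[of i] apply_bcontfun_times[of "p i" "p i" t] by (simp add: projection_def)

lemma range_p: "i \<in> I \<Longrightarrow> x \<in> range ((*) (p i)) \<longleftrightarrow> (\<forall>t. p i t * x t = x t)"
proof
  assume i: "i \<in> I"
  show "\<forall>t. p i t * x t = x t" if x: "x \<in> range ((*) (p i))"
  proof -
    obtain y where "x = p i * y" using x by blast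
    then show ?thesis by (simp add: mult.assoc[symmetric] p_idem[OF i])
  qed
  show "x \<in> range ((*) (p i))" if "\<forall>t. p i t * x t = x t"
    by (rule range_eqI[of _ _ x], rule bcontfun_eqI) (simp add: that)
qed

lemma fam_iff: "fam \<xi> \<longleftrightarrow> (\<forall>i\<in>I. \<xi> i \<in> range ((*) (p i))) \<and> (\<forall>i. i \<notin> I \<longrightarrow> \<xi> i = 0)"
  by (simp add: fam_def range_p)

lemma sum_bstar: "apply_bcontfun (\<Sum>i\<in>F. bstar (\<xi> i) * \<xi> i) t = of_real (\<Sum>i\<in>F. (norm (\<xi> i t))\<^sup>2)"
  by (simp add: mult_kconj_of_real mult.commute[of "kconj _"] del: of_real_power)

lemma Kmod_iff: "\<xi> \<in> Kmod I p \<longleftrightarrow> fam \<xi> \<and>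
    (\<exists>C. \<forall>F t. finite F \<longrightarrow> F \<subseteq> I \<longrightarrow> (\<Sum>i\<in>F. (norm (\<xi> i t))\<^sup>2) \<le> C)"
proof -
  have nb: "norm (\<Sum>i\<in>F. bstar (\<xi> i) * \<xi> i) \<le> C \<longleftrightarrow> (\<forall>t. (\<Sum>i\<in>F. (norm (\<xi> i t))\<^sup>2) \<le> C)" for F C
  proof
    assume C: "norm (\<Sum>i\<in>F. bstar (\<xi> i) * \<xi> i) \<le> C"
    show "\<forall>t. (\<Sum>i\<in>F. (norm (\<xi> i t))\<^sup>2) \<le> C"
    proof
      fix t
      have "norm (of_real (\<Sum>i\<in>F. (norm (\<xi> i t))\<^sup>2) :: 'k) \<le> C"
        using norm_bounded[of "\<Sum>i\<in>F. bstar (\<xi> i) * \<xi> i" t] C unfolding sum_bstar by linarith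
      then show "(\<Sum>i\<in>F. (norm (\<xi> i t))\<^sup>2) \<le> C" by (simp only: norm_of_real)
    qed
  next
    assume C: "\<forall>t. (\<Sum>i\<in>F. (norm (\<xi> i t))\<^sup>2) \<le> C"
    show "norm (\<Sum>i\<in>F. bstar (\<xi> i) * \<xi> i) \<le> C"
      by (rule norm_bound) (unfold sum_bstar, simp only: norm_of_real abs_of_nonneg[OF sum_nonneg] zero_le_power2 C)
  qed
  have "bounded ((\<lambda>F. \<Sum>i\<in>F. bstar (\<xi> i) * \<xi> i) ` {F. finite F \<and> F \<subseteq> I}) \<longleftrightarrow>
      (\<exists>C. \<forall>F\<in>{F. finite F \<and> F \<subseteq> I}. norm (\<Sum>i\<in>F. bstar (\<xi> i) * \<xi> i) \<le> C)"
    unfolding bounded_iff by (simp only: ball_simps)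
  also have "\<dots> \<longleftrightarrow> (\<exists>C. \<forall>F t. finite F \<longrightarrow> F \<subseteq> I \<longrightarrow> (\<Sum>i\<in>F. (norm (\<xi> i t))\<^sup>2) \<le> C)"
    unfolding nb Ball_def mem_Collect_eq by (simp only: imp_conjL all_simps)
  finally show ?thesis
    unfolding Kmod_def mem_Collect_eq fam_iff conj_assoc by (simp only:)
qed

lemma KmodD: "\<xi> \<in> Kmod I p \<Longrightarrow> fam \<xi>" by (simp add: Kmod_iff)

lemma KmodI:
  "fam \<xi> \<Longrightarrow> (\<And>F t. finite F \<Longrightarrow> F \<subseteq> I \<Longrightarrow> (\<Sum>i\<in>F. (norm (\<xi> i t))\<^sup>2) \<le> C) \<Longrightarrow> \<xi> \<in> Kmod I p"
  unfolding Kmod_iff by blast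

lemma Kmod_bound:
  assumes "\<xi> \<in> Kmod I p"
  obtains C where "\<And>F t. finite F \<Longrightarrow> F \<subseteq> I \<Longrightarrow> (\<Sum>i\<in>F. (norm (\<xi> i t))\<^sup>2) \<le> C"
  using assms unfolding Kmod_iff by blast

lemma sum_restrict_I:
  assumes "fam \<xi>" "finite F"
  shows "(\<Sum>i\<in>F. (norm (\<xi> i t))\<^sup>2) = (\<Sum>i\<in>F \<inter> I. (norm (\<xi> i t))\<^sup>2)"
  by (rule sum.mono_neutral_right) (use assms in \<open>auto simp: fam_def\<close>)

lemma coords_vec [simp]:
  assumes "\<xi> \<in> Kmod I p"
  shows "coords (vec \<xi> t) = (\<lambda>i. \<xi> i t)"
  unfolding vec_def
proof (rule coords_Ell2)
  obtain C where C: "\<And>F t. finite F \<Longrightarrow> F \<subseteq> I \<Longrightarrow> (\<Sum>i\<in>F. (norm (\<xi> i t))\<^sup>2) \<le> C"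
    by (rule Kmod_bound[OF assms]) (rule that)
  show "(\<lambda>i. (norm (\<xi> i t))\<^sup>2) summable_on UNIV"
  proof (rule sq_summable_of_bounded)
    fix F :: "'i set" assume "finite F"
    then show "(\<Sum>i\<in>F. (norm (\<xi> i t))\<^sup>2) \<le> C"
      unfolding sum_restrict_I[OF KmodD[OF assms] \<open>finite F\<close>] by (intro C) auto
  qed
qed

lemma supp_in_vec: "\<xi> \<in> Kmod I p \<Longrightarrow> supp_in I (vec \<xi> t)"
  using KmodD[of \<xi>] by (simp add: supp_in_def fam_def)

lemma norm_vec_le:
  assumes \<xi>: "\<xi> \<in> Kmod I p" and c: "0 \<le> c"
    and F: "\<And>F. finite F \<Longrightarrow> F \<subseteq> I \<Longrightarrow> (\<Sum>i\<in>F. (norm (\<xi> i t))\<^sup>2) \<le> c\<^sup>2"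
  shows "norm (vec \<xi> t) \<le> c"
proof (rule norm_ell2_le[OF c])
  fix F :: "'i set" assume "finite F"
  then show "(\<Sum>i\<in>F. (norm (coords (vec \<xi> t) i))\<^sup>2) \<le> c\<^sup>2"
    unfolding coords_vec[OF \<xi>] sum_restrict_I[OF KmodD[OF \<xi>] \<open>finite F\<close>] by (intro F) auto
qed

lemma sum_le_norm_vec:
  "\<xi> \<in> Kmod I p \<Longrightarrow> finite F \<Longrightarrow> (\<Sum>i\<in>F. (norm (\<xi> i t))\<^sup>2) \<le> (norm (vec \<xi> t))\<^sup>2"
  using sum_coords_le[of F "vec \<xi> t"] by simp

lemma cont_bcontfun: "continuous_on S (apply_bcontfun f)"
  by simp

lemma weak_star_iff:
  "has_weak_star_sum (\<lambda>i. bstar (\<eta> i) * \<xi> i) g I \<longleftrightarrow> weak_sum (\<lambda>i t. kconj (\<eta> i t) * \<xi> i t) (apply_bcontfun g) I"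
  by (simp add: has_weak_star_sum_def weak_sum_def)

text \<open>The products are dominated by the sums of the two squared norms, whose partial sums are
  bounded, so the weak* sum exists; its uniqueness evaluates the description
  \<open>mod_inner\<close>.\<close>

lemma inner_weak:
  assumes \<xi>: "\<xi> \<in> Kmod I p" and \<eta>: "\<eta> \<in> Kmod I p"
  shows "weak_sum (\<lambda>i t. kconj (\<eta> i t) * \<xi> i t) (apply_bcontfun (mod_inner I \<xi> \<eta>)) I"
proof -
  obtain C where C: "\<And>F t. finite F \<Longrightarrow> F \<subseteq> I \<Longrightarrow> (\<Sum>i\<in>F. (norm (\<xi> i t))\<^sup>2) \<le> C"
    by (rule Kmod_bound[OF \<xi>]) (rule that)
  obtain D where D: "\<And>F t. finite F \<Longrightarrow> F \<subseteq> I \<Longrightarrow> (\<Sum>i\<in>F. (norm (\<eta> i t))\<^sup>2) \<le> D"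
    by (rule Kmod_bound[OF \<eta>]) (rule that)
  obtain g where g: "weak_sum (\<lambda>i t. kconj (\<eta> i t) * \<xi> i t) g I"
  proof (rule weak_sum_exists[of I "\<lambda>i t. kconj (\<eta> i t) * \<xi> i t" "\<lambda>i t. (norm (\<xi> i t))\<^sup>2 + (norm (\<eta> i t))\<^sup>2" "C + D"])
    show "continuous_on UNIV (\<lambda>t. kconj (\<eta> i t) * \<xi> i t)" for i
      by (intro continuous_intros cont_bcontfun)
    show "continuous_on UNIV (\<lambda>t. (norm (\<xi> i t))\<^sup>2 + (norm (\<eta> i t))\<^sup>2)" for i
      by (intro continuous_intros cont_bcontfun)
    show "norm (kconj (\<eta> i t) * \<xi> i t) \<le> (norm (\<xi> i t))\<^sup>2 + (norm (\<eta> i t))\<^sup>2" for i t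
      using sum_squares_bound[of "norm (\<xi> i t)" "norm (\<eta> i t)"]
        mult_nonneg_nonneg[OF norm_ge_zero norm_ge_zero, of "\<xi> i t" "\<eta> i t"]
      unfolding norm_mult norm_kconj mult.commute[of "norm (\<eta> i t)"] by linarith
    show "(\<Sum>i\<in>F. (norm (\<xi> i t))\<^sup>2 + (norm (\<eta> i t))\<^sup>2) \<le> C + D" if "finite F" "F \<subseteq> I" for F t
      unfolding sum.distrib by (intro add_mono C D that)
  qed (rule that)
  have "continuous_on UNIV g" using g by (simp add: weak_sum_def)
  then have app: "apply_bcontfun (Bcontfun g) = g" by (rule Bcontfun_continuous)
  have "mod_inner I \<xi> \<eta> = Bcontfun g"
    unfolding mod_inner_def weak_star_iff
  proof (rule the_equality)
    show "weak_sum (\<lambda>i t. kconj (\<eta> i t) * \<xi> i t) (apply_bcontfun (Bcontfun g)) I" unfolding app by (rule g)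
    fix h assume h: "weak_sum (\<lambda>i t. kconj (\<eta> i t) * \<xi> i t) (apply_bcontfun h) I"
    show "h = Bcontfun g"
      by (rule bcontfun_eqI) (simp only: app weak_sum_unique[OF h g])
  qed
  then show ?thesis using g app by simp
qed

lemma inner_eqI:
  assumes "\<xi> \<in> Kmod I p" "\<eta> \<in> Kmod I p" "weak_sum (\<lambda>i t. kconj (\<eta> i t) * \<xi> i t) h I"
  shows "mod_inner I \<xi> \<eta> t = h t"
  by (rule weak_sum_unique[OF inner_weak[OF assms(1,2)] assms(3)])

lemma inner_commute:
  assumes "\<xi> \<in> Kmod I p" "\<eta> \<in> Kmod I p"
  shows "mod_inner I \<eta> \<xi> t = kconj (mod_inner I \<xi> \<eta> t)"
proof (rule inner_eqI[OF assms(2,1)])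
  have "weak_sum (\<lambda>i t. kconj (kconj (\<eta> i t) * \<xi> i t)) (\<lambda>t. kconj (mod_inner I \<xi> \<eta> t)) I"
    by (rule weak_sum_bounded_linear[OF inner_weak[OF assms] bounded_linear_kconj])
      (intro continuous_intros cont_bcontfun)
  then show "weak_sum (\<lambda>i t. kconj (\<xi> i t) * \<eta> i t) (\<lambda>t. kconj (mod_inner I \<xi> \<eta> t)) I"
    by (simp add: kconj_mult mult.commute)
qed

lemma mod_norm_nonneg: "0 \<le> mod_norm I \<xi>" by (simp add: mod_norm_def)

text \<open>At single points \<langle>\<xi>|\<xi>\<rangle> may exceed the squared norm of
  \<open>vec \<xi> t\<close>, being only the least continuous upper bound of the partial sums.
  Constants are continuous, however, so both have the same uniform bounds, and the norm of K is the
  supremum of the pointwise norms.\<close>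

lemma mod_norm_vec:
  assumes \<xi>: "\<xi> \<in> Kmod I p"
  shows "norm (vec \<xi> t) \<le> mod_norm I \<xi>"
    and "0 \<le> c \<Longrightarrow> (\<And>t. norm (vec \<xi> t) \<le> c) \<Longrightarrow> mod_norm I \<xi> \<le> c"
proof -
  obtain C where C: "\<And>F t. finite F \<Longrightarrow> F \<subseteq> I \<Longrightarrow> (\<Sum>i\<in>F. (norm (\<xi> i t))\<^sup>2) \<le> C"
    by (rule Kmod_bound[OF \<xi>]) (rule that)
  have cont: "continuous_on UNIV (\<lambda>t. (norm (\<xi> i t))\<^sup>2)" for i
    by (intro continuous_intros cont_bcontfun)
  obtain g where g: "weak_sum (\<lambda>i t. (norm (\<xi> i t))\<^sup>2) g I"
    and g1: "\<And>F t. finite F \<Longrightarrow> F \<subseteq> I \<Longrightarrow> (\<Sum>i\<in>F. (norm (\<xi> i t))\<^sup>2) \<le> g t"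
    and g2: "\<And>t D. (\<And>F s. finite F \<Longrightarrow> F \<subseteq> I \<Longrightarrow> (\<Sum>i\<in>F. (norm (\<xi> i s))\<^sup>2) \<le> D) \<Longrightarrow> g t \<le> D"
  proof (rule weak_sum_nonneg_exists[of I "\<lambda>i t. (norm (\<xi> i t))\<^sup>2" C])
    fix g assume "weak_sum (\<lambda>i t. (norm (\<xi> i t))\<^sup>2) g I"
      "\<And>F t. finite F \<Longrightarrow> F \<subseteq> I \<Longrightarrow> (\<Sum>i\<in>F. (norm (\<xi> i t))\<^sup>2) \<le> g t"
      "\<And>t D. (\<And>F s. finite F \<Longrightarrow> F \<subseteq> I \<Longrightarrow> (\<Sum>i\<in>F. (norm (\<xi> i s))\<^sup>2) \<le> D) \<Longrightarrow> g t \<le> D"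
    then show thesis by (rule that)
  qed (rule cont zero_le_power2 C; assumption?)+
  have g0: "0 \<le> g t" for t using g1[of "{}" t] by simp
  have inner: "mod_inner I \<xi> \<xi> t = of_real (g t)" for t
  proof (rule inner_eqI[OF \<xi> \<xi>])
    have "weak_sum (\<lambda>i t. of_real ((norm (\<xi> i t))\<^sup>2)) (\<lambda>t. of_real (g t) :: 'k) I"
      by (rule weak_sum_bounded_linear[OF g bounded_linear_of_real cont])
    then show "weak_sum (\<lambda>i t. kconj (\<xi> i t) * \<xi> i t) (\<lambda>t. of_real (g t)) I"
      by (simp add: mult_kconj_of_real mult.commute[of "kconj _"] del: of_real_power)
  qed
  have "norm (vec \<xi> t) \<le> mod_norm I \<xi>" for t
  proof (rule norm_vec_le[OF \<xi> mod_norm_nonneg])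
    fix F assume "finite F" "F \<subseteq> I"
    then have "(\<Sum>i\<in>F. (norm (\<xi> i t))\<^sup>2) \<le> g t" by (rule g1)
    also have "g t = norm (mod_inner I \<xi> \<xi> t)" using g0[of t] by (simp add: inner)
    also have "\<dots> \<le> norm (mod_inner I \<xi> \<xi>)" by (rule norm_bounded)
    also have "\<dots> = (mod_norm I \<xi>)\<^sup>2" by (simp add: mod_norm_def)
    finally show "(\<Sum>i\<in>F. (norm (\<xi> i t))\<^sup>2) \<le> (mod_norm I \<xi>)\<^sup>2" .
  qed
  then show "norm (vec \<xi> t) \<le> mod_norm I \<xi>" .
  assume c: "0 \<le> c" "\<And>t. norm (vec \<xi> t) \<le> c"
  have "g t \<le> c\<^sup>2" for t
  proof (rule g2)
    fix F s assume "finite F" "F \<subseteq> I"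
    have "(\<Sum>i\<in>F. (norm (\<xi> i s))\<^sup>2) \<le> (norm (vec \<xi> s))\<^sup>2" by (rule sum_le_norm_vec[OF \<xi> \<open>finite F\<close>])
    also have "\<dots> \<le> c\<^sup>2" by (rule power_mono[OF c(2)]) simp
    finally show "(\<Sum>i\<in>F. (norm (\<xi> i s))\<^sup>2) \<le> c\<^sup>2" .
  qed
  then have "norm (mod_inner I \<xi> \<xi>) \<le> c\<^sup>2"
    by (intro norm_bound) (simp add: inner g0)
  then have "sqrt (norm (mod_inner I \<xi> \<xi>)) \<le> sqrt (c\<^sup>2)" by (rule real_sqrt_le_mono)
  then show "mod_norm I \<xi> \<le> c" using c(1) by (simp add: mod_norm_def)
qed

text \<open>Continuity of one factor on a clopen A is enough: its range there is compact, so
  truncations converge uniformly and the cut-off sum converges uniformly to the pointwise inner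
  product. Uniqueness of weak* sums identifies the two.\<close>

lemma inner_pointwise:
  assumes \<zeta>: "\<zeta> \<in> Kmod I p" and \<eta>: "\<eta> \<in> Kmod I p"
    and A: "open A" "closed A" "t \<in> A" and cont: "continuous_on A (vec \<eta>)"
  shows "mod_inner I \<zeta> \<eta> t = cinner (vec \<zeta> t) (vec \<eta> t)"
proof -
  let ?f = "\<lambda>i t. indicator A t *\<^sub>R (kconj (\<eta> i t) * \<zeta> i t)"
  let ?h = "\<lambda>t. indicator A t *\<^sub>R cinner (vec \<zeta> t) (vec \<eta> t)"
  define z where "z = mod_norm I \<zeta> + 1"
  have z: "z > 0" using mod_norm_nonneg[of \<zeta>] by (simp add: z_def)
  have zb: "norm (vec \<zeta> t) \<le> z" for t using mod_norm_vec(1)[OF \<zeta>, of t] by (simp add: z_def)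
  have cf: "continuous_on UNIV (\<lambda>t. kconj (\<eta> i t) * \<zeta> i t)" for i
    by (intro continuous_intros cont_bcontfun)
  have W: "weak_sum ?f (\<lambda>t. indicator A t *\<^sub>R mod_inner I \<zeta> \<eta> t) I"
    by (rule weak_sum_restrict[OF inner_weak[OF \<zeta> \<eta>] A(1,2) cf])
  have K: "compact (vec \<eta> ` A)"
    by (rule compact_continuous_image[OF cont compact_of_closed[OF A(2)]])
  have H: "weak_sum ?f ?h I"
  proof (rule weak_sum_uniform)
    show "continuous_on UNIV (?f i)" for i
      by (intro continuous_intros continuous_indicator A cont_bcontfun)
    fix d :: real assume "d > 0"
    then have dz: "d / z > 0" using z by simp
    obtain F1 where F1: "finite F1"
      "\<And>F x. finite F \<Longrightarrow> F1 \<subseteq> F \<Longrightarrow> x \<in> vec \<eta> ` A \<Longrightarrow> norm (x - trunc F x) \<le> d / z"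
      by (rule compact_uniform_trunc[OF K dz]) (rule that)
    \<comment> \<open>Indices of F1 outside I may be added to F freely, since \<eta> vanishes
      there.\<close>
    have "norm (?h s - (\<Sum>i\<in>F. ?f i s)) \<le> d" if F: "finite F" "F1 \<inter> I \<subseteq> F" "F \<subseteq> I" for F s
    proof (cases "s \<in> A")
      case True
      let ?G = "F \<union> F1"
      have fG: "finite ?G" using F(1) F1(1) by simp
      have "(\<Sum>i\<in>F. ?f i s) = (\<Sum>i\<in>F. \<zeta> i s * kconj (\<eta> i s))"
        using True by (simp add: mult.commute)
      also have "\<dots> = (\<Sum>i\<in>?G. \<zeta> i s * kconj (\<eta> i s))"
        by (rule sum.mono_neutral_left[OF fG]) (use F(2) KmodD[OF \<eta>] in \<open>auto simp: fam_def\<close>)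
      also have "\<dots> = cinner (vec \<zeta> s) (trunc ?G (vec \<eta> s))"
        unfolding cinner_trunc[OF fG] coords_vec[OF \<zeta>] coords_vec[OF \<eta>] ..
      finally have "?h s - (\<Sum>i\<in>F. ?f i s) = cinner (vec \<zeta> s) (vec \<eta> s - trunc ?G (vec \<eta> s))"
        using True by (simp add: cinner.diff_right)
      also have "norm \<dots> \<le> norm (vec \<zeta> s) * norm (vec \<eta> s - trunc ?G (vec \<eta> s))" by (rule norm_cinner_le)
      also have "\<dots> \<le> z * (d / z)"
        by (intro mult_mono zb F1(2) fG) (use True z in auto)
      finally show ?thesis using z by simp
    next
      case False
      then show ?thesis using \<open>d > 0\<close> by simp
    qed
    then show "\<exists>F0. finite F0 \<and> F0 \<subseteq> I \<and> (\<forall>F. finite F \<longrightarrow> F0 \<subseteq> F \<longrightarrow> F \<subseteq> I \<longrightarrow>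
        (\<forall>t. norm (?h t - (\<Sum>i\<in>F. ?f i t)) \<le> d))"
      by (intro exI[of _ "F1 \<inter> I"] conjI allI impI) (use F1(1) in simp_all)
  qed
  show ?thesis using weak_sum_unique[OF W H, of t] A(3) by simp
qed

lemma inner_pointwise_open:
  assumes \<zeta>: "\<zeta> \<in> Kmod I p" and \<eta>: "\<eta> \<in> Kmod I p"
    and U: "open U" "t \<in> U" and cont: "continuous_on U (vec \<eta>)"
  shows "mod_inner I \<zeta> \<eta> t = cinner (vec \<zeta> t) (vec \<eta> t)"
proof -
  obtain A where A: "open A" "closed A" "t \<in> A" "A \<subseteq> U" by (rule clopen_nbhd[OF U]) (rule that)
  show ?thesis by (rule inner_pointwise[OF \<zeta> \<eta> A(1-3) continuous_on_subset[OF cont A(4)]])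
qed

lemma inner_pointwise_open':
  assumes \<zeta>: "\<zeta> \<in> Kmod I p" and \<eta>: "\<eta> \<in> Kmod I p"
    and U: "open U" "t \<in> U" and cont: "continuous_on U (vec \<zeta>)"
  shows "mod_inner I \<zeta> \<eta> t = cinner (vec \<zeta> t) (vec \<eta> t)"
  using inner_commute[OF \<eta> \<zeta>, of t] inner_pointwise_open[OF \<eta> \<zeta> U cont]
    cinner_commute[of "vec \<zeta> t" "vec \<eta> t"] by simp

text \<open>Norm summability of the squares says that the tails of |\<open>vec \<xi>\<close>|^2 are
  uniformly small, so the field is a uniform limit of its continuous truncations. Conversely a norm
  continuous field has compact range, on which truncations converge uniformly; this is summability,
  with sum |\<open>vec \<xi>\<close>|^2.\<close>

lemma Hmod_iff: "\<xi> \<in> Hmod I p \<longleftrightarrow> \<xi> \<in> Kmod I p \<and> continuous_on UNIV (vec \<xi>)"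
proof
  assume H: "\<xi> \<in> Hmod I p"
  then have fam: "fam \<xi>" by (simp add: Hmod_def fam_iff)
  let ?f = "\<lambda>i. bstar (\<xi> i) * \<xi> i"
  obtain G where "(?f has_sum G) I" using H by (auto simp: Hmod_def summable_on_def)
  then have near: "\<exists>F0. finite F0 \<and> F0 \<subseteq> I \<and>
      (\<forall>F. finite F \<and> F0 \<subseteq> F \<and> F \<subseteq> I \<longrightarrow> dist (sum ?f F) G < d)" if "d > 0" for d
    using that unfolding has_sum_def tendsto_iff eventually_finite_subsets_at_top by blast
  have diff: "norm (sum ?f F t - G t) < d" if "dist (sum ?f F) G < d" for F t d
    using norm_bounded[of "sum ?f F - G" t] that by (simp add: dist_norm)
  have real: "norm (sum ?f F t) = (\<Sum>i\<in>F. (norm (\<xi> i t))\<^sup>2)" for F t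
    unfolding sum_bstar norm_of_real by (rule abs_of_nonneg[OF sum_nonneg]) simp
  have K: "\<xi> \<in> Kmod I p"
  proof -
    obtain F0 where F0: "finite F0" "F0 \<subseteq> I"
      "\<forall>F. finite F \<and> F0 \<subseteq> F \<and> F \<subseteq> I \<longrightarrow> dist (sum ?f F) G < 1"
      using near[of 1] by auto
    show ?thesis
    proof (rule KmodI[OF fam, where C = "norm G + 1"])
      fix F t assume F: "finite F" "F \<subseteq> I"
      have "(\<Sum>i\<in>F. (norm (\<xi> i t))\<^sup>2) \<le> (\<Sum>i\<in>F \<union> F0. (norm (\<xi> i t))\<^sup>2)"
        by (rule sum_mono2) (use F F0 in auto)
      also have "\<dots> = norm (sum ?f (F \<union> F0) t)" by (simp only: real)
      also have "\<dots> \<le> norm (G t) + norm (sum ?f (F \<union> F0) t - G t)" by norm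
      also have "\<dots> \<le> norm G + 1"
        using norm_bounded[of G t] diff[of "F \<union> F0" 1 t] F0(3)[rule_format, of "F \<union> F0"] F F0(1,2)
        by (intro add_mono) (auto intro: less_imp_le)
      finally show "(\<Sum>i\<in>F. (norm (\<xi> i t))\<^sup>2) \<le> norm G + 1" .
    qed
  qed
  moreover have "continuous_on UNIV (vec \<xi>)"
  proof (rule continuous_on_uniform_approx)
    fix d :: real assume d: "d > 0"
    then have "d\<^sup>2 / 2 > 0" by simp
    from near[OF this] obtain F0 where F0: "finite F0" "F0 \<subseteq> I"
      "\<forall>F. finite F \<and> F0 \<subseteq> F \<and> F \<subseteq> I \<longrightarrow> dist (sum ?f F) G < d\<^sup>2 / 2"
      by auto
    have "norm (vec \<xi> t - trunc F0 (vec \<xi> t)) \<le> d" for t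
    proof (rule power2_le_imp_le)
      have "(norm (vec \<xi> t))\<^sup>2 \<le> d\<^sup>2 + (\<Sum>i\<in>F0. (norm (\<xi> i t))\<^sup>2)"
        unfolding norm_ell2_sq coords_vec[OF K]
      proof (rule infsum_le_finite_sums)
        show "(\<lambda>i. (norm (\<xi> i t))\<^sup>2) summable_on UNIV"
          using coords_sq_summable[of "vec \<xi> t" UNIV] by (simp add: K)
        fix F :: "'i set" assume F: "finite F"
        let ?G = "(F \<inter> I) \<union> F0"
        have G: "finite ?G" "F0 \<subseteq> ?G" "?G \<subseteq> I" using F F0 by auto
        have "(\<Sum>i\<in>F. (norm (\<xi> i t))\<^sup>2) \<le> (\<Sum>i\<in>?G. (norm (\<xi> i t))\<^sup>2)"
          unfolding sum_restrict_I[OF fam F] by (rule sum_mono2) (use G in auto)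
        also have "\<dots> = norm (sum ?f ?G t)" by (simp only: real)
        also have "\<dots> \<le> norm (sum ?f F0 t) + (norm (sum ?f ?G t - G t) + norm (sum ?f F0 t - G t))"
          by norm
        also have "norm (sum ?f ?G t - G t) + norm (sum ?f F0 t - G t) \<le> d\<^sup>2 / 2 + d\<^sup>2 / 2"
          using diff[OF F0(3)[rule_format, of ?G], of t] diff[OF F0(3)[rule_format, of F0], of t] G F0(1,2)
          by (intro add_mono) (auto intro: less_imp_le)
        finally show "(\<Sum>i\<in>F. (norm (\<xi> i t))\<^sup>2) \<le> d\<^sup>2 + (\<Sum>i\<in>F0. (norm (\<xi> i t))\<^sup>2)"
          by (simp only: real) simp
      qed
      then show "(norm (vec \<xi> t - trunc F0 (vec \<xi> t)))\<^sup>2 \<le> d\<^sup>2"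
        unfolding norm_trunc[OF F0(1)] coords_vec[OF K] by simp
    qed (use d in simp)
    moreover have "continuous_on UNIV (\<lambda>t. trunc F0 (vec \<xi> t))"
      unfolding trunc_finite[OF F0(1)] coords_vec[OF K]
      by (intro continuous_intros cont_bcontfun)
    ultimately show "\<exists>S. continuous_on UNIV S \<and> (\<forall>t\<in>UNIV. norm (vec \<xi> t - S t) \<le> d)"
      by (intro exI[of _ "\<lambda>t. trunc F0 (vec \<xi> t)"]) auto
  qed
  ultimately show "\<xi> \<in> Kmod I p \<and> continuous_on UNIV (vec \<xi>)" ..
next
  assume "\<xi> \<in> Kmod I p \<and> continuous_on UNIV (vec \<xi>)"
  then have K: "\<xi> \<in> Kmod I p" and cont: "continuous_on UNIV (vec \<xi>)" by auto
  let ?f = "\<lambda>i. bstar (\<xi> i) * \<xi> i"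
  let ?g = "\<lambda>t. of_real ((norm (vec \<xi> t))\<^sup>2) :: 'k"
  have "continuous_on UNIV ?g" by (intro continuous_intros cont)
  then have app: "apply_bcontfun (Bcontfun ?g) = ?g" by (rule Bcontfun_continuous)
  have "(?f has_sum Bcontfun ?g) I"
    unfolding has_sum_def tendsto_iff eventually_finite_subsets_at_top
  proof (intro allI impI)
    fix d :: real assume "d > 0"
    then have sd: "sqrt (d / 2) > 0" by simp
    have cK: "compact (range (vec \<xi>))" by (rule compact_continuous_image[OF cont compact_space])
    obtain F1 where F1: "finite F1"
      "\<And>F x. finite F \<Longrightarrow> F1 \<subseteq> F \<Longrightarrow> x \<in> range (vec \<xi>) \<Longrightarrow> norm (x - trunc F x) \<le> sqrt (d / 2)"
      by (rule compact_uniform_trunc[OF cK sd]) (rule that)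
    have "dist (sum ?f F) (Bcontfun ?g) < d" if F: "finite F" "F1 \<inter> I \<subseteq> F" "F \<subseteq> I" for F
    proof -
      have "dist (sum ?f F t) (Bcontfun ?g t) \<le> d / 2" for t
      proof -
        let ?G = "F \<union> F1"
        have fG: "finite ?G" using F(1) F1(1) by simp
        have "(\<Sum>i\<in>?G. (norm (\<xi> i t))\<^sup>2) = (\<Sum>i\<in>F. (norm (\<xi> i t))\<^sup>2)"
          by (rule sum.mono_neutral_right[OF fG]) (use F KmodD[OF K] in \<open>auto simp: fam_def\<close>)
        then have eq: "(norm (vec \<xi> t - trunc ?G (vec \<xi> t)))\<^sup>2 = (norm (vec \<xi> t))\<^sup>2 - (\<Sum>i\<in>F. (norm (\<xi> i t))\<^sup>2)"
          unfolding norm_trunc[OF fG] coords_vec[OF K] by simp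
        have "dist (sum ?f F t) (Bcontfun ?g t)
            = norm (of_real ((norm (vec \<xi> t))\<^sup>2 - (\<Sum>i\<in>F. (norm (\<xi> i t))\<^sup>2)) :: 'k)"
          unfolding app sum_bstar dist_norm of_real_diff by (rule norm_minus_commute)
        also have "\<dots> = (norm (vec \<xi> t - trunc ?G (vec \<xi> t)))\<^sup>2"
          unfolding eq[symmetric] norm_of_real by simp
        also have "\<dots> \<le> (sqrt (d / 2))\<^sup>2" by (intro power_mono F1(2) fG) auto
        also have "\<dots> = d / 2" using \<open>d > 0\<close> by simp
        finally show ?thesis .
      qed
      then have "dist (sum ?f F) (Bcontfun ?g) \<le> d / 2" by (rule dist_bound)
      then show ?thesis using \<open>d > 0\<close> by simp
    qed
    then show "\<exists>X. finite X \<and> X \<subseteq> I \<and> (\<forall>Y. finite Y \<and> X \<subseteq> Y \<and> Y \<subseteq> I \<longrightarrow> dist (sum ?f Y) (Bcontfun ?g) < d)"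
      by (intro exI[of _ "F1 \<inter> I"] conjI allI impI) (use F1(1) in simp_all)
  qed
  then show "\<xi> \<in> Hmod I p"
    using KmodD[OF K] unfolding Hmod_def fam_iff summable_on_def by auto
qed

lemma HmodD:
  assumes "\<xi> \<in> Hmod I p"
  shows "\<xi> \<in> Kmod I p" "continuous_on UNIV (vec \<xi>)"
  using assms by (auto simp: Hmod_iff)

end

section \<open>Operators on the modules\<close>

lemma zero_of_small:
  fixes x :: "'a::real_normed_vector"
  assumes "\<And>d. d > 0 \<Longrightarrow> norm x \<le> d * c" and "0 \<le> c"
  shows "x = 0"
proof -
  have "norm x \<le> 0"
  proof (rule field_le_epsilon)
    fix e :: real assume "e > 0"
    then have "norm x \<le> e / (c + 1) * c" using assms(2) by (intro assms(1)) simp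
    also have "\<dots> \<le> e" using \<open>e > 0\<close> assms(2) by (simp add: field_simps)
    finally show "norm x \<le> 0 + e" by simp
  qed
  then show ?thesis by simp
qed

text \<open>Membership in \<open>compact_ops\<close> does not mention linearity. For the fibres it
  is obtained here, as additivity and homogeneity up to arbitrarily small errors.\<close>

lemma klinear_of_approx:
  fixes f :: "('i, 'k::rclike) ell2 \<Rightarrow> ('i, 'k) ell2"
  assumes "\<And>d. d > 0 \<Longrightarrow> \<exists>S. (\<forall>c x. blinfun_apply S (ksc c x) = ksc c (S x)) \<and> (\<forall>x. norm (f x - S x) \<le> d * norm x)"
  shows "bounded_linear f" "f (ksc c x) = ksc c (f x)"
proof -
  have add: "f (x + y) = f x + f y" for x y
  proof -
    have "f (x + y) - f x - f y = 0"
    proof (rule zero_of_small)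
      fix d :: real assume "d > 0"
      then obtain S :: "('i, 'k) ell2 \<Rightarrow>\<^sub>L ('i, 'k) ell2" where S: "\<forall>x. norm (f x - S x) \<le> d * norm x"
        using assms[OF \<open>d > 0\<close>] by auto
      have eq: "f (x + y) - f x - f y = (f (x + y) - S (x + y)) - ((f x - S x) + (f y - S y))"
        by (simp add: blinfun.add_right)
      have "norm (f (x + y) - f x - f y) \<le> norm (f (x + y) - S (x + y)) + (norm (f x - S x) + norm (f y - S y))"
        unfolding eq by (rule order_trans[OF norm_triangle_ineq4 add_left_mono[OF norm_triangle_ineq]])
      also have "\<dots> \<le> d * norm (x + y) + (d * norm x + d * norm y)"
        using S by (intro add_mono) auto
      finally show "norm (f (x + y) - f x - f y) \<le> d * (norm (x + y) + norm x + norm y)"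
        by (simp add: algebra_simps)
    qed simp
    then show ?thesis by (simp add: algebra_simps)
  qed
  have mul: "f (ksc c x) = ksc c (f x)" for c x
  proof -
    have "f (ksc c x) - ksc c (f x) = 0"
    proof (rule zero_of_small)
      fix d :: real assume "d > 0"
      then obtain S :: "('i, 'k) ell2 \<Rightarrow>\<^sub>L ('i, 'k) ell2" where S: "\<forall>x. norm (f x - S x) \<le> d * norm x"
        "\<forall>c x. S (ksc c x) = ksc c (S x)"
        using assms[OF \<open>d > 0\<close>] by auto
      have eq: "f (ksc c x) - ksc c (f x) = (f (ksc c x) - S (ksc c x)) - ksc c (f x - S x)"
        using S(2) by (simp add: ksc.diff_right)
      have "norm (f (ksc c x) - ksc c (f x)) \<le> norm (f (ksc c x) - S (ksc c x)) + norm (ksc c (f x - S x))"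
        unfolding eq by (rule norm_triangle_ineq4)
      also have "\<dots> \<le> d * norm (ksc c x) + norm c * (d * norm x)"
        unfolding norm_ksc[of c "f x - S x"]
        by (intro add_mono mult_left_mono S(1)[rule_format]) simp
      finally show "norm (f (ksc c x) - ksc c (f x)) \<le> d * (2 * norm c * norm x)"
        by (simp add: algebra_simps)
    qed simp
    then show ?thesis by simp
  qed
  show "f (ksc c x) = ksc c (f x)" by (rule mul)
  obtain S :: "('i, 'k) ell2 \<Rightarrow>\<^sub>L ('i, 'k) ell2" where S: "\<forall>x. norm (f x - S x) \<le> 1 * norm x"
    using assms[of 1] by auto
  show "bounded_linear f"
  proof (rule bounded_linear_intro[OF add])
    show "f (r *\<^sub>R x) = r *\<^sub>R f x" for r x by (simp only: ksc_of_real[symmetric] mul)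
    show "norm (f x) \<le> norm x * (norm S + 1)" for x
    proof -
      have "norm (f x) \<le> norm (S x) + norm (f x - S x)" by (rule norm_triangle_sub)
      also have "\<dots> \<le> norm S * norm x + 1 * norm x" using S by (intro add_mono norm_blinfun) auto
      finally show ?thesis by (simp add: algebra_simps)
    qed
  qed
qed

lemma rk_sum_apply: "blinfun_apply (rk_sum N a b t) x = (\<Sum>k<N. ksc (cinner x (b k t)) (a k t))"
  by (simp add: rk_sum_def blinfun.sum_left)

lemma rk_sum_ksc: "blinfun_apply (rk_sum N a b t) (ksc c x) = ksc c (rk_sum N a b t x)"
  by (simp add: rk_sum_apply ksc.sum_right)

context module_family
begin

abbreviation "H \<equiv> Hmod I p"
abbreviation "K \<equiv> Kmod I p"

lemma HK: "\<xi> \<in> H \<Longrightarrow> \<xi> \<in> K" by (rule HmodD)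

text \<open>Outside \<open>I\<close> nothing is known about \<open>p\<close>.\<close>

definition pcoef :: "'i \<Rightarrow> 't \<Rightarrow> 'k" where "pcoef i t = (if i \<in> I then p i t else 0)"

lemma fam_pcoef: "fam \<xi> \<Longrightarrow> pcoef i t * \<xi> i t = \<xi> i t"
  by (simp add: fam_def pcoef_def)

lemma famI:
  fixes \<xi> :: "'i \<Rightarrow> ('t \<Rightarrow>\<^sub>C 'k)"
  assumes "\<And>i t. pcoef i t * \<xi> i t = \<xi> i t"
  shows "fam \<xi>"
  unfolding fam_def
proof (intro conjI ballI allI impI)
  show "p i t * \<xi> i t = \<xi> i t" if "i \<in> I" for i t
    using assms[of i t] that by (simp add: pcoef_def)
  show "\<xi> i = 0" if "i \<notin> I" for i
  proof (rule bcontfun_eqI)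
    fix t
    show "\<xi> i t = apply_bcontfun 0 t" using assms[of i t] that by (simp add: pcoef_def)
  qed
qed

lemma fam_zero: "fam 0" by (simp add: fam_def)
lemma fam_add: "fam \<xi> \<Longrightarrow> fam \<eta> \<Longrightarrow> fam (\<xi> + \<eta>)"
  by (rule famI) (simp add: distrib_left fam_pcoef)
lemma fam_diff: "fam \<xi> \<Longrightarrow> fam \<eta> \<Longrightarrow> fam (\<xi> - \<eta>)"
  by (rule famI) (simp add: right_diff_distrib fam_pcoef)
lemma fam_scale: "fam \<xi> \<Longrightarrow> fam (\<lambda>i. a * \<xi> i)"
  by (auto simp: fam_def mult.left_commute intro!: bcontfun_eqI)

lemma K_of_vec:
  assumes "fam \<xi>" and x: "\<And>t i. coords (x t) i = \<xi> i t" and C: "\<And>t. norm (x t) \<le> C"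
  shows "\<xi> \<in> K" "vec \<xi> = x"
proof -
  show "\<xi> \<in> K"
  proof (rule KmodI[OF assms(1)])
    fix F t assume "finite F" "F \<subseteq> I"
    have "(\<Sum>i\<in>F. (norm (\<xi> i t))\<^sup>2) \<le> (norm (x t))\<^sup>2"
      using sum_coords_le[OF \<open>finite F\<close>, of "x t"] by (simp add: x)
    also have "\<dots> \<le> C\<^sup>2" by (rule power_mono[OF C]) simp
    finally show "(\<Sum>i\<in>F. (norm (\<xi> i t))\<^sup>2) \<le> C\<^sup>2" .
  qed
  then show "vec \<xi> = x"
    by (intro ext ell2_eqI) (simp add: x)
qed

lemma H_of_vec:
  assumes "fam \<xi>" and x: "\<And>t i. coords (x t) i = \<xi> i t" and cont: "continuous_on UNIV x"
  shows "\<xi> \<in> H" "vec \<xi> = x"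
proof -
  obtain B where B: "B > 0" "\<And>t. norm (x t) \<le> B" by (rule bounded_of_continuous[OF cont]) (rule that)
  note K = K_of_vec[OF assms(1) x B(2)]
  show "vec \<xi> = x" by (rule K(2))
  then show "\<xi> \<in> H" using K(1) cont by (simp add: Hmod_iff)
qed

lemma vec_eqI: "\<xi> \<in> K \<Longrightarrow> \<eta> \<in> K \<Longrightarrow> (\<And>t. vec \<xi> t = vec \<eta> t) \<Longrightarrow> \<xi> = \<eta>"
proof (intro ext bcontfun_eqI)
  fix i t assume "\<xi> \<in> K" "\<eta> \<in> K" "\<And>t. vec \<xi> t = vec \<eta> t"
  then have "coords (vec \<xi> t) i = coords (vec \<eta> t) i" by simp
  then show "\<xi> i t = \<eta> i t" using \<open>\<xi> \<in> K\<close> \<open>\<eta> \<in> K\<close> by simp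
qed

lemma K_add:
  assumes \<xi>: "\<xi> \<in> K" and \<eta>: "\<eta> \<in> K"
  shows "\<xi> + \<eta> \<in> K" "vec (\<xi> + \<eta>) = (\<lambda>t. vec \<xi> t + vec \<eta> t)"
proof -
  have b: "norm (vec \<xi> t + vec \<eta> t) \<le> mod_norm I \<xi> + mod_norm I \<eta>" for t
    by (rule order_trans[OF norm_triangle_ineq add_mono[OF mod_norm_vec(1)[OF \<xi>] mod_norm_vec(1)[OF \<eta>]]])
  have c: "coords (vec \<xi> t + vec \<eta> t) i = (\<xi> + \<eta>) i t" for t i
    by (simp add: \<xi> \<eta>)
  note R = K_of_vec[OF fam_add[OF KmodD[OF \<xi>] KmodD[OF \<eta>]], of "\<lambda>t. vec \<xi> t + vec \<eta> t", OF c b]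
  show "\<xi> + \<eta> \<in> K" "vec (\<xi> + \<eta>) = (\<lambda>t. vec \<xi> t + vec \<eta> t)" by (rule R)+
qed

lemma K_diff:
  assumes \<xi>: "\<xi> \<in> K" and \<eta>: "\<eta> \<in> K"
  shows "\<xi> - \<eta> \<in> K" "vec (\<xi> - \<eta>) = (\<lambda>t. vec \<xi> t - vec \<eta> t)"
proof -
  have b: "norm (vec \<xi> t - vec \<eta> t) \<le> mod_norm I \<xi> + mod_norm I \<eta>" for t
    by (rule order_trans[OF norm_triangle_ineq4 add_mono[OF mod_norm_vec(1)[OF \<xi>] mod_norm_vec(1)[OF \<eta>]]])
  have c: "coords (vec \<xi> t - vec \<eta> t) i = (\<xi> - \<eta>) i t" for t i
    by (simp add: \<xi> \<eta>)
  note R = K_of_vec[OF fam_diff[OF KmodD[OF \<xi>] KmodD[OF \<eta>]], of "\<lambda>t. vec \<xi> t - vec \<eta> t", OF c b]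
  show "\<xi> - \<eta> \<in> K" "vec (\<xi> - \<eta>) = (\<lambda>t. vec \<xi> t - vec \<eta> t)" by (rule R)+
qed

lemma K_zero: "0 \<in> K" "vec 0 = (\<lambda>t. 0)"
proof -
  have c: "coords (0 :: ('i, 'k) ell2) i = apply_bcontfun ((0 :: 'i \<Rightarrow> ('t \<Rightarrow>\<^sub>C 'k)) i) t" for i t by simp
  have b: "norm (0 :: ('i, 'k) ell2) \<le> 0" by simp
  note R = K_of_vec[OF fam_zero, of "\<lambda>t. 0", OF c b]
  show "0 \<in> K" "vec 0 = (\<lambda>t. 0)" by (rule R)+
qed

lemma K_scale:
  assumes \<xi>: "\<xi> \<in> K"
  shows "(\<lambda>i. a * \<xi> i) \<in> K" "vec (\<lambda>i. a * \<xi> i) = (\<lambda>t. ksc (a t) (vec \<xi> t))"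
proof -
  have b: "norm (ksc (a t) (vec \<xi> t)) \<le> norm a * mod_norm I \<xi>" for t
    unfolding norm_ksc by (intro mult_mono norm_bounded mod_norm_vec(1) \<xi>) auto
  have c: "coords (ksc (a t) (vec \<xi> t)) i = (a * \<xi> i) t" for t i by (simp add: \<xi>)
  note R = K_of_vec[OF fam_scale[OF KmodD[OF \<xi>], of a], of "\<lambda>t. ksc (a t) (vec \<xi> t)", OF c b]
  show "(\<lambda>i. a * \<xi> i) \<in> K" "vec (\<lambda>i. a * \<xi> i) = (\<lambda>t. ksc (a t) (vec \<xi> t))" by (rule R)+
qed

lemma K_sum:
  assumes "\<And>n. n \<in> F \<Longrightarrow> f n \<in> K"
  shows "(\<Sum>n\<in>F. f n) \<in> K" "vec (\<Sum>n\<in>F. f n) = (\<lambda>t. \<Sum>n\<in>F. vec (f n) t)"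
proof -
  have "(\<Sum>n\<in>F. f n) \<in> K \<and> vec (\<Sum>n\<in>F. f n) = (\<lambda>t. \<Sum>n\<in>F. vec (f n) t)"
    using assms
  proof (induction F rule: infinite_finite_induct)
    case (insert n F)
    then have IH: "(\<Sum>n\<in>F. f n) \<in> K" "vec (\<Sum>n\<in>F. f n) = (\<lambda>t. \<Sum>n\<in>F. vec (f n) t)" by auto
    have "f n \<in> K" using insert.prems by simp
    have e1: "(\<Sum>m\<in>insert n F. f m) = f n + (\<Sum>m\<in>F. f m)" by (rule sum.insert) fact+
    have e2: "(\<Sum>m\<in>insert n F. vec (f m) t) = vec (f n) t + (\<Sum>m\<in>F. vec (f m) t)" for t
      by (rule sum.insert) fact+
    show ?case
      unfolding e1 e2 K_add(2)[OF \<open>f n \<in> K\<close> IH(1)] IH(2)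
      by (intro conjI refl K_add(1) \<open>f n \<in> K\<close> IH(1))
  qed (simp_all add: K_zero)
  then show "(\<Sum>n\<in>F. f n) \<in> K" "vec (\<Sum>n\<in>F. f n) = (\<lambda>t. \<Sum>n\<in>F. vec (f n) t)" by auto
qed

lemma inner_H:
  assumes "\<zeta> \<in> K" "\<eta> \<in> H"
  shows "mod_inner I \<zeta> \<eta> t = cinner (vec \<zeta> t) (vec \<eta> t)" "mod_inner I \<eta> \<zeta> t = cinner (vec \<eta> t) (vec \<zeta> t)"
  using inner_pointwise_open[OF assms(1) HK[OF assms(2)] open_UNIV UNIV_I HmodD(2)[OF assms(2)]]
    inner_pointwise_open'[OF HK[OF assms(2)] assms(1) open_UNIV UNIV_I HmodD(2)[OF assms(2)]] by auto

lemma mod_norm_near: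
  assumes "\<xi> \<in> K" "\<eta> \<in> K" "0 \<le> c"
  shows "mod_norm I (\<xi> - \<eta>) \<le> c \<longleftrightarrow> (\<forall>t. norm (vec \<xi> t - vec \<eta> t) \<le> c)"
proof -
  have v: "norm (vec (\<xi> - \<eta>) t) = norm (vec \<xi> t - vec \<eta> t)" for t by (simp add: K_diff[OF assms(1,2)])
  show ?thesis
  proof (intro iffI allI)
    fix t assume "mod_norm I (\<xi> - \<eta>) \<le> c"
    with mod_norm_vec(1)[OF K_diff(1)[OF assms(1,2)], of t]
    show "norm (vec \<xi> t - vec \<eta> t) \<le> c" unfolding v by linarith
  next
    assume "\<forall>t. norm (vec \<xi> t - vec \<eta> t) \<le> c"
    then show "mod_norm I (\<xi> - \<eta>) \<le> c"
      by (intro mod_norm_vec(2)[OF K_diff(1)[OF assms(1,2)] assms(3)]) (simp add: v)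
  qed
qed

definition vrk :: "nat \<Rightarrow> (nat \<Rightarrow> 'i \<Rightarrow> ('t \<Rightarrow>\<^sub>C 'k)) \<Rightarrow> (nat \<Rightarrow> 'i \<Rightarrow> ('t \<Rightarrow>\<^sub>C 'k)) \<Rightarrow> 't
    \<Rightarrow> ('i, 'k) ell2 \<Rightarrow>\<^sub>L ('i, 'k) ell2"
  where "vrk N a b = rk_sum N (\<lambda>k. vec (a k)) (\<lambda>k. vec (b k))"

lemma rank_one_K:
  assumes "\<zeta> \<in> K" "a \<in> K"
  shows "(\<lambda>i. a i * mod_inner I \<zeta> b) \<in> K"
    "vec (\<lambda>i. a i * mod_inner I \<zeta> b) = (\<lambda>t. ksc (mod_inner I \<zeta> b t) (vec a t))"
  using K_scale[OF assms(2), of "mod_inner I \<zeta> b"] by (simp_all add: mult.commute)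

lemma rank_one_sum_vec:
  assumes \<zeta>: "\<zeta> \<in> X" "X = H \<or> X = K" and ab: "\<forall>k<N. a k \<in> H \<and> b k \<in> H"
  shows "rank_one_sum I X N a b \<zeta> \<in> K" "vec (rank_one_sum I X N a b \<zeta>) t = vrk N a b t (vec \<zeta> t)"
proof -
  have K: "\<zeta> \<in> K" using \<zeta> HK by auto
  have eq: "rank_one_sum I X N a b \<zeta> = (\<Sum>k<N. (\<lambda>i. a k i * mod_inner I \<zeta> (b k)))"
    using \<zeta> by (simp add: rank_one_sum_def rank_one_def)
  have mem: "(\<lambda>i. a k i * mod_inner I \<zeta> (b k)) \<in> K" if "k \<in> {..<N}" for k
    using that ab by (intro rank_one_K(1)[OF K] HK) auto
  show "rank_one_sum I X N a b \<zeta> \<in> K" unfolding eq by (rule K_sum(1)[OF mem])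
  have "vec (rank_one_sum I X N a b \<zeta>) t = (\<Sum>k<N. vec (\<lambda>i. a k i * mod_inner I \<zeta> (b k)) t)"
    unfolding eq
    by (rule fun_cong[OF K_sum(2)[of "{..<N}" "\<lambda>k i. a k i * mod_inner I \<zeta> (b k)", OF mem]])
  also have "\<dots> = (\<Sum>k<N. ksc (cinner (vec \<zeta> t) (vec (b k) t)) (vec (a k) t))"
    using ab by (intro sum.cong refl) (simp add: rank_one_K(2)[OF K HK] inner_H[OF K])
  finally show "vec (rank_one_sum I X N a b \<zeta>) t = vrk N a b t (vec \<zeta> t)"
    by (simp add: vrk_def rk_sum_apply)
qed

lemma op_near_K:
  assumes w: "\<And>\<zeta>. \<zeta> \<in> X \<Longrightarrow> w \<zeta> \<in> K" and X: "X = H \<or> X = K" and ab: "\<forall>k<N. a k \<in> H \<and> b k \<in> H"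
    and d: "d > 0"
  shows "op_near I X d w (rank_one_sum I X N a b) \<longleftrightarrow>
    (\<forall>\<zeta>\<in>X. \<forall>t. norm (vec (w \<zeta>) t - vrk N a b t (vec \<zeta> t)) \<le> d * mod_norm I \<zeta>)"
proof -
  have "mod_norm I (w \<zeta> - rank_one_sum I X N a b \<zeta>) \<le> d * mod_norm I \<zeta> \<longleftrightarrow>
      (\<forall>t. norm (vec (w \<zeta>) t - vrk N a b t (vec \<zeta> t)) \<le> d * mod_norm I \<zeta>)" if "\<zeta> \<in> X" for \<zeta>
    using mod_norm_near[OF w[OF that] rank_one_sum_vec(1)[OF that X ab], of "d * mod_norm I \<zeta>"]
      d mod_norm_nonneg[of \<zeta>] by (simp add: rank_one_sum_vec(2)[OF that X ab])
  then show ?thesis unfolding op_near_def by simp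
qed

text \<open>Stronger than \<open>fin_approx\<close> in that the vectors come from H: the fibres then
  take values in the range of the projections at t, and the family acts on K.\<close>

definition happrox :: "('t \<Rightarrow> ('i, 'k) ell2 \<Rightarrow>\<^sub>L ('i, 'k) ell2) \<Rightarrow> bool"
  where "happrox w \<longleftrightarrow> (\<forall>d>0. \<exists>N a b. (\<forall>k<N. a k \<in> H \<and> b k \<in> H) \<and> (\<forall>t. norm (w t - vrk N a b t) \<le> d))"

lemma happroxE:
  assumes "happrox w" "d > 0"
  obtains N a b where "\<forall>k<N. a k \<in> H \<and> b k \<in> H" "\<And>t. norm (w t - vrk N a b t) \<le> d"
proof -
  have "\<exists>N a b. (\<forall>k<N. a k \<in> H \<and> b k \<in> H) \<and> (\<forall>t. norm (w t - vrk N a b t) \<le> d)"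
    using assms by (simp add: happrox_def)
  then show ?thesis by (elim exE conjE) (rule that, assumption, erule spec)
qed

lemma happrox_fin_approx:
  assumes "happrox w"
  shows "fin_approx w"
  unfolding fin_approx_def
proof (intro allI impI)
  fix d :: real assume d: "d > 0"
  obtain N a b where ab: "\<forall>k<N. a k \<in> H \<and> b k \<in> H" "\<And>t. norm (w t - vrk N a b t) \<le> d"
    by (rule happroxE[OF assms d]) (rule that)
  let ?z = "\<lambda>a k. if k < N then vec (a k) else (\<lambda>t. 0)"
  have "rk_sum N (?z a) (?z b) t = vrk N a b t" for t
    unfolding rk_sum_def vrk_def by (rule sum.cong) auto
  moreover have "continuous_on UNIV (?z a k)" "continuous_on UNIV (?z b k)" for k
    using ab(1) by (auto intro: HmodD)
  ultimately show "\<exists>N a b. (\<forall>j. continuous_on UNIV (a j)) \<and> (\<forall>j. continuous_on UNIV (b j)) \<and>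
      (\<forall>t. norm (w t - rk_sum N a b t) \<le> d)"
    using ab(2) by (intro exI[of _ N] exI[of _ "?z a"] exI[of _ "?z b"] conjI allI) simp_all
qed

lemma happrox_adj:
  assumes w: "happrox w" and adj: "\<And>t. cadj (w t) (w' t)"
  shows "happrox w'"
  unfolding happrox_def
proof (intro allI impI)
  fix d :: real assume d: "d > 0"
  obtain N a b where ab: "\<forall>k<N. a k \<in> H \<and> b k \<in> H" "\<And>t. norm (w t - vrk N a b t) \<le> d"
    by (rule happroxE[OF w d]) (rule that)
  have cv: "cadj (vrk N a b t) (vrk N b a t)" for t
    unfolding vrk_def rk_sum_def by (intro cadj_sum cadj_rk)
  have "norm (w' t - vrk N b a t) \<le> d" for t
    by (rule order_trans[OF cadj_norm_le[OF cadj_diff[OF adj cv]] ab(2)])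
  then show "\<exists>N a b. (\<forall>k<N. a k \<in> H \<and> b k \<in> H) \<and> (\<forall>t. norm (w' t - vrk N a b t) \<le> d)"
    using ab(1) by (intro exI[of _ N] exI[of _ b] exI[of _ a]) simp
qed

lemma vrk_range:
  assumes "\<forall>k<N. a k \<in> H \<and> b k \<in> H"
  shows "pcoef i t * coords (vrk N a b t x) i = coords (vrk N a b t x) i"
  using assms unfolding vrk_def rk_sum_apply coords_sum coords_ksc sum_distrib_left
  by (intro sum.cong refl) (simp add: HK mult.left_commute[of "pcoef i t"] fam_pcoef[OF KmodD[OF HK]])

lemma happrox_range:
  assumes "happrox w"
  shows "pcoef i t * coords (w t x) i = coords (w t x) i"
proof -
  have "pcoef i t * coords (w t x) i - coords (w t x) i = 0"
  proof (rule zero_of_small)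
    fix d :: real assume d: "d > 0"
    obtain N a b where ab: "\<forall>k<N. a k \<in> H \<and> b k \<in> H" "\<And>t. norm (w t - vrk N a b t) \<le> d"
      by (rule happroxE[OF assms d]) (rule that)
    let ?e = "coords ((w t - vrk N a b t) x) i"
    have e: "norm ?e \<le> d * norm x"
      using norm_coords_le[of "(w t - vrk N a b t) x" i] norm_blinfun[of "w t - vrk N a b t" x]
        mult_right_mono[OF ab(2)[of t] norm_ge_zero[of x]] by linarith
    have "pcoef i t * coords (w t x) i - coords (w t x) i = pcoef i t * ?e - ?e"
      using vrk_range[OF ab(1), of i t x] by (simp add: blinfun.diff_left algebra_simps)
    then have "norm (pcoef i t * coords (w t x) i - coords (w t x) i) \<le> norm (pcoef i t) * norm ?e + norm ?e"
      using norm_triangle_ineq4[of "pcoef i t * ?e" ?e] by (simp only: norm_mult)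
    also have "\<dots> = (norm (pcoef i t) + 1) * norm ?e" by (simp add: algebra_simps)
    also have "\<dots> \<le> (norm (pcoef i t) + 1) * (d * norm x)" by (intro mult_left_mono e) simp
    finally show "norm (pcoef i t * coords (w t x) i - coords (w t x) i) \<le> d * ((norm (pcoef i t) + 1) * norm x)"
      by (simp add: mult_ac)
  qed simp
  then show ?thesis by simp
qed

definition opK :: "('t \<Rightarrow> ('i, 'k) ell2 \<Rightarrow>\<^sub>L ('i, 'k) ell2) \<Rightarrow> ('i, 't, 'k) mod_op"
  where "opK w = (\<lambda>\<zeta>\<in>K. \<lambda>i. Bcontfun (\<lambda>t. coords (w t (vec \<zeta> t)) i))"

text \<open>The field of \<zeta> in K need not be norm continuous, yet its image is. An approximant
  uses \<zeta> only through the inner products \<langle>\<zeta>|b k\<rangle>, which are continuous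
  functions and, b k being in H, can be computed pointwise.\<close>

lemma opK_vec:
  assumes w: "happrox w" and \<zeta>: "\<zeta> \<in> K"
  shows "opK w \<zeta> \<in> H" "vec (opK w \<zeta>) = (\<lambda>t. w t (vec \<zeta> t))"
proof -
  have cont: "continuous_on UNIV (\<lambda>t. w t (vec \<zeta> t))"
  proof (rule continuous_on_uniform_approx)
    fix d :: real assume "d > 0"
    define m where "m = mod_norm I \<zeta> + 1"
    have m: "m > 0" "\<And>t. norm (vec \<zeta> t) \<le> m"
      using mod_norm_nonneg[of \<zeta>] order_trans[OF mod_norm_vec(1)[OF \<zeta>], of m]
      by (auto simp: m_def)
    have dm: "d / m > 0" using \<open>d > 0\<close> m by simp
    obtain N a b where ab: "\<forall>k<N. a k \<in> H \<and> b k \<in> H" "\<And>t. norm (w t - vrk N a b t) \<le> d / m"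
      by (rule happroxE[OF w dm]) (rule that)
    have eq: "vrk N a b t (vec \<zeta> t) = (\<Sum>k<N. ksc (mod_inner I \<zeta> (b k) t) (vec (a k) t))" for t
      unfolding vrk_def rk_sum_apply using ab(1) by (intro sum.cong refl) (simp add: inner_H[OF \<zeta>])
    have "continuous_on UNIV (\<lambda>t. vrk N a b t (vec \<zeta> t))"
      unfolding eq using ab(1) by (intro continuous_intros cont_bcontfun HmodD(2)) auto
    moreover have "norm (w t (vec \<zeta> t) - vrk N a b t (vec \<zeta> t)) \<le> d" for t
    proof -
      have "norm (w t (vec \<zeta> t) - vrk N a b t (vec \<zeta> t)) = norm ((w t - vrk N a b t) (vec \<zeta> t))"
        by (simp add: blinfun.diff_left)
      also have "\<dots> \<le> norm (w t - vrk N a b t) * norm (vec \<zeta> t)" by (rule norm_blinfun)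
      also have "\<dots> \<le> d / m * m" by (intro mult_mono ab(2) m(2)) (use dm in auto)
      finally show ?thesis using m(1) by simp
    qed
    ultimately show "\<exists>S. continuous_on UNIV S \<and> (\<forall>t\<in>UNIV. norm (w t (vec \<zeta> t) - S t) \<le> d)"
      by (intro exI[of _ "\<lambda>t. vrk N a b t (vec \<zeta> t)"]) simp
  qed
  have app: "apply_bcontfun (opK w \<zeta> i) = (\<lambda>t. coords (w t (vec \<zeta> t)) i)" for i
    unfolding opK_def restrict_apply'[OF \<zeta>]
    by (rule Bcontfun_continuous) (intro continuous_intros cont)
  have fam: "fam (opK w \<zeta>)" by (rule famI) (simp add: app happrox_range[OF w])
  show "opK w \<zeta> \<in> H" "vec (opK w \<zeta>) = (\<lambda>t. w t (vec \<zeta> t))"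
    by (rule H_of_vec[OF fam _ cont]; simp add: app)+
qed

lemma opK_near:
  assumes w: "happrox w" and ab: "\<forall>k<N. a k \<in> H \<and> b k \<in> H" "\<And>t. norm (w t - vrk N a b t) \<le> d"
    and d: "d > 0"
  shows "op_near I K d (opK w) (rank_one_sum I K N a b)"
proof -
  have "norm (vec (opK w \<zeta>) t - vrk N a b t (vec \<zeta> t)) \<le> d * mod_norm I \<zeta>" if "\<zeta> \<in> K" for \<zeta> t
  proof -
    have "norm (vec (opK w \<zeta>) t - vrk N a b t (vec \<zeta> t)) = norm ((w t - vrk N a b t) (vec \<zeta> t))"
      by (simp add: opK_vec(2)[OF w that] blinfun.diff_left)
    also have "\<dots> \<le> norm (w t - vrk N a b t) * norm (vec \<zeta> t)" by (rule norm_blinfun)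
    also have "\<dots> \<le> d * mod_norm I \<zeta>"
      by (intro mult_mono ab(2) mod_norm_vec(1) that) (use d in auto)
    finally show ?thesis .
  qed
  then show ?thesis
    using op_near_K[of K "opK w" N a b d] opK_vec(1)[OF w] HK ab(1) d by simp
qed

lemma opK_compact:
  assumes w: "happrox w" and adj: "\<And>t. cadj (w t) (w' t)"
  shows "opK w \<in> compact_ops I K"
proof -
  note w' = happrox_adj[OF w adj]
  have opK: "opK u \<in> K \<rightarrow>\<^sub>E K" if "happrox u" for u
    using opK_vec(1)[OF that] HK by (auto simp: opK_def)
  have "mod_inner I (opK w \<xi>) \<eta> = mod_inner I \<xi> (opK w' \<eta>)" if "\<xi> \<in> K" "\<eta> \<in> K" for \<xi> \<eta>
    by (rule bcontfun_eqI)
      (simp add: inner_H(2)[OF that(2) opK_vec(1)[OF w that(1)]] inner_H(1)[OF that(1) opK_vec(1)[OF w' that(2)]]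
        opK_vec(2)[OF w that(1)] opK_vec(2)[OF w' that(2)] cadjD[OF adj])
  then have "opK w \<in> adjointable_ops I K"
    unfolding adjointable_ops_def using opK[OF w] opK[OF w'] by blast
  moreover have "\<exists>N a b. (\<forall>k<N. a k \<in> K \<and> b k \<in> K) \<and> op_near I K d (opK w) (rank_one_sum I K N a b)"
    if d: "d > 0" for d
  proof -
    obtain N a b where ab: "\<forall>k<N. a k \<in> H \<and> b k \<in> H" "\<And>t. norm (w t - vrk N a b t) \<le> d"
      by (rule happroxE[OF w d]) (rule that)
    have "op_near I K d (opK w) (rank_one_sum I K N a b)"
      by (rule opK_near[OF w ab d])
    then show ?thesis using ab(1) HK by (intro exI[of _ N] exI[of _ a] exI[of _ b]) auto
  qed
  ultimately show ?thesis by (simp add: compact_ops_def)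
qed

end

section \<open>The fibres of a compact operator\<close>

context module_family
begin

lemma pcoef_01: "pcoef i t = 0 \<or> pcoef i t = 1"
  using p_idem[of i t] by (auto simp: pcoef_def)

lemma continuous_pcoef: "continuous_on UNIV (pcoef i)"
  unfolding pcoef_def by (cases "i \<in> I") simp_all

text \<open>The map \<open>psi\<close> carried over to \<open>ell2\<close>; the truncation is needed
  because p is arbitrary outside I.\<close>

definition ps :: "('i, 'k) ell2 \<Rightarrow> 'i \<Rightarrow> ('t \<Rightarrow>\<^sub>C 'k)"
  where "ps x = psi p (coords (trunc I x))"

lemma ps_coord: "ps x i t = pcoef i t * coords x i"
  by (simp add: ps_def psi_def pcoef_def mult.commute)

lemma norm_ps_coord: "norm (ps x i t) \<le> norm (coords x i)"
  using pcoef_01[of i t] by (auto simp: ps_coord)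

lemma ps_K: "ps x \<in> K"
proof (rule KmodI)
  show "fam (ps x)"
  proof (rule famI)
    show "pcoef i t * ps x i t = ps x i t" for i t
      using pcoef_01[of i t] by (auto simp: ps_coord)
  qed
  fix F t assume "finite F" "F \<subseteq> I"
  have "(\<Sum>i\<in>F. (norm (ps x i t))\<^sup>2) \<le> (\<Sum>i\<in>F. (norm (coords x i))\<^sup>2)"
    by (intro sum_mono power_mono norm_ps_coord) auto
  also have "\<dots> \<le> (norm x)\<^sup>2" by (rule sum_coords_le[OF \<open>finite F\<close>])
  finally show "(\<Sum>i\<in>F. (norm (ps x i t))\<^sup>2) \<le> (norm x)\<^sup>2" .
qed

lemma ps_H: "ps x \<in> H"
proof -
  have "continuous_on UNIV (vec (ps x))"
  proof (rule continuous_on_uniform_approx)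
    fix d :: real assume d: "d > 0"
    obtain F where F: "finite F" "norm (x - (\<Sum>i\<in>F. ksc (coords x i) (ket i))) \<le> d"
      by (rule ell2_approx[OF d]) (rule that)
    have "norm (vec (ps x) t - trunc F (vec (ps x) t)) \<le> d" for t
    proof (rule norm_ell2_le)
      fix G :: "'i set" assume G: "finite G"
      have "(\<Sum>i\<in>G. (norm (coords (vec (ps x) t - trunc F (vec (ps x) t)) i))\<^sup>2)
          \<le> (\<Sum>i\<in>G. (norm (coords (x - trunc F x) i))\<^sup>2)"
        by (intro sum_mono power_mono) (simp_all add: coords_vec[OF ps_K] norm_ps_coord)
      also have "\<dots> \<le> (norm (x - trunc F x))\<^sup>2" by (rule sum_coords_le[OF G])
      also have "\<dots> \<le> d\<^sup>2" unfolding trunc_finite[OF F(1)] by (rule power_mono[OF F(2)]) simp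
      finally show "(\<Sum>i\<in>G. (norm (coords (vec (ps x) t - trunc F (vec (ps x) t)) i))\<^sup>2) \<le> d\<^sup>2" .
    qed (use d in simp)
    moreover have "continuous_on UNIV (\<lambda>t. trunc F (vec (ps x) t))"
      unfolding trunc_finite[OF F(1)] coords_vec[OF ps_K] by (intro continuous_intros cont_bcontfun)
    ultimately show "\<exists>S. continuous_on UNIV S \<and> (\<forall>t\<in>UNIV. norm (vec (ps x) t - S t) \<le> d)"
      by (intro exI[of _ "\<lambda>t. trunc F (vec (ps x) t)"]) simp
  qed
  then show ?thesis using ps_K by (simp add: Hmod_iff)
qed

lemma mod_norm_ps: "mod_norm I (ps x) \<le> norm x"
proof (rule mod_norm_vec(2)[OF HK[OF ps_H] norm_ge_zero], rule norm_vec_le[OF HK[OF ps_H] norm_ge_zero])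
  fix t F assume "finite F" "F \<subseteq> I"
  have "(\<Sum>i\<in>F. (norm (ps x i t))\<^sup>2) \<le> (\<Sum>i\<in>F. (norm (coords x i))\<^sup>2)"
    by (intro sum_mono power_mono norm_ps_coord) auto
  also have "\<dots> \<le> (norm x)\<^sup>2" by (rule sum_coords_le[OF \<open>finite F\<close>])
  finally show "(\<Sum>i\<in>F. (norm (ps x i t))\<^sup>2) \<le> (norm x)\<^sup>2" .
qed

lemma cinner_ps:
  assumes "\<And>i. pcoef i t * coords z i = coords z i"
  shows "cinner (vec (ps x) t) z = cinner x z"
proof -
  have eq: "coords (vec (ps x) t) i * kconj (coords z i) = coords x i * kconj (coords z i)" for i
    using pcoef_01[of i t] assms[of i] by (auto simp: coords_vec[OF HK[OF ps_H]] ps_coord)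
  show ?thesis unfolding cinner_def by (rule infsum_cong) (rule eq)
qed

lemma vrk_ps:
  assumes "\<forall>k<N. a k \<in> H \<and> b k \<in> H"
  shows "vrk N a b t (vec (ps x) t) = vrk N a b t x"
  unfolding vrk_def rk_sum_apply
proof (rule sum.cong[OF refl])
  fix k assume "k \<in> {..<N}"
  then have b: "b k \<in> K" using assms HK by auto
  have "cinner (vec (ps x) t) (vec (b k) t) = cinner x (vec (b k) t)"
    by (rule cinner_ps) (simp add: coords_vec[OF b] fam_pcoef[OF KmodD[OF b]])
  then show "ksc (cinner (vec (ps x) t) (vec (b k) t)) (vec (a k) t) = ksc (cinner x (vec (b k) t)) (vec (a k) t)"
    by simp
qed

definition opv :: "('i, 't, 'k) mod_op \<Rightarrow> 't \<Rightarrow> ('i, 'k) ell2 \<Rightarrow>\<^sub>L ('i, 'k) ell2"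
  where "opv u t = Blinfun (\<lambda>x. vec (u (ps x)) t)"

text \<open>At a zero of r the product is continuous because \<xi> is bounded and r tends to 0,
  whatever \<xi> does there.\<close>

lemma scaled_H:
  assumes \<xi>: "\<xi> \<in> K" and cont: "continuous_on {t. apply_bcontfun r t \<noteq> 0} (vec \<xi>)"
  shows "(\<lambda>i. r * \<xi> i) \<in> H"
proof -
  let ?U = "{t. apply_bcontfun r t \<noteq> 0}"
  have opn: "open ?U" by (intro open_Collect_neq continuous_intros cont_bcontfun)
  have tr: "(apply_bcontfun r \<longlongrightarrow> r t) (at t)" for t
    using cont_bcontfun[of UNIV r] by (simp only: continuous_on_def UNIV_I Ball_def simp_thms)
  have "continuous_on UNIV (\<lambda>t. ksc (r t) (vec \<xi> t))"
    unfolding continuous_on_def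
  proof (intro ballI)
    fix t
    show "((\<lambda>t. ksc (r t) (vec \<xi> t)) \<longlongrightarrow> ksc (r t) (vec \<xi> t)) (at t within UNIV)"
    proof (cases "t \<in> ?U")
      case True
      then have "(vec \<xi> \<longlongrightarrow> vec \<xi> t) (at t within ?U)" using cont by (simp only: continuous_on_def)
      then have "(vec \<xi> \<longlongrightarrow> vec \<xi> t) (at t)" by (simp only: at_within_open[OF True opn])
      then show ?thesis by (intro tendsto_intros tr)
    next
      case False
      have "((\<lambda>s. norm (r s) * mod_norm I \<xi>) \<longlongrightarrow> norm (r t) * mod_norm I \<xi>) (at t)"
        by (intro tendsto_intros tr)
      then have lim: "((\<lambda>s. norm (r s) * mod_norm I \<xi>) \<longlongrightarrow> 0) (at t)" using False by simp
      have "((\<lambda>t. ksc (r t) (vec \<xi> t)) \<longlongrightarrow> 0) (at t)"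
        by (rule Lim_null_comparison[OF always_eventually lim])
          (intro allI, unfold norm_ksc, intro mult_left_mono mod_norm_vec(1)[OF \<xi>] norm_ge_zero)
      then show ?thesis using False by (simp add: ksc.zero_left)
    qed
  qed
  then show ?thesis using K_scale[OF \<xi>, of r] by (simp add: Hmod_iff)
qed

lemma psi_continuous_iff:
  assumes \<xi>: "\<xi> \<in> K"
  shows "(\<forall>s\<in>U. ((\<lambda>t. l2_norm I (psi_at t \<xi> - psi_at s \<xi>)) \<longlongrightarrow> 0) (at s within U)) \<longleftrightarrow> continuous_on U (vec \<xi>)"
proof -
  have eq: "l2_norm I (psi_at t \<xi> - psi_at s \<xi>) = norm (vec \<xi> t - vec \<xi> s)" for t s
  proof -
    have "psi_at t \<xi> - psi_at s \<xi> = coords (vec \<xi> t - vec \<xi> s)"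
      by (rule ext) (simp add: psi_at_def coords_vec[OF \<xi>])
    moreover have "supp_in I (vec \<xi> t - vec \<xi> s)"
      using supp_in_vec[OF \<xi>] by (simp add: supp_in_def)
    ultimately show ?thesis by (simp add: l2_norm_coords)
  qed
  show ?thesis unfolding eq continuous_on_def tendsto_norm_zero_iff LIM_zero_iff by (rule refl)
qed

lemma dense_all:
  assumes "closed {t. P t}" "\<And>t. t \<in> U \<Longrightarrow> P t" "\<And>t. t \<notin> closure U \<Longrightarrow> P t"
  shows "P t"
proof (cases "t \<in> closure U")
  case True
  have "U \<subseteq> {t. P t}" using assms(2) by auto
  then have "closure U \<subseteq> {t. P t}" using assms(1) by (rule closure_minimal)
  with True show ?thesis by auto
qed (rule assms(3))

text \<open>Each coordinate is bounded on U and extends separately. The relation with the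
  projections and the bound on finite partial sums are closed conditions, so they pass to the
  closure of U; norm continuity is not closed in this sense and stays behind on U.\<close>

lemma extend_field:
  assumes U: "open U" and z: "continuous_on U z" and nz: "\<And>t. t \<in> U \<Longrightarrow> norm (z t) \<le> 1"
    and range: "\<And>t i. t \<in> U \<Longrightarrow> pcoef i t * coords (z t) i = coords (z t) i"
  obtains \<xi> where "\<xi> \<in> K" "\<And>t. t \<in> U \<Longrightarrow> vec \<xi> t = z t" "\<And>t. t \<notin> closure U \<Longrightarrow> vec \<xi> t = 0"
proof -
  have "\<exists>F. continuous_on UNIV F \<and> (\<forall>t\<in>U. F t = coords (z t) i) \<and> (\<forall>t. t \<notin> closure U \<longrightarrow> F t = 0)" for i
  proof -
    have c: "continuous_on U (\<lambda>t. coords (z t) i)" by (intro continuous_intros z)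
    have im: "(\<lambda>t. coords (z t) i) ` U \<subseteq> cball 0 1"
      using order_trans[OF norm_coords_le nz] by auto
    obtain F where "continuous_on UNIV F" "\<And>t. t \<in> U \<Longrightarrow> F t = coords (z t) i"
      "\<And>t. t \<notin> closure U \<Longrightarrow> F t = 0"
      by (rule extend_from_open[OF U c im compact_cball, of 0]) (rule that)
    then show ?thesis by (intro exI[of _ F]) simp
  qed
  then obtain F where F: "\<And>i. continuous_on UNIV (F i) \<and> (\<forall>t\<in>U. F i t = coords (z t) i) \<and>
      (\<forall>t. t \<notin> closure U \<longrightarrow> F i t = 0)"
    by metis
  have cF: "continuous_on UNIV (F i)" and FU: "t \<in> U \<Longrightarrow> F i t = coords (z t) i"
    and F0: "t \<notin> closure U \<Longrightarrow> F i t = 0" for i t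
    using F by auto
  define \<xi> where "\<xi> i = Bcontfun (F i)" for i
  have app: "apply_bcontfun (\<xi> i) = F i" for i
    unfolding \<xi>_def by (rule Bcontfun_continuous[OF cF])
  have fam: "fam \<xi>"
  proof (rule famI, unfold app)
    fix i t
    show "pcoef i t * F i t = F i t"
    proof (rule dense_all[of "\<lambda>t. pcoef i t * F i t = F i t" U])
      show "closed {t. pcoef i t * F i t = F i t}"
        by (intro closed_Collect_eq continuous_intros continuous_pcoef cF)
      show "pcoef i t * F i t = F i t" if "t \<in> U" for t using that by (simp only: FU range)
      show "pcoef i t * F i t = F i t" if "t \<notin> closure U" for t using F0[OF that, of i] by simp
    qed
  qed
  have K: "\<xi> \<in> K"
  proof (rule KmodI[OF fam, where C = 1], unfold app)
    fix G t assume G: "finite G" "G \<subseteq> I"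
    show "(\<Sum>i\<in>G. (norm (F i t))\<^sup>2) \<le> 1"
    proof (rule dense_all[of "\<lambda>t. (\<Sum>i\<in>G. (norm (F i t))\<^sup>2) \<le> 1" U])
      show "closed {t. (\<Sum>i\<in>G. (norm (F i t))\<^sup>2) \<le> 1}"
        by (intro closed_Collect_le continuous_intros cF)
      fix t assume t: "t \<in> U"
      have "(\<Sum>i\<in>G. (norm (F i t))\<^sup>2) \<le> (norm (z t))\<^sup>2"
        using sum_coords_le[OF G(1), of "z t"] by (simp add: FU[OF t])
      also have "\<dots> \<le> 1" using nz[OF t] by (simp add: power_le_one)
      finally show "(\<Sum>i\<in>G. (norm (F i t))\<^sup>2) \<le> 1" .
    qed (simp add: F0)
  qed
  show ?thesis
  proof (rule that[OF K])
    show "vec \<xi> t = z t" if "t \<in> U" for t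
      by (rule ell2_eqI) (simp add: coords_vec[OF K] app FU[OF that])
    show "vec \<xi> t = 0" if "t \<notin> closure U" for t
      by (rule ell2_eqI) (simp add: coords_vec[OF K] app F0[OF that])
  qed
qed

end

section \<open>From a compact operator on H to its fibres and to its extension to K\<close>

locale compact_module_op = module_family T I p
  for T :: "'t::t2_space itself" and I :: "'i set" and p :: "'i \<Rightarrow> ('t \<Rightarrow>\<^sub>C 'k::rclike)" +
  fixes u :: "('i, 't, 'k) mod_op"
  assumes u: "u \<in> compact_ops I (Hmod I p)"
begin

lemma u_H: "\<zeta> \<in> H \<Longrightarrow> u \<zeta> \<in> H"
  using u by (auto simp: compact_ops_def adjointable_ops_def)

lemma u_near:
  assumes "d > 0"
  obtains N a b where "\<forall>k<N. a k \<in> H \<and> b k \<in> H" "op_near I H d u (rank_one_sum I H N a b)"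
proof -
  have "\<exists>N a b. (\<forall>k<N. a k \<in> H \<and> b k \<in> H) \<and> op_near I H d u (rank_one_sum I H N a b)"
    using u assms by (simp add: compact_ops_def)
  then show ?thesis by (elim exE conjE) (rule that)
qed

lemma near_vec:
  assumes ab: "\<forall>k<N. a k \<in> H \<and> b k \<in> H" and near: "op_near I H d u (rank_one_sum I H N a b)"
    and d: "d > 0" and \<zeta>: "\<zeta> \<in> H"
  shows "norm (vec (u \<zeta>) t - vrk N a b t (vec \<zeta> t)) \<le> d * mod_norm I \<zeta>"
  using op_near_K[of H u N a b d] near HK[OF u_H] ab d \<zeta> by simp

lemma near_ps:
  assumes ab: "\<forall>k<N. a k \<in> H \<and> b k \<in> H" and near: "op_near I H d u (rank_one_sum I H N a b)"
    and d: "d > 0"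
  shows "norm (vec (u (ps x)) t - vrk N a b t x) \<le> d * norm x"
  using near_vec[OF ab near d ps_H, of x t] mult_left_mono[OF mod_norm_ps[of x], of d] d
  unfolding vrk_ps[OF ab] by linarith

lemma opv_linear:
  shows opv_apply: "opv u t x = vec (u (ps x)) t" and opv_ksc: "opv u t (ksc c x) = ksc c (opv u t x)"
proof -
  have approx: "\<exists>S. (\<forall>c x. blinfun_apply S (ksc c x) = ksc c (S x)) \<and>
      (\<forall>x. norm (vec (u (ps x)) t - S x) \<le> d * norm x)" if d: "d > 0" for d
  proof -
    obtain N a b where ab: "\<forall>k<N. a k \<in> H \<and> b k \<in> H" "op_near I H d u (rank_one_sum I H N a b)"
      by (rule u_near[OF d]) (rule that)
    show ?thesis
    proof (intro exI[of _ "vrk N a b t"] conjI allI)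
      show "vrk N a b t (ksc c x) = ksc c (vrk N a b t x)" for c x
        unfolding vrk_def by (rule rk_sum_ksc)
      show "norm (vec (u (ps x)) t - vrk N a b t x) \<le> d * norm x" for x
        by (rule near_ps[OF ab d])
    qed
  qed
  show app: "opv u t x = vec (u (ps x)) t" for x
    unfolding opv_def by (rule bounded_linear_Blinfun_apply[OF klinear_of_approx(1)[OF approx], THEN fun_cong])
  show "opv u t (ksc c x) = ksc c (opv u t x)"
    unfolding app by (rule klinear_of_approx(2)[OF approx])
qed

lemma opv_near:
  assumes ab: "\<forall>k<N. a k \<in> H \<and> b k \<in> H" and near: "op_near I H d u (rank_one_sum I H N a b)"
    and d: "d > 0"
  shows "norm (opv u t - vrk N a b t) \<le> d"
  by (rule norm_blinfun_bound)
    (use near_ps[OF ab near d] d in \<open>simp_all add: blinfun.diff_left opv_apply\<close>)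

lemma opv_happrox: "happrox (opv u)"
  unfolding happrox_def
proof (intro allI impI)
  fix d :: real assume d: "d > 0"
  obtain N a b where ab: "\<forall>k<N. a k \<in> H \<and> b k \<in> H" "op_near I H d u (rank_one_sum I H N a b)"
    by (rule u_near[OF d]) (rule that)
  show "\<exists>N a b. (\<forall>k<N. a k \<in> H \<and> b k \<in> H) \<and> (\<forall>t. norm (opv u t - vrk N a b t) \<le> d)"
    by (rule exI[of _ N], rule exI[of _ a], rule exI[of _ b], rule conjI[OF ab(1)], rule allI,
        rule opv_near[OF ab d])
qed

lemma opv_reps: "reps I (opv u t) (phi I p t u)"
  unfolding reps_def
proof (intro conjI ballI allI impI)
  show "phi I p t u \<in> extensional (l2 I)" by (simp add: phi_def)
  fix \<zeta> :: "'i \<Rightarrow> 'k" assume \<zeta>: "\<zeta> \<in> l2 I"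
  then have "coords (trunc I (Ell2 \<zeta>)) = \<zeta>" by (auto simp: fun_eq_iff) (auto simp: l2_def)
  then have "ps (Ell2 \<zeta>) = psi p \<zeta>" by (simp add: ps_def)
  moreover have "coords (opv u t (Ell2 \<zeta>)) = (\<lambda>i. u (ps (Ell2 \<zeta>)) i t)"
    unfolding opv_apply by (rule coords_vec[OF HK[OF u_H[OF ps_H]]])
  ultimately show "phi I p t u \<zeta> = coords (opv u t (Ell2 \<zeta>))"
    using \<zeta> by (simp add: phi_def psi_at_def)
next
  show "supp_in I (opv u t x)" for x
    unfolding opv_apply by (rule supp_in_vec[OF HK[OF u_H[OF ps_H]]])
  show "opv u t x = 0" if "\<forall>i\<in>I. coords x i = 0" for x
  proof -
    have "trunc I x = trunc I 0" by (rule ell2_eqI) (use that in simp)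
    then have "opv u t x = opv u t 0" by (simp only: opv_apply ps_def)
    then show ?thesis by (simp add: blinfun.zero_right)
  qed
  show "opv u t (ksc c x) = ksc c (opv u t x)" for c x by (rule opv_ksc)
qed

lemma opv_adj:
  obtains v' where "\<And>t. cadj (opv u t) (v' t)"
proof -
  have "\<exists>B. cadj (opv u t) B" for t
  proof -
    obtain B where "cadj (opv u t) B" by (rule adjoint_exists[OF opv_ksc]) (rule that)
    then show ?thesis ..
  qed
  then show ?thesis using that by metis
qed

text \<open>The approximants of u on H approximate \<open>opK (opv u)\<close> on K with the same
  error, which gives existence. Any other operator sharing its approximants with u agrees with the
  fibres of u at every point.\<close>

lemma compact_incl_opv: "compact_incl I p u = opK (opv u)"
  unfolding compact_incl_def
proof (rule the_equality)
  obtain v' where v': "\<And>t. cadj (opv u t) (v' t)" by (rule opv_adj) (rule that)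
  show "opK (opv u) \<in> compact_ops I K \<and> (\<forall>e>0. \<exists>N \<xi> \<eta>. (\<forall>k<N. \<xi> k \<in> H \<and> \<eta> k \<in> H) \<and>
      op_near I H e u (rank_one_sum I H N \<xi> \<eta>) \<and> op_near I K e (opK (opv u)) (rank_one_sum I K N \<xi> \<eta>))"
  proof (intro conjI allI impI)
    show "opK (opv u) \<in> compact_ops I K" by (rule opK_compact[OF opv_happrox v'])
    fix d :: real assume d: "d > 0"
    obtain N a b where ab: "\<forall>k<N. a k \<in> H \<and> b k \<in> H" "op_near I H d u (rank_one_sum I H N a b)"
      by (rule u_near[OF d]) (rule that)
    show "\<exists>N \<xi> \<eta>. (\<forall>k<N. \<xi> k \<in> H \<and> \<eta> k \<in> H) \<and> op_near I H d u (rank_one_sum I H N \<xi> \<eta>) \<and>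
        op_near I K d (opK (opv u)) (rank_one_sum I K N \<xi> \<eta>)"
      by (rule exI[of _ N], rule exI[of _ a], rule exI[of _ b], rule conjI[OF ab(1)],
          rule conjI[OF ab(2)], rule opK_near[OF opv_happrox ab(1) opv_near[OF ab d] d])
  qed
  fix w assume w: "w \<in> compact_ops I K \<and> (\<forall>e>0. \<exists>N \<xi> \<eta>. (\<forall>k<N. \<xi> k \<in> H \<and> \<eta> k \<in> H) \<and>
      op_near I H e u (rank_one_sum I H N \<xi> \<eta>) \<and> op_near I K e w (rank_one_sum I K N \<xi> \<eta>))"
  then have wE: "w \<in> K \<rightarrow>\<^sub>E K" by (auto simp: compact_ops_def adjointable_ops_def)
  then have wK: "\<zeta> \<in> K \<Longrightarrow> w \<zeta> \<in> K" for \<zeta> by auto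
  have "w \<zeta> = opK (opv u) \<zeta>" if \<zeta>: "\<zeta> \<in> K" for \<zeta>
  proof (rule vec_eqI[OF wK[OF \<zeta>] HK[OF opK_vec(1)[OF opv_happrox \<zeta>]]])
    fix t
    have "vec (w \<zeta>) t - opv u t (vec \<zeta> t) = 0"
    proof (rule zero_of_small)
      fix d :: real assume d: "d > 0"
      have "\<exists>N \<xi> \<eta>. (\<forall>k<N. \<xi> k \<in> H \<and> \<eta> k \<in> H) \<and>
        op_near I H d u (rank_one_sum I H N \<xi> \<eta>) \<and> op_near I K d w (rank_one_sum I K N \<xi> \<eta>)"
        using w d by simp
      then obtain N a b where ab: "\<forall>k<N. a k \<in> H \<and> b k \<in> H" "op_near I H d u (rank_one_sum I H N a b)"
        and near: "op_near I K d w (rank_one_sum I K N a b)"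
        by (elim exE conjE) (rule that)
      let ?S = "vrk N a b t (vec \<zeta> t)"
      have 1: "norm (vec (w \<zeta>) t - ?S) \<le> d * mod_norm I \<zeta>"
        using op_near_K[of K w N a b d] near wK ab(1) d \<zeta> by simp
      have "norm (opv u t (vec \<zeta> t) - ?S) \<le> norm (opv u t - vrk N a b t) * norm (vec \<zeta> t)"
        using norm_blinfun[of "opv u t - vrk N a b t" "vec \<zeta> t"] by (simp add: blinfun.diff_left)
      also have "\<dots> \<le> d * mod_norm I \<zeta>"
        by (intro mult_mono opv_near[OF ab d] mod_norm_vec(1) \<zeta>) (use d in auto)
      finally have "norm (opv u t (vec \<zeta> t) - ?S) \<le> d * mod_norm I \<zeta>" .
      with 1 show "norm (vec (w \<zeta>) t - opv u t (vec \<zeta> t)) \<le> d * (2 * mod_norm I \<zeta>)"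
        using norm_triangle_ineq4[of "vec (w \<zeta>) t - ?S" "opv u t (vec \<zeta> t) - ?S"] by simp
    qed (simp add: mod_norm_nonneg)
    then show "vec (w \<zeta>) t = vec (opK (opv u) \<zeta>) t" by (simp add: opK_vec(2)[OF opv_happrox \<zeta>])
  qed
  moreover have "opK (opv u) \<in> extensional K" by (simp add: opK_def)
  moreover have "w \<in> extensional K" using wE by (simp add: PiE_def)
  ultimately show "w = opK (opv u)" by (intro extensionalityI[of w K]) auto
qed

text \<open>Writing u as the product of an adjoint with w gives \<langle>v x, y\<rangle> =
  \<langle>W x, W y\<rangle> for the fibre v at t, where W x is the value at t of w on the constant
  section of x. Symmetry and nonnegativity follow from this formula alone, without W being an
  operator.\<close>

lemma opv_positive:
  assumes "positive_op I H u"
  shows "cpos (opv u t)"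
proof -
  obtain w where w: "w \<in> adjointable_ops I H" and uw: "u = compose H (mod_adjoint I H w) w"
    using assms by (auto simp: positive_op_def)
  let ?P = "\<lambda>v. v \<in> H \<rightarrow>\<^sub>E H \<and> (\<forall>\<xi>\<in>H. \<forall>\<eta>\<in>H. mod_inner I (w \<xi>) \<eta> = mod_inner I \<xi> (v \<eta>))"
  have wH: "w \<xi> \<in> H" if "\<xi> \<in> H" for \<xi> using w that by (auto simp: adjointable_ops_def)
  obtain w' where w': "?P w'" using w unfolding adjointable_ops_def by blast
  \<comment> \<open>Uniqueness of the adjoint on H: values lie in H, where inner products are
    pointwise, so the difference of two candidates is orthogonal to itself in each fibre.\<close>
  have "v = w'" if v: "?P v" for v
  proof (rule extensionalityI[of _ H])
    show "v \<in> extensional H" "w' \<in> extensional H" using v w' by (auto simp: PiE_def)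
    fix \<eta> assume \<eta>: "\<eta> \<in> H"
    have vH: "v \<eta> \<in> H" "w' \<eta> \<in> H" using v w' \<eta> by auto
    have eq: "cinner (vec \<xi> t) (vec (v \<eta>) t) = cinner (vec \<xi> t) (vec (w' \<eta>) t)" if \<xi>: "\<xi> \<in> H" for \<xi> t
    proof -
      have "mod_inner I \<xi> (v \<eta>) = mod_inner I \<xi> (w' \<eta>)" using v w' \<xi> \<eta> by metis
      then show ?thesis using inner_H(1)[OF HK[OF \<xi>] vH(1), of t] inner_H(1)[OF HK[OF \<xi>] vH(2), of t] by simp
    qed
    show "v \<eta> = w' \<eta>"
    proof (rule vec_eqI[OF HK[OF vH(1)] HK[OF vH(2)]])
      fix t
      let ?d = "vec (v \<eta>) t - vec (w' \<eta>) t"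
      have "cinner ?d ?d = 0"
        using eq[OF vH(1), of t] eq[OF vH(2), of t] by (simp add: cinner.diff_left cinner.diff_right)
      then have "norm ?d = 0" by (simp add: cinner_self)
      then show "vec (v \<eta>) t = vec (w' \<eta>) t" by simp
    qed
  qed
  then have "mod_adjoint I H w = w'"
    unfolding mod_adjoint_def using w' by (intro the_equality) auto
  then have uw': "u \<xi> = w' (w \<xi>)" if "\<xi> \<in> H" for \<xi> using that by (simp add: uw compose_def)
  define W where "W x = vec (w (ps x)) t" for x
  have key: "cinner (opv u t x) y = cinner (W x) (W y)" for x y
  proof -
    have r: "pcoef i t * coords (opv u t x) i = coords (opv u t x) i" for i
      by (rule happrox_range[OF opv_happrox])
    have "cinner (opv u t x) y = cinner (opv u t x) (vec (ps y) t)"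
      using cinner_ps[OF r, of y] cinner_commute[of "opv u t x" y] cinner_commute[of "opv u t x" "vec (ps y) t"]
      by simp
    also have "\<dots> = mod_inner I (u (ps x)) (ps y) t"
      unfolding opv_apply by (rule inner_H(1)[OF HK[OF u_H[OF ps_H]] ps_H, symmetric])
    also have "\<dots> = kconj (mod_inner I (ps y) (w' (w (ps x))) t)"
      unfolding uw'[OF ps_H, symmetric]
      by (rule inner_commute[OF HK[OF ps_H] HK[OF u_H[OF ps_H]]])
    also have "mod_inner I (ps y) (w' (w (ps x))) = mod_inner I (w (ps y)) (w (ps x))"
      using w' ps_H wH[OF ps_H] by simp
    also have "kconj (mod_inner I (w (ps y)) (w (ps x)) t) = cinner (W x) (W y)"
      unfolding inner_H(1)[OF HK[OF wH[OF ps_H]] wH[OF ps_H]] W_def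
      by (rule cinner_commute[symmetric])
    finally show ?thesis .
  qed
  have "cadj (opv u t) (opv u t)"
    unfolding cadj_def
  proof (intro allI)
    fix x y
    have "cinner x (opv u t y) = kconj (cinner (opv u t y) x)" by (rule cinner_commute)
    also have "\<dots> = cinner (W x) (W y)" unfolding key by (rule cinner_commute[symmetric])
    finally show "cinner (opv u t x) y = cinner x (opv u t y)" by (simp add: key)
  qed
  moreover have "0 \<le> opv u t x \<bullet> x" for x
  proof -
    have "opv u t x \<bullet> x = W x \<bullet> W x" by (simp only: cinner_one[symmetric] key)
    then show ?thesis by simp
  qed
  ultimately show ?thesis by (simp add: cpos_def)
qed

end

section \<open>The decomposition\<close>

locale svd_module = compact_module_op T I p u
  for T :: "'t::t2_space itself" and I :: "'i set" and p :: "'i \<Rightarrow> ('t \<Rightarrow>\<^sub>C 'k::rclike)"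
    and u :: "('i, 't, 'k) mod_op" +
  fixes s :: "nat \<Rightarrow> 't \<Rightarrow> real" and x y :: "nat \<Rightarrow> 't \<Rightarrow> ('i, 'k) ell2"
  assumes svd: "svd_at (opv u t) (\<lambda>n. s n t) (\<lambda>n. x n t) (\<lambda>n. y n t)"
    and cs: "continuous_on UNIV (s n)"
    and cx: "continuous_on {t. s n t \<noteq> 0} (x n)" and cy: "continuous_on {t. s n t \<noteq> 0} (y n)"
    and decay: "d > 0 \<Longrightarrow> \<exists>n. \<forall>t. s n t \<le> d"
begin

lemma s_nonneg: "0 \<le> s n t" by (rule svd_atD(2)[OF svd])

lemma s_tendsto: "(\<lambda>n. s n t) \<longlonglongrightarrow> 0"
proof (rule LIMSEQ_I)
  fix d :: real assume "d > 0"
  then obtain m where m: "\<forall>t. s m t \<le> d / 2" using decay[of "d / 2"] by auto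
  have "norm (s n t - 0) < d" if "n \<ge> m" for n
  proof -
    have "s n t \<le> s m t" by (rule decseqD[OF svd_atD(1)[OF svd] that])
    also have "\<dots> \<le> d / 2" using m by blast
    finally show ?thesis using s_nonneg[of n t] \<open>d > 0\<close> by simp
  qed
  then show "\<exists>m. \<forall>n\<ge>m. norm (s n t - 0) < d" by blast
qed

lemma singular_value_s: "singular_value I n (phi I p t u) = s (n - 1) t"
  unfolding singular_value_def singular_values_svd[OF svd s_tendsto opv_reps] ..

lemma U_set_s: "U_set I p n u = {t. s (n - 1) t \<noteq> 0}"
  by (simp add: U_set_def singular_value_s)

lemma open_U: "open (U_set I p n u)"
  unfolding U_set_s by (intro open_Collect_neq continuous_intros cs)

lemma theta_s: "apply_bcontfun (theta I p n u) t = of_real (s (n - 1) t)"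
proof -
  have "continuous_on UNIV (\<lambda>t. of_real (s (n - 1) t) :: 'k)" by (intro continuous_intros cs)
  then show ?thesis by (simp add: theta_def singular_value_s Bcontfun_continuous)
qed

lemma e_fun_indicator: "apply_bcontfun (e_fun I p n u) t = indicator (closure (U_set I p n u)) t"
  unfolding e_fun_def
  by (subst Bcontfun_continuous[OF continuous_indicator[OF open_closure[OF open_U] closed_closure]]) (rule refl)

text \<open>The fibre vectors z are numbered from 0, the module vectors \<xi> from 1. On the
  boundary of U_n nothing is prescribed; there the values come from continuity of the
  coordinates.\<close>

definition realizes :: "(nat \<Rightarrow> 't \<Rightarrow> ('i, 'k) ell2) \<Rightarrow> (nat \<Rightarrow> 'i \<Rightarrow> ('t \<Rightarrow>\<^sub>C 'k)) \<Rightarrow> bool"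
  where "realizes z \<xi> \<longleftrightarrow> (\<forall>n. \<xi> n \<in> K \<and> (\<forall>t\<in>U_set I p n u. vec (\<xi> n) t = z (n - 1) t) \<and>
    (\<forall>t. t \<notin> closure (U_set I p n u) \<longrightarrow> vec (\<xi> n) t = 0))"

lemma realizes_exists:
  assumes cz: "\<And>n. continuous_on {t. s n t \<noteq> 0} (z n)" and oz: "\<And>t. oz (\<lambda>n. z n t)"
    and range: "\<And>n t i. s n t \<noteq> 0 \<Longrightarrow> pcoef i t * coords (z n t) i = coords (z n t) i"
  obtains \<xi> where "realizes z \<xi>"
proof -
  have "\<exists>\<eta>. \<eta> \<in> K \<and> (\<forall>t\<in>U_set I p n u. vec \<eta> t = z (n - 1) t) \<and>
    (\<forall>t. t \<notin> closure (U_set I p n u) \<longrightarrow> vec \<eta> t = 0)" for n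
  proof -
    have c: "continuous_on (U_set I p n u) (z (n - 1))" unfolding U_set_s by (rule cz)
    have b: "norm (z (n - 1) t) \<le> 1" for t by (rule oz_norm_le[OF oz])
    have r: "pcoef i t * coords (z (n - 1) t) i = coords (z (n - 1) t) i" if "t \<in> U_set I p n u" for t i
      using that by (intro range) (simp add: U_set_s)
    obtain \<eta> where "\<eta> \<in> K" "\<And>t. t \<in> U_set I p n u \<Longrightarrow> vec \<eta> t = z (n - 1) t"
      "\<And>t. t \<notin> closure (U_set I p n u) \<Longrightarrow> vec \<eta> t = 0"
      by (rule extend_field[OF open_U c b r]) (assumption | rule that)+
    then show ?thesis by blast
  qed
  then have "\<exists>\<xi>. realizes z \<xi>" unfolding realizes_def by (rule choice[OF allI])
  then show ?thesis using that by blast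
qed

text \<open>Where s is nonzero, x is a multiple of a value of the fibre and so lies in the range of
  the projections at t; for y the same holds with the adjoint fibre.\<close>

lemma realizes_x: obtains \<xi> where "realizes x \<xi>"
proof (rule realizes_exists[OF cx svd_atD(3)[OF svd]])
  fix n t i assume "s n t \<noteq> 0"
  then have "x n t = (1 / s n t) *\<^sub>R opv u t (y n t)" by (simp add: svd_atD(7)[OF svd])
  then show "pcoef i t * coords (x n t) i = coords (x n t) i"
    using happrox_range[OF opv_happrox, of i t "y n t"] by simp
qed (rule that)

lemma realizes_y: obtains \<xi> where "realizes y \<xi>"
proof (rule realizes_exists[OF cy svd_atD(4)[OF svd]])
  obtain v' where v': "\<And>t. cadj (opv u t) (v' t)" by (rule opv_adj) (rule that)
  fix n t i assume "s n t \<noteq> 0"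
  then have "y n t = (1 / s n t) *\<^sub>R v' t (x n t)" by (simp add: svd_at_adj[OF svd v'])
  then show "pcoef i t * coords (y n t) i = coords (y n t) i"
    using happrox_range[OF happrox_adj[OF opv_happrox v'], of i t "x n t"] by simp
qed (rule that)

lemma realizes_continuous:
  assumes r: "realizes z \<xi>" and cz: "\<And>n. continuous_on {t. s n t \<noteq> 0} (z n)"
  shows "continuous_on (U_set I p n u) (vec (\<xi> n))"
proof (rule continuous_on_eq)
  show "continuous_on (U_set I p n u) (z (n - 1))" unfolding U_set_s by (rule cz)
qed (use r in \<open>simp add: realizes_def\<close>)

lemma U_set_antimono: "m \<le> n \<Longrightarrow> U_set I p n u \<subseteq> U_set I p m u"
proof
  fix t assume "m \<le> n" "t \<in> U_set I p n u"
  then have "s (n - 1) t \<le> s (m - 1) t" by (intro decseqD[OF svd_atD(1)[OF svd]]) simp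
  with \<open>t \<in> U_set I p n u\<close> show "t \<in> U_set I p m u"
    using s_nonneg[of "n - 1" t] by (auto simp: U_set_s)
qed

text \<open>Both sides are continuous functions of t, so it suffices to compare them on U_n and off
  its closure. On U_n, which is contained in U_m for m \<le> n, the inner product is pointwise
  because \<xi> n is norm continuous there; off the closure \<xi> n vanishes.\<close>

lemma realizes_orthonormal:
  assumes r: "realizes z \<xi>" and cz: "\<And>n. continuous_on {t. s n t \<noteq> 0} (z n)"
    and oz: "\<And>t. oz (\<lambda>n. z n t)" and nz: "\<And>n t. z n t \<noteq> 0 \<longleftrightarrow> s n t \<noteq> 0"
  shows "u_orthonormal I p u \<xi>"
  unfolding u_orthonormal_def
proof (intro conjI)
  have K: "\<xi> n \<in> K" for n using r by (simp add: realizes_def)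
  have zU: "vec (\<xi> n) t = z (n - 1) t" if "t \<in> U_set I p n u" for n t
    using r that by (simp add: realizes_def)
  have z0: "vec (\<xi> n) t = 0" if "t \<notin> closure (U_set I p n u)" for n t
    using r that by (simp add: realizes_def)
  show "\<forall>n\<ge>1. \<xi> n \<in> K" using K by simp
  show "\<forall>n\<ge>1. \<forall>s\<in>U_set I p n u. ((\<lambda>t. l2_norm I (psi_at t (\<xi> n) - psi_at s (\<xi> n))) \<longlongrightarrow> 0) (at s within U_set I p n u)"
    unfolding psi_continuous_iff[OF K] using realizes_continuous[OF r cz] by simp
  show "\<forall>m\<ge>1. \<forall>n\<ge>m. mod_inner I (\<xi> m) (\<xi> n) = (if m = n then e_fun I p n u else 0)"
  proof (intro allI impI, rule bcontfun_eqI)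
    fix m n :: nat and t assume mn: "1 \<le> m" "m \<le> n"
    let ?U = "U_set I p n u"
    let ?r = "apply_bcontfun (if m = n then e_fun I p n u else 0)"
    show "mod_inner I (\<xi> m) (\<xi> n) t = ?r t"
    proof (rule dense_all[of "\<lambda>t. mod_inner I (\<xi> m) (\<xi> n) t = ?r t" ?U])
      show "closed {t. mod_inner I (\<xi> m) (\<xi> n) t = ?r t}"
        by (intro closed_Collect_eq cont_bcontfun)
      fix t assume t: "t \<in> ?U"
      have tm: "t \<in> U_set I p m u" using U_set_antimono[OF mn(2)] t by blast
      have "mod_inner I (\<xi> m) (\<xi> n) t = cinner (vec (\<xi> m) t) (vec (\<xi> n) t)"
        by (rule inner_pointwise_open[OF K K open_U t realizes_continuous[OF r cz]])
      also have "\<dots> = cinner (z (m - 1) t) (z (n - 1) t)" by (simp add: zU[OF t] zU[OF tm])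
      also have "\<dots> = (if m - 1 = n - 1 \<and> z (n - 1) t \<noteq> 0 then 1 else 0)" by (rule ozD[OF oz])
      also have "\<dots> = ?r t"
        using mn t subsetD[OF closure_subset t] by (auto simp: nz U_set_s e_fun_indicator)
      finally show "mod_inner I (\<xi> m) (\<xi> n) t = ?r t" .
    next
      fix t assume t: "t \<notin> closure ?U"
      have c0: "continuous_on (- closure ?U) (vec (\<xi> n))"
        by (rule continuous_on_eq[of _ "\<lambda>_. 0"]) (simp_all add: z0)
      have tt: "t \<in> - closure ?U" using t by simp
      have opn: "open (- closure ?U)" by (rule open_Compl[OF closed_closure])
      have "mod_inner I (\<xi> m) (\<xi> n) t = 0"
        unfolding inner_pointwise_open[OF K K opn tt c0] z0[OF t] by (rule cinner.zero_right)
      then show "mod_inner I (\<xi> m) (\<xi> n) t = ?r t" using t by (simp add: e_fun_indicator)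
    qed
  qed
qed

text \<open>On U_n the vector \<eta> n is norm continuous and its inner products are pointwise; off
  U_n the factor \<theta> makes both sides zero.\<close>

lemma term_vec:
  assumes r: "realizes x \<xi>" "realizes y \<eta>" and \<zeta>: "\<zeta> \<in> K"
  shows "scale_op K (theta I p n u) (rank_one I K (\<xi> n) (\<eta> n)) \<zeta> \<in> K"
    "vec (scale_op K (theta I p n u) (rank_one I K (\<xi> n) (\<eta> n)) \<zeta>) t
      = s (n - 1) t *\<^sub>R ksc (cinner (vec \<zeta> t) (y (n - 1) t)) (x (n - 1) t)"
proof -
  have K: "\<xi> n \<in> K" "\<eta> n \<in> K" using r by (simp_all add: realizes_def)
  have eq: "scale_op K (theta I p n u) (rank_one I K (\<xi> n) (\<eta> n)) \<zeta>
      = (\<lambda>i. theta I p n u * (\<lambda>i. \<xi> n i * mod_inner I \<zeta> (\<eta> n)) i)"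
    using \<zeta> by (simp add: scale_op_def rank_one_def)
  note R = rank_one_K[OF \<zeta> K(1), of "\<eta> n"]
  show "scale_op K (theta I p n u) (rank_one I K (\<xi> n) (\<eta> n)) \<zeta> \<in> K"
    unfolding eq by (rule K_scale(1)[OF R(1)])
  have v: "vec (scale_op K (theta I p n u) (rank_one I K (\<xi> n) (\<eta> n)) \<zeta>) t
      = s (n - 1) t *\<^sub>R ksc (mod_inner I \<zeta> (\<eta> n) t) (vec (\<xi> n) t)"
    unfolding eq K_scale(2)[OF R(1)] R(2) theta_s ksc_of_real ..
  show "vec (scale_op K (theta I p n u) (rank_one I K (\<xi> n) (\<eta> n)) \<zeta>) t
      = s (n - 1) t *\<^sub>R ksc (cinner (vec \<zeta> t) (y (n - 1) t)) (x (n - 1) t)"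
  proof (cases "t \<in> U_set I p n u")
    case True
    have "mod_inner I \<zeta> (\<eta> n) t = cinner (vec \<zeta> t) (vec (\<eta> n) t)"
      by (rule inner_pointwise_open[OF \<zeta> K(2) open_U True realizes_continuous[OF r(2) cy]])
    then show ?thesis using True r unfolding v by (simp add: realizes_def)
  next
    case False
    then show ?thesis unfolding v by (simp add: U_set_s)
  qed
qed

text \<open>The vectors \<xi> n and \<eta> n lie only in K, so the rank one operator is not directly
  of the form required for \<open>happrox\<close>. Distributing \<theta> as two square roots
  multiplies each vector by a function vanishing off U_n, which moves both into H.\<close>

lemma term_compact:
  assumes r: "realizes x \<xi>" "realizes y \<eta>"
  shows "scale_op K (theta I p n u) (rank_one I K (\<xi> n) (\<eta> n)) \<in> compact_ops I K"
proof -
  have K: "\<xi> n \<in> K" "\<eta> n \<in> K" using r by (simp_all add: realizes_def)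
  define q where "q = Bcontfun (\<lambda>t. of_real (sqrt (s (n - 1) t)) :: 'k)"
  have "continuous_on UNIV (\<lambda>t. of_real (sqrt (s (n - 1) t)) :: 'k)" by (intro continuous_intros cs)
  then have q: "apply_bcontfun q = (\<lambda>t. of_real (sqrt (s (n - 1) t)))"
    unfolding q_def by (rule Bcontfun_continuous)
  have qU: "{t. apply_bcontfun q t \<noteq> 0} = U_set I p n u"
    by (auto simp: q U_set_s)
  define a where "a = (\<lambda>i. q * \<xi> n i)"
  define b where "b = (\<lambda>i. q * \<eta> n i)"
  have aH: "a \<in> H"
    unfolding a_def by (rule scaled_H[OF K(1)]) (unfold qU, rule realizes_continuous[OF r(1) cx])
  have bH: "b \<in> H"
    unfolding b_def by (rule scaled_H[OF K(2)]) (unfold qU, rule realizes_continuous[OF r(2) cy])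
  have ab: "\<forall>k<1::nat. a \<in> H \<and> b \<in> H" "\<forall>k<1::nat. b \<in> H \<and> a \<in> H" using aH bH by auto
  define w where "w = vrk 1 (\<lambda>_. a) (\<lambda>_. b)"
  have wr: "w t = rk (vec a t) (vec b t)" for t by (simp add: w_def vrk_def rk_sum_def)
  have hw: "happrox w"
    unfolding happrox_def
  proof (intro allI impI)
    fix d :: real assume d: "d > 0"
    have near: "norm (w t - vrk 1 (\<lambda>_. a) (\<lambda>_. b) t) \<le> d" for t using d by (simp add: w_def)
    show "\<exists>N a b. (\<forall>k<N. a k \<in> H \<and> b k \<in> H) \<and> (\<forall>t. norm (w t - vrk N a b t) \<le> d)"
      by (rule exI[of _ 1], rule exI[of _ "\<lambda>_. a"], rule exI[of _ "\<lambda>_. b"], rule conjI[OF ab(1)],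
          rule allI, rule near)
  qed
  have adj: "cadj (w t) (rk (vec b t) (vec a t))" for t unfolding wr by (rule cadj_rk)
  have "scale_op K (theta I p n u) (rank_one I K (\<xi> n) (\<eta> n)) = opK w"
  proof (rule extensionalityI[of _ K])
    show "scale_op K (theta I p n u) (rank_one I K (\<xi> n) (\<eta> n)) \<in> extensional K"
      by (simp add: scale_op_def)
    show "opK w \<in> extensional K" by (simp add: opK_def)
    fix \<zeta> assume \<zeta>: "\<zeta> \<in> K"
    show "scale_op K (theta I p n u) (rank_one I K (\<xi> n) (\<eta> n)) \<zeta> = opK w \<zeta>"
    proof (rule vec_eqI[OF term_vec(1)[OF r \<zeta>] HK[OF opK_vec(1)[OF hw \<zeta>]]])
      fix t
      have va: "vec a t = sqrt (s (n - 1) t) *\<^sub>R vec (\<xi> n) t"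
        and vb: "vec b t = sqrt (s (n - 1) t) *\<^sub>R vec (\<eta> n) t"
        unfolding a_def b_def K_scale(2)[OF K(1)] K_scale(2)[OF K(2)] q ksc_of_real by (rule refl)+
      have "vec (opK w \<zeta>) t = ksc (cinner (vec \<zeta> t) (vec b t)) (vec a t)"
        by (simp add: opK_vec(2)[OF hw \<zeta>] wr)
      also have "\<dots> = s (n - 1) t *\<^sub>R ksc (cinner (vec \<zeta> t) (vec (\<eta> n) t)) (vec (\<xi> n) t)"
        by (simp add: va vb cinner.scaleR_right ksc.scaleR_left ksc.scaleR_right s_nonneg)
      also have "\<dots> = s (n - 1) t *\<^sub>R ksc (cinner (vec \<zeta> t) (y (n - 1) t)) (x (n - 1) t)"
        using r by (cases "t \<in> U_set I p n u") (simp_all add: realizes_def U_set_s)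
      also have "\<dots> = vec (scale_op K (theta I p n u) (rank_one I K (\<xi> n) (\<eta> n)) \<zeta>) t"
        by (rule term_vec(2)[OF r \<zeta>, symmetric])
      finally show "vec (scale_op K (theta I p n u) (rank_one I K (\<xi> n) (\<eta> n)) \<zeta>) t = vec (opK w \<zeta>) t"
        by (rule sym)
    qed
  qed
  then show ?thesis using opK_compact[OF hw adj] by simp
qed

text \<open>Uniform decay provides m with s m at most d on all of T. Every finite F containing 1,
  ..., m then leaves a remainder of norm at most s m t in each fibre, and pointwise bounds are
  bounds in the operator norm.\<close>

theorem decomposition:
  assumes r: "realizes x \<xi>" "realizes y \<eta>"
  shows "compact_has_sum I K (\<lambda>n. scale_op K (theta I p n u) (rank_one I K (\<xi> n) (\<eta> n)))
    (compact_incl I p u) {1..}"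
  unfolding compact_has_sum_def compact_incl_opv
proof (intro conjI ballI allI impI)
  obtain v' where v': "\<And>t. cadj (opv u t) (v' t)" by (rule opv_adj) (rule that)
  show "opK (opv u) \<in> compact_ops I K" by (rule opK_compact[OF opv_happrox v'])
  show "scale_op K (theta I p n u) (rank_one I K (\<xi> n) (\<eta> n)) \<in> compact_ops I K" for n
    by (rule term_compact[OF r])
  fix d :: real assume "d > 0"
  then obtain m where m: "\<forall>t. s m t \<le> d" using decay by blast
  let ?f = "\<lambda>n. scale_op K (theta I p n u) (rank_one I K (\<xi> n) (\<eta> n))"
  have near: "op_near I K d (opK (opv u)) (\<lambda>\<zeta>. \<Sum>n\<in>F. ?f n \<zeta>)"
    if F: "finite F" "{1..m} \<subseteq> F" "F \<subseteq> {1..}" for F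
    unfolding op_near_def
  proof
    fix \<zeta> assume \<zeta>: "\<zeta> \<in> K"
    have fK: "?f n \<zeta> \<in> K" if "n \<in> F" for n by (rule term_vec(1)[OF r \<zeta>])
    have "norm (vec (opK (opv u) \<zeta>) t - vec (\<Sum>n\<in>F. ?f n \<zeta>) t) \<le> d * mod_norm I \<zeta>" for t
    proof -
      let ?g = "\<lambda>k. s k t *\<^sub>R ksc (cinner (vec \<zeta> t) (y k t)) (x k t)"
      \<comment> \<open>The shift between the two numberings is injective only because F avoids
        0.\<close>
      have inj: "inj_on (\<lambda>n. n - 1) F"
      proof (rule inj_onI)
        fix a b assume ab: "a \<in> F" "b \<in> F" "a - 1 = b - 1"
        then have "a \<ge> 1" "b \<ge> 1" using F(3) by auto
        with ab(3) show "a = b" by simp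
      qed
      have "vec (\<Sum>n\<in>F. ?f n \<zeta>) t = (\<Sum>n\<in>F. vec (?f n \<zeta>) t)"
        by (rule fun_cong[OF K_sum(2)[of F "\<lambda>n. ?f n \<zeta>", OF fK]])
      also have "\<dots> = (\<Sum>n\<in>F. ?g (n - 1))" by (rule sum.cong[OF refl]) (rule term_vec(2)[OF r \<zeta>])
      also have "\<dots> = (\<Sum>k\<in>(\<lambda>n. n - 1) ` F. ?g k)"
        unfolding sum.reindex[OF inj] by (simp only: o_def)
      finally have eq: "vec (\<Sum>n\<in>F. ?f n \<zeta>) t = (\<Sum>k\<in>(\<lambda>n. n - 1) ` F. ?g k)" .
      have sub: "{..<m} \<subseteq> (\<lambda>n. n - 1) ` F"
      proof
        fix k assume "k \<in> {..<m}"
        then have "Suc k \<in> F" using F(2) by auto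
        then show "k \<in> (\<lambda>n. n - 1) ` F" by (rule rev_image_eqI) simp
      qed
      have "norm (opv u t (vec \<zeta> t) - (\<Sum>k\<in>(\<lambda>n. n - 1) ` F. ?g k)) \<le> s m t * norm (vec \<zeta> t)"
        by (rule svd_atD(8)[OF svd finite_imageI[OF F(1)] sub])
      also have "\<dots> \<le> d * mod_norm I \<zeta>"
        by (intro mult_mono mod_norm_vec(1)[OF \<zeta>]) (use m \<open>d > 0\<close> in auto)
      finally show ?thesis by (simp only: eq opK_vec(2)[OF opv_happrox \<zeta>])
    qed
    moreover have "0 \<le> d * mod_norm I \<zeta>" using \<open>d > 0\<close> mod_norm_nonneg[of \<zeta>] by simp
    ultimately show "mod_norm I (opK (opv u) \<zeta> - (\<Sum>n\<in>F. ?f n \<zeta>)) \<le> d * mod_norm I \<zeta>"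
      using mod_norm_near[OF HK[OF opK_vec(1)[OF opv_happrox \<zeta>]] K_sum(1)[of F "\<lambda>n. ?f n \<zeta>", OF fK]]
      by blast
  qed
  show "\<exists>F0. finite F0 \<and> F0 \<subseteq> {1..} \<and> (\<forall>F. finite F \<and> F0 \<subseteq> F \<and> F \<subseteq> {1..} \<longrightarrow>
      op_near I K d (opK (opv u)) (\<lambda>\<zeta>. \<Sum>n\<in>F. ?f n \<zeta>))"
    by (rule exI[of _ "{1..m}"]) (use near in auto)
qed

text \<open>Stated for any decomposition of this kind, not only the constructed one. Applied to
  \<xi> m, every finite partial sum containing the index m has the single surviving term \<theta> e
  \<xi> m, and \<theta> e = \<theta>; the limit is therefore attained.\<close>

theorem eigenvectors:
  assumes orth: "u_orthonormal I p u \<xi>"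
    and sum: "compact_has_sum I K (\<lambda>n. scale_op K (theta I p n u) (rank_one I K (\<xi> n) (\<xi> n)))
      (compact_incl I p u) {1..}" and m: "m \<ge> 1"
  shows "compact_incl I p u (\<xi> m) = (\<lambda>i. theta I p m u * \<xi> m i)"
    "(\<lambda>i. theta I p m u * \<xi> m i) \<in> H"
proof -
  let ?f = "\<lambda>n. scale_op K (theta I p n u) (rank_one I K (\<xi> n) (\<xi> n))"
  have K: "\<xi> n \<in> K" if "n \<ge> 1" for n using orth that by (simp add: u_orthonormal_def)
  have mm: "\<xi> m \<in> K" by (rule K[OF m])
  have "continuous_on (U_set I p m u) (vec (\<xi> m))"
    using orth m unfolding psi_continuous_iff[OF mm, symmetric] by (simp add: u_orthonormal_def)
  moreover have "{t. apply_bcontfun (theta I p m u) t \<noteq> 0} = U_set I p m u"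
    by (simp add: theta_s U_set_s)
  ultimately show H': "(\<lambda>i. theta I p m u * \<xi> m i) \<in> H" by (intro scaled_H[OF mm]) simp
  have inner: "mod_inner I (\<xi> m) (\<xi> n) t = (if n = m then apply_bcontfun (e_fun I p m u) t else 0)"
    if n: "n \<ge> 1" for n t
  proof (cases "m \<le> n")
    case True
    then have "mod_inner I (\<xi> m) (\<xi> n) = (if m = n then e_fun I p n u else 0)"
      using orth m by (simp add: u_orthonormal_def)
    then show ?thesis by auto
  next
    case False
    then have "mod_inner I (\<xi> n) (\<xi> m) = 0" using orth n by (simp add: u_orthonormal_def)
    then show ?thesis using inner_commute[OF K[OF n] mm, of t] False by simp
  qed
  have f0: "?f n (\<xi> m) = (if n = m then (\<lambda>i. theta I p m u * \<xi> m i) else 0)" if n: "n \<ge> 1" for n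
  proof (intro ext bcontfun_eqI)
    fix i t
    have "?f n (\<xi> m) i t = of_real (s (n - 1) t) * (\<xi> n i t * mod_inner I (\<xi> m) (\<xi> n) t)"
      using mm by (simp add: scale_op_def rank_one_def theta_s)
    \<comment> \<open>The indicator e is 1 wherever \<theta> is nonzero, so multiplying by it
      changes nothing.\<close>
    moreover have "of_real (s (m - 1) t) * apply_bcontfun (e_fun I p m u) t = (of_real (s (m - 1) t) :: 'k)"
    proof (cases "t \<in> U_set I p m u")
      case True
      then show ?thesis using subsetD[OF closure_subset True] by (simp add: e_fun_indicator)
    qed (simp add: U_set_s)
    ultimately show "?f n (\<xi> m) i t = apply_bcontfun ((if n = m then (\<lambda>i. theta I p m u * \<xi> m i) else 0) i) t"
      using inner[OF n, of t]
      by (cases "n = m") (simp_all add: theta_s mult.left_commute[of "of_real (s (m - Suc 0) t)"] mult.commute)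
  qed
  have uK: "compact_incl I p u (\<xi> m) \<in> K"
  proof -
    have "compact_incl I p u \<in> compact_ops I K" using sum by (simp add: compact_has_sum_def)
    then have "compact_incl I p u \<in> K \<rightarrow>\<^sub>E K" by (auto simp: compact_ops_def adjointable_ops_def)
    then show ?thesis using mm by auto
  qed
  show "compact_incl I p u (\<xi> m) = (\<lambda>i. theta I p m u * \<xi> m i)"
  proof (rule vec_eqI[OF uK HK[OF H']])
    fix t
    have "vec (compact_incl I p u (\<xi> m)) t - vec (\<lambda>i. theta I p m u * \<xi> m i) t = 0"
    proof (rule zero_of_small)
      fix d :: real assume d: "d > 0"
      have "\<exists>F0. finite F0 \<and> F0 \<subseteq> {1..} \<and> (\<forall>F. finite F \<and> F0 \<subseteq> F \<and> F \<subseteq> {1..} \<longrightarrow>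
          op_near I K d (compact_incl I p u) (\<lambda>\<zeta>. \<Sum>n\<in>F. ?f n \<zeta>))"
        using sum d by (simp add: compact_has_sum_def)
      then obtain F0 where F0: "finite F0" "F0 \<subseteq> {1..}" and near: "\<forall>F. finite F \<and> F0 \<subseteq> F \<and> F \<subseteq> {1..} \<longrightarrow>
          op_near I K d (compact_incl I p u) (\<lambda>\<zeta>. \<Sum>n\<in>F. ?f n \<zeta>)"
        by (elim exE conjE) (rule that)
      let ?F = "insert m F0"
      have F: "finite ?F \<and> F0 \<subseteq> ?F \<and> ?F \<subseteq> {1..}" using F0 m by auto
      have nearF: "op_near I K d (compact_incl I p u) (\<lambda>\<zeta>. \<Sum>n\<in>?F. ?f n \<zeta>)"
        by (rule near[THEN spec, THEN mp, OF F])
      have "(\<Sum>n\<in>?F. ?f n (\<xi> m)) = (\<Sum>n\<in>?F. if n = m then (\<lambda>i. theta I p m u * \<xi> m i) else 0)"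
        by (rule sum.cong[OF refl], rule f0) (use F in auto)
      also have "\<dots> = (\<lambda>i. theta I p m u * \<xi> m i)" using F by (subst sum.delta) auto
      finally have eq: "(\<Sum>n\<in>?F. ?f n (\<xi> m)) = (\<lambda>i. theta I p m u * \<xi> m i)" .
      have "mod_norm I (compact_incl I p u (\<xi> m) - (\<Sum>n\<in>?F. ?f n (\<xi> m))) \<le> d * mod_norm I (\<xi> m)"
        using nearF mm unfolding op_near_def by (rule bspec)
      then have "mod_norm I (compact_incl I p u (\<xi> m) - (\<lambda>i. theta I p m u * \<xi> m i)) \<le> d * mod_norm I (\<xi> m)"
        unfolding eq .
      then show "norm (vec (compact_incl I p u (\<xi> m)) t - vec (\<lambda>i. theta I p m u * \<xi> m i) t)
          \<le> d * mod_norm I (\<xi> m)"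
        using mod_norm_near[OF uK HK[OF H'], of "d * mod_norm I (\<xi> m)"] d mod_norm_nonneg[of "\<xi> m"] by simp
    qed (rule mod_norm_nonneg)
    then show "vec (compact_incl I p u (\<xi> m)) t = vec (\<lambda>i. theta I p m u * \<xi> m i) t" by simp
  qed
qed

lemma realizes_orthonormal_x: "realizes x \<xi> \<Longrightarrow> u_orthonormal I p u \<xi>"
  by (rule realizes_orthonormal[OF _ cx svd_atD(3)[OF svd] svd_atD(5)[OF svd]])

lemma realizes_orthonormal_y: "realizes y \<xi> \<Longrightarrow> u_orthonormal I p u \<xi>"
  by (rule realizes_orthonormal[OF _ cy svd_atD(4)[OF svd] svd_atD(6)[OF svd]])

end

theorem theorem2p9:
  fixes I :: "'i set"
    and p :: "'i \<Rightarrow> ('t::t2_space \<Rightarrow>\<^sub>C 'k::rclike)"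
    and u :: "('i, 't, 'k) mod_op"
  assumes hyper: "hyperstonian TYPE('t)"
    and proj: "\<And>i. i \<in> I \<Longrightarrow> projection (p i)"
    and u: "u \<in> compact_ops I (Hmod I p)"
  shows "(positive_op I (Hmod I p) u \<longrightarrow>
      (\<exists>\<xi>. u_orthonormal I p u \<xi> \<and>
        compact_has_sum I (Kmod I p)
          (\<lambda>n. scale_op (Kmod I p) (theta I p n u) (rank_one I (Kmod I p) (\<xi> n) (\<xi> n)))
          (compact_incl I p u) {1..}) \<and>
      (\<forall>\<xi>. u_orthonormal I p u \<xi> \<and>
        compact_has_sum I (Kmod I p)
          (\<lambda>n. scale_op (Kmod I p) (theta I p n u) (rank_one I (Kmod I p) (\<xi> n) (\<xi> n)))
          (compact_incl I p u) {1..} \<longrightarrow>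
        (\<forall>n\<ge>1. compact_incl I p u (\<xi> n) = (\<lambda>i. theta I p n u * \<xi> n i) \<and>
                (\<lambda>i. theta I p n u * \<xi> n i) \<in> Hmod I p))) \<and>
    (\<exists>\<xi> \<eta>. u_orthonormal I p u \<xi> \<and> u_orthonormal I p u \<eta> \<and>
        compact_has_sum I (Kmod I p)
          (\<lambda>n. scale_op (Kmod I p) (theta I p n u) (rank_one I (Kmod I p) (\<xi> n) (\<eta> n)))
          (compact_incl I p u) {1..})"
proof -
  interpret compact_module_op "TYPE('t)" I p u
    by unfold_locales (fact hyper proj u)+
  obtain s x y where sxy: "\<And>t. svd_at (opv u t) (\<lambda>n. s n t) (\<lambda>n. x n t) (\<lambda>n. y n t)"
    "\<And>n. continuous_on UNIV (s n)" "\<And>n. continuous_on {t. s n t \<noteq> 0} (x n)"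
    "\<And>n. continuous_on {t. s n t \<noteq> 0} (y n)" "\<And>d. d > 0 \<Longrightarrow> \<exists>n. \<forall>t. s n t \<le> d"
    and xy: "\<And>n t. cpos (opv u t) \<Longrightarrow> x n t = y n t"
    by (rule svd_family[OF happrox_fin_approx[OF opv_happrox]]) (rule that)
  interpret svd_module "TYPE('t)" I p u s x y
    by unfold_locales (fact sxy)+
  obtain \<xi> where \<xi>: "realizes x \<xi>" by (rule realizes_x)
  obtain \<eta> where \<eta>: "realizes y \<eta>" by (rule realizes_y)
  show ?thesis
  proof (rule conjI[OF impI[OF conjI]])
    assume "positive_op I H u"
    \<comment> \<open>For positive u the left and right singular vectors agree, so one sequence
      realizes both families.\<close>
    then have "x = y" using xy opv_positive by (intro ext) blast
    then have "realizes x \<eta>" using \<eta> by simp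
    from realizes_orthonormal_y[OF \<eta>] decomposition[OF this \<eta>]
    show "\<exists>\<xi>. u_orthonormal I p u \<xi> \<and>
        compact_has_sum I K (\<lambda>n. scale_op K (theta I p n u) (rank_one I K (\<xi> n) (\<xi> n))) (compact_incl I p u) {1..}"
      by (intro exI[of _ \<eta>] conjI)
  next
    show "\<forall>\<xi>. u_orthonormal I p u \<xi> \<and>
        compact_has_sum I K (\<lambda>n. scale_op K (theta I p n u) (rank_one I K (\<xi> n) (\<xi> n))) (compact_incl I p u) {1..} \<longrightarrow>
        (\<forall>n\<ge>1. compact_incl I p u (\<xi> n) = (\<lambda>i. theta I p n u * \<xi> n i) \<and> (\<lambda>i. theta I p n u * \<xi> n i) \<in> H)"
    proof (intro allI impI)
      fix \<xi> and n :: nat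
      assume *: "u_orthonormal I p u \<xi> \<and>
        compact_has_sum I K (\<lambda>n. scale_op K (theta I p n u) (rank_one I K (\<xi> n) (\<xi> n))) (compact_incl I p u) {1..}"
        and n: "1 \<le> n"
      show "compact_incl I p u (\<xi> n) = (\<lambda>i. theta I p n u * \<xi> n i) \<and> (\<lambda>i. theta I p n u * \<xi> n i) \<in> H"
        by (rule conjI[OF eigenvectors[OF conjunct1[OF *] conjunct2[OF *] n]])
    qed
  next
    show "\<exists>\<xi> \<eta>. u_orthonormal I p u \<xi> \<and> u_orthonormal I p u \<eta> \<and>
        compact_has_sum I K (\<lambda>n. scale_op K (theta I p n u) (rank_one I K (\<xi> n) (\<eta> n))) (compact_incl I p u) {1..}"
      by (rule exI[of _ \<xi>], rule exI[of _ \<eta>],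
          intro conjI realizes_orthonormal_x[OF \<xi>] realizes_orthonormal_y[OF \<eta>] decomposition[OF \<xi> \<eta>])
  qed
qed

end
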